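(* Let $\kappa>0$, $R>0$, and let $\boldsymbol J\in(L^2(B_R))^3$ be a source with compact support contained in $B_R$. Suppose that $\gamma_n^m=0$ for all $n=0,1,\dots$ and $m=-n,\dots,n$. Then $\boldsymbol J$ is nonradiating if and only if its far-field pattern $$\boldsymbol E_\infty(\hat x)=\hat{\boldsymbol G}(\hat x)\int_{B_R}e^{-\mathrm i\kappa\hat x\cdot y}\boldsymbol J(y)\,\mathrm dy=4\pi\sum_{n=0}^{\infty}\sum_{m=-n}^{n}(-\mathrm i)^n\big(\hat{\boldsymbol G}(\hat x)\alpha_n^m\big)Y_n^m(\hat x)$$ is equal to zero (for all unit vectors $\hat x\in\mathbb R^3$).
   Context: $B_R=\{x\in\mathbb R^3:|x|<R\}$, $\kappa>0$ is the wavenumber, $g(x,y)=\frac{e^{\mathrm i\kappa|x-y|}}{4\pi|x-y|}$, and $\boldsymbol G(x,y)=[\boldsymbol I+\kappa^{-2}\nabla\nabla]g(x,y)$ is the $3\times3$ dyadic Green's tensor of Maxwell's equations ($\nabla\nabla$ is the Hessian). The electric field generated by $\boldsymbol J$ is $\boldsymbol E(x)=\int_{B_R}\boldsymbol G(x,y)\boldsymbol J(y)\,\mathrm dy$. A source $\boldsymbol J$ with compact support contained in $B_R$ is called nonradiating if this $\boldsymbol E$ is identically zero outside $B_R$. $\hat{\boldsymbol G}(\hat x)$ is the $3\times 3$ matrix with entries $\delta_{ls}-\hat x_l\hat x_s$, $l,s=1,2,3$, for a unit vector $\hat x=(\hat x_1,\hat x_2,\hat x_3)$. Let $j_n$ be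 the spherical Bessel function of order $n$, $\{Y_n^m\}$ the orthonormal spherical harmonics on the unit sphere, $\hat y=y/|y|$, and $\alpha_n^m=\int_{B_R}j_n(\kappa|y|)\overline{Y_n^m(\hat y)}\boldsymbol J(y)\,\mathrm dy\in\mathbb C^3$, $\gamma_n^m=\kappa^{-2}\int_{B_R}\big(\nabla_y\nabla_y\,[j_n(\kappa|y|)\overline{Y_n^m(\hat y)}]\big)\boldsymbol J(y)\,\mathrm dy\in\mathbb C^3$ (Hessian matrix applied to $\boldsymbol J$). *)

theory Defs
  imports "HOL-Analysis.Analysis" "HOL-Computational_Algebra.Polynomial"
begin

subsection \<open>Hessian of a complex-valued function on three-space\<close>

definition partial_deriv :: "3 \<Rightarrow> (real^3 \<Rightarrow> complex) \<Rightarrow> real^3 \<Rightarrow> complex" where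
  "partial_deriv l f x = vector_derivative (\<lambda>t. f (x + t *\<^sub>R axis l 1)) (at 0)"

definition hessian :: "(real^3 \<Rightarrow> complex) \<Rightarrow> real^3 \<Rightarrow> complex^3^3" where
  "hessian f x = (\<chi> l s. partial_deriv l (partial_deriv s f) x)"

subsection \<open>Green's function and Green's tensor\<close>

definition green_fun :: "real \<Rightarrow> real^3 \<Rightarrow> real^3 \<Rightarrow> complex" where
  "green_fun \<kappa> x y = exp (\<i> * of_real (\<kappa> * norm (x - y))) / of_real (4 * pi * norm (x - y))"

text \<open>The Hessian is taken in the first argument; as \<^const>\<open>green_fun\<close> depends on
  \<^term>\<open>norm (x - y)\<close> only, taking it in the second one gives the same tensor.\<close>

definition green_tensor :: "real \<Rightarrow> real^3 \<Rightarrow> real^3 \<Rightarrow> complex^3^3" where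
  "green_tensor \<kappa> x y = mat (green_fun \<kappa> x y) + (1 / \<kappa>\<^sup>2) *\<^sub>R hessian (\<lambda>z. green_fun \<kappa> z y) x"

subsection \<open>Sources and their fields\<close>

definition L2_on :: "(real^3) set \<Rightarrow> (real^3 \<Rightarrow> complex^3) set" where
  "L2_on \<Omega> = {J. J \<in> borel_measurable (lebesgue_on \<Omega>) \<and>
                  integrable (lebesgue_on \<Omega>) (\<lambda>y. (norm (J y))\<^sup>2)}"

text \<open>Elements of \<^const>\<open>L2_on\<close> matter only up to null sets, so the support is the essential
  one, relative to \<open>\<Omega>\<close>. It is contained in \<open>\<Omega>\<close>; for open \<open>\<Omega>\<close> its compactness says that
  \<open>J\<close> vanishes almost everywhere off a compact subset of \<open>\<Omega>\<close>.\<close>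

definition ess_support :: "(real^3) set \<Rightarrow> (real^3 \<Rightarrow> complex^3) \<Rightarrow> (real^3) set" where
  "ess_support \<Omega> J =
     \<Omega> - \<Union>{U. open U \<and> (AE y in lebesgue_on \<Omega>. y \<in> U \<longrightarrow> J y = 0)}"

text \<open>Used only for \<open>x\<close> outside the ball: inside the support the kernel is not integrable.\<close>

definition electric_field ::
  "real \<Rightarrow> real \<Rightarrow> (real^3 \<Rightarrow> complex^3) \<Rightarrow> real^3 \<Rightarrow> complex^3" where
  "electric_field \<kappa> R J x = (LINT y|lebesgue_on (ball 0 R). green_tensor \<kappa> x y *v J y)"

definition nonradiating :: "real \<Rightarrow> real \<Rightarrow> (real^3 \<Rightarrow> complex^3) \<Rightarrow> bool" where
  "nonradiating \<kappa> R J \<longleftrightarrow> (\<forall>x. x \<notin> ball 0 R \<longrightarrow> electric_field \<kappa> R J x = 0)"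

definition G_hat :: "real^3 \<Rightarrow> complex^3^3" where
  "G_hat x = (\<chi> l s. of_real ((if l = s then 1 else 0) - x $ l * x $ s))"

definition far_field ::
  "real \<Rightarrow> real \<Rightarrow> (real^3 \<Rightarrow> complex^3) \<Rightarrow> real^3 \<Rightarrow> complex^3" where
  "far_field \<kappa> R J x =
     G_hat x *v (LINT y|lebesgue_on (ball 0 R). exp (- \<i> * of_real (\<kappa> * (x \<bullet> y))) *s J y)"

subsection \<open>Spherical Bessel functions and spherical harmonics\<close>

text \<open>The power series
  \[ j_n(t) = \sum_{p=0}^\infty \frac{(-1)^p\, t^{n+2p}}{2^p\, p!\, 1 \cdot 3 \cdots (2n+2p+1)}. \]\<close>

definition spherical_bessel :: "nat \<Rightarrow> real \<Rightarrow> real" where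
  "spherical_bessel n t =
     (\<Sum>p. (-1) ^ p * t ^ (n + 2 * p) / (2 ^ p * fact p * (\<Prod>i\<le>n + p. real (2 * i + 1))))"

text \<open>Rodrigues' formula.\<close>

definition legendre_poly :: "nat \<Rightarrow> real poly" where
  "legendre_poly n = smult (1 / (2 ^ n * fact n)) ((pderiv ^^ n) ([:-1, 0, 1:] ^ n))"

definition assoc_legendre :: "nat \<Rightarrow> nat \<Rightarrow> real \<Rightarrow> real" where
  "assoc_legendre n m t = sqrt (1 - t\<^sup>2) ^ m * poly ((pderiv ^^ m) (legendre_poly n)) t"

text \<open>At the unit vector \<open>x\<close> with polar angle \<open>\<theta>\<close> and azimuth \<open>\<phi>\<close> this is
  \[ Y_n^m = \sqrt{\frac{2n+1}{4\pi} \frac{(n-|m|)!}{(n+|m|)!}}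
       \; P_n^{|m|}(\cos\theta)\, e^{\mathrm{i} m \phi}, \]
  where \<open>cos \<theta> = x $ 3\<close>, \<open>\<phi> = Arg (x $ 1 + \<i> x $ 2)\<close>, and no Condon--Shortley sign is used.
  At the poles the choice of \<open>\<phi>\<close> is immaterial, as \<open>P_n^{|m|}\<close> vanishes there unless
  \<open>m = 0\<close>.\<close>

definition sph_harmonic :: "nat \<Rightarrow> int \<Rightarrow> real^3 \<Rightarrow> complex" where
  "sph_harmonic n m x =
     of_real (sqrt ((2 * real n + 1) / (4 * pi) * (fact (n - nat \<bar>m\<bar>) / fact (n + nat \<bar>m\<bar>)))
              * assoc_legendre n (nat \<bar>m\<bar>) (x $ 3))
     * cis (of_int m * Arg (Complex (x $ 1) (x $ 2)))"

text \<open>The regular wave function \<open>j_n(\<kappa>|y|)\<close> times the conjugate of \<open>Y_n^m(y/|y|)\<close>. It is smooth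
  on all of three-space, including the origin, where \<open>y/|y|\<close> becomes \<open>0\<close>: there \<open>j_n\<close> is zero
  for \<open>n > 0\<close>, and \<open>Y_0^0\<close> is constant.\<close>

definition wave_fun :: "real \<Rightarrow> nat \<Rightarrow> int \<Rightarrow> real^3 \<Rightarrow> complex" where
  "wave_fun \<kappa> n m y =
     of_real (spherical_bessel n (\<kappa> * norm y)) * cnj (sph_harmonic n m (y /\<^sub>R norm y))"

definition alpha_coeff ::
  "real \<Rightarrow> real \<Rightarrow> (real^3 \<Rightarrow> complex^3) \<Rightarrow> nat \<Rightarrow> int \<Rightarrow> complex^3" where
  "alpha_coeff \<kappa> R J n m = (LINT y|lebesgue_on (ball 0 R). wave_fun \<kappa> n m y *s J y)"

definition gamma_coeff ::
  "real \<Rightarrow> real \<Rightarrow> (real^3 \<Rightarrow> complex^3) \<Rightarrow> nat \<Rightarrow> int \<Rightarrow> complex^3" where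
  "gamma_coeff \<kappa> R J n m =
     (1 / \<kappa>\<^sup>2) *\<^sub>R (LINT y|lebesgue_on (ball 0 R). hessian (wave_fun \<kappa> n m) y *v J y)"

end

theory Submission
  imports Defs "HOL-Complex_Analysis.Complex_Analysis"
begin

text \<open>
  Let \<open>J_hat x\<close> be the integral of \<open>e\<^sup>-\<^sup>i\<^sup>\<kappa>\<^sup>x\<^sup>\<cdot>\<^sup>y J y\<close>, the Fourier transform of the source on the sphere of
  radius \<open>\<kappa>\<close>. The far-field pattern is its part orthogonal to \<open>x\<close>. The source vanishes almost
  everywhere outside a closed ball of some radius \<open>r < R\<close>.

  The plane wave has the expansion into regular wave functions. It follows from the addition theorem
  (\<open>sph_harmonic_addition\<close>) and from \<open>plane_wave_expansion\<close>: both sides of the first obey the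
  same three-term recurrence in the degree, both sides of the second the same differential equation
  in a scaling parameter. The series converges faster than any geometric series, uniformly on bounded
  sets of complex arguments. Hence it may be integrated against \<open>J\<close>, which gives the series for the
  far field, and it may also be differentiated twice term by term. As the Hessian of the plane
  wave is \<open>- \<kappa>\<^sup>2 x x\<^sup>T\<close> times the plane wave, vanishing of all \<open>\<gamma>\<^sub>n\<^sup>m\<close> means \<open>x \<bullet> J_hat x = 0\<close>
  (\<open>gamma_zero_imp_transversal\<close>), and then the far-field pattern is \<open>J_hat\<close> itself.

  If the source is nonradiating, its field vanishes along every ray, and the far-field pattern is the
  limit of \<open>4 \<pi> t e\<^sup>-\<^sup>i\<^sup>\<kappa>\<^sup>t E (t x)\<close> (\<open>green_entry_asymptotic\<close>).

  Conversely, let \<open>J_hat\<close> vanish on the unit sphere. For \<open>x = e / \<tau>\<close> the Green function is an explicit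
  factor times a kernel \<open>\<Phi> \<tau>\<close> that is holomorphic for \<open>|\<tau>| < 1 / r\<close>, and the Helmholtz equation becomes
  \<open>\<tau>\<^sup>2 \<Phi>'' + (2 \<tau> - 2 \<i> \<kappa>) \<Phi>' + \<Delta> \<Phi> = 0\<close> with the Laplace--Beltrami operator \<open>\<Delta>\<close> in \<open>e\<close>. After
  integration against a component of \<open>J\<close>, the Taylor coefficient of order zero is \<open>J_hat e = 0\<close>, and
  the equation expresses each further coefficient by the previous one and its image under \<open>\<Delta>\<close>. So all
  coefficients vanish (\<open>aw_coefficients_vanish\<close>, the recursion of Atkinson and Wilcox), the scalar potential of
  \<open>J\<close> vanishes for \<open>|x| > r\<close> (\<open>green_potential_zero\<close>), and with it its second derivatives, which
  make up the electric field.
\<close>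


unbundle no fps_syntax

section \<open>Derivatives of Legendre polynomials\<close>

definition rodrigues_base :: "nat \<Rightarrow> real poly" where
  "rodrigues_base n = [:-1, 0, 1:] ^ n"

lemma pderiv_rodrigues_base:
  "pderiv (rodrigues_base (Suc n)) = smult (2 * real (Suc n)) ([:0, 1:] * rodrigues_base n)"
  unfolding rodrigues_base_def pderiv_power_Suc
  by (simp add: pderiv_pCons algebra_simps)

lemma pderiv2_rodrigues_base:
  "pderiv (pderiv (rodrigues_base (Suc (Suc n)))) =
     smult (2 * real (Suc (Suc n)))
       (smult (2 * real n + 3) (rodrigues_base (Suc n)) + smult (2 * real n + 2) (rodrigues_base n))"
proof -
  have sq: "[:0, 1:] * ([:0, 1:] * rodrigues_base n) = rodrigues_base (Suc n) + rodrigues_base n"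
  proof -
    have "rodrigues_base (Suc n) + rodrigues_base n = ([:-1, 0, 1:] + 1) * rodrigues_base n"
      unfolding rodrigues_base_def by (simp add: algebra_simps)
    also have "[:-1, 0, 1:] + 1 = [:0,1:] * [:0,1::real:]" by (simp add: one_pCons)
    finally show ?thesis by (simp only: mult.assoc)
  qed
  have "pderiv (pderiv (rodrigues_base (Suc (Suc n)))) =
     smult (2 * real (Suc (Suc n))) (rodrigues_base (Suc n)
       + [:0, 1:] * smult (2 * real (Suc n)) ([:0, 1:] * rodrigues_base n))"
    unfolding pderiv_rodrigues_base pderiv_smult pderiv_mult
    by (simp add: pderiv_pCons algebra_simps)
  also have "[:0, 1:] * smult (2 * real (Suc n)) ([:0, 1:] * rodrigues_base n)
      = smult (2 * real (Suc n)) (rodrigues_base (Suc n) + rodrigues_base n)"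
    by (simp only: mult_smult_right sq)
  also have "rodrigues_base (Suc n) + smult (2 * real (Suc n)) (rodrigues_base (Suc n) + rodrigues_base n)
     = smult (2 * real n + 3) (rodrigues_base (Suc n)) + smult (2 * real n + 2) (rodrigues_base n)"
    by (rule poly_eqI) (simp add: algebra_simps)
  finally show ?thesis .
qed

lemma higher_pderiv_add_smult:
  fixes p q :: "real poly"
  shows "(pderiv ^^ k) (smult c p + smult d q) = smult c ((pderiv ^^ k) p) + smult d ((pderiv ^^ k) q)"
  by (simp add: higher_pderiv_add higher_pderiv_smult)

lemma higher_pderiv_diff_smult:
  fixes p q :: "real poly"
  shows "(pderiv ^^ k) (smult c p - smult d q) = smult c ((pderiv ^^ k) p) - smult d ((pderiv ^^ k) q)"
  using higher_pderiv_add_smult[of k c p "- d" q] by simp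

lemma higher_pderiv_X_mult:
  fixes q :: "real poly"
  shows "(pderiv ^^ k) ([:0,1:] * q) = [:0,1:] * (pderiv ^^ k) q + smult (real k) ((pderiv ^^ (k - 1)) q)"
proof (induction k)
  case 0
  then show ?case by simp
next
  case (Suc k)
  show ?case
  proof (cases k)
    case 0
    then show ?thesis by (simp add: pderiv_mult pderiv_pCons)
  next
    case (Suc j)
    have "(pderiv ^^ Suc k) ([:0,1:] * q) = pderiv ([:0,1:] * (pderiv ^^ k) q + smult (real k) ((pderiv ^^ (k - 1)) q))"
      using Suc.IH by simp
    also have "\<dots> = [:0,1:] * (pderiv ^^ Suc k) q + (pderiv ^^ k) q + smult (real k) ((pderiv ^^ k) q)"
      using Suc by (simp add: pderiv_mult pderiv_pCons pderiv_add pderiv_smult algebra_simps)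
    also have "\<dots> = [:0,1:] * (pderiv ^^ Suc k) q + smult (real (Suc k)) ((pderiv ^^ k) q)"
      by (rule poly_eqI) (simp add: algebra_simps)
    finally show ?thesis by simp
  qed
qed

lemma legendre_poly_0: "legendre_poly 0 = 1"
  by (simp add: legendre_poly_def)

lemma legendre_poly_1: "legendre_poly (Suc 0) = [:0,1:]"
  by (simp add: legendre_poly_def pderiv_pCons)

lemma legendre_alt: "smult (2 ^ n * fact n) (legendre_poly n) = (pderiv ^^ n) (rodrigues_base n)"
  by (simp add: legendre_poly_def rodrigues_base_def)

text \<open>The polynomial \<open>V\<close> is the integral of \<open>P\<^sub>n\<^sub>+\<^sub>1\<close> that Rodrigues' formula provides (one derivative
  less). Differentiating \<open>(t\<^sup>2 - 1)\<^sup>n\<^sup>+\<^sup>2\<close> once or twice before applying the remaining derivatives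
  gives two expressions for \<open>P\<^sub>n\<^sub>+\<^sub>2\<close> in terms of \<open>V\<close>. Eliminating \<open>V\<close> between them yields the
  three-term recurrence, and differentiating the first one yields \<open>dlegendre_lower\<close>.\<close>

lemma legendre_Suc_Suc_aux:
  fixes n :: nat
  defines "V \<equiv> smult (1 / (2 ^ Suc n * fact (Suc n))) ((pderiv ^^ n) (rodrigues_base (Suc n)))"
  shows "legendre_poly (Suc (Suc n)) = smult (2 * real n + 3) V + legendre_poly n"
    and "legendre_poly (Suc (Suc n)) = [:0,1:] * legendre_poly (Suc n) + smult (real n + 1) V"
proof -
  define c :: real where "c = 2 ^ Suc (Suc n) * fact (Suc (Suc n))"
  have c0: "c \<noteq> 0" by (simp add: c_def)
  have "smult c (legendre_poly (Suc (Suc n))) = (pderiv ^^ n) (pderiv (pderiv (rodrigues_base (Suc (Suc n)))))"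
    unfolding c_def legendre_alt by (simp add: funpow_swap1)
  also have "\<dots> = smult (2 * real (Suc (Suc n)))
       (smult (2 * real n + 3) ((pderiv ^^ n) (rodrigues_base (Suc n))) +
        smult (2 * real n + 2) ((pderiv ^^ n) (rodrigues_base n)))"
    unfolding pderiv2_rodrigues_base by (simp only: higher_pderiv_smult higher_pderiv_add_smult)
  also have "(pderiv ^^ n) (rodrigues_base n) = smult (2 ^ n * fact n) (legendre_poly n)"
    by (simp add: legendre_alt)
  also have "(pderiv ^^ n) (rodrigues_base (Suc n)) = smult (2 ^ Suc n * fact (Suc n)) V"
    by (simp add: V_def)
  also have "smult (2 * real (Suc (Suc n)))
       (smult (2 * real n + 3) (smult (2 ^ Suc n * fact (Suc n)) V) +
        smult (2 * real n + 2) (smult (2 ^ n * fact n) (legendre_poly n)))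
     = smult c (smult (2 * real n + 3) V + legendre_poly n)"
    unfolding c_def by (rule poly_eqI) (simp add: algebra_simps)
  finally show "legendre_poly (Suc (Suc n)) = smult (2 * real n + 3) V + legendre_poly n"
    using c0 by (metis smult_cancel)
next
  define c :: real where "c = 2 ^ Suc (Suc n) * fact (Suc (Suc n))"
  have c0: "c \<noteq> 0" by (simp add: c_def)
  have "smult c (legendre_poly (Suc (Suc n))) = (pderiv ^^ Suc n) (pderiv (rodrigues_base (Suc (Suc n))))"
    unfolding c_def legendre_alt by (simp add: funpow_swap1)
  also have "\<dots> = smult (2 * real (Suc (Suc n)))
       ([:0,1:] * (pderiv ^^ Suc n) (rodrigues_base (Suc n)) +
        smult (real (Suc n)) ((pderiv ^^ n) (rodrigues_base (Suc n))))"
    unfolding pderiv_rodrigues_base higher_pderiv_smult higher_pderiv_X_mult by simp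
  also have "(pderiv ^^ Suc n) (rodrigues_base (Suc n)) = smult (2 ^ Suc n * fact (Suc n)) (legendre_poly (Suc n))"
    by (simp only: legendre_alt)
  also have "(pderiv ^^ n) (rodrigues_base (Suc n)) = smult (2 ^ Suc n * fact (Suc n)) V"
    by (simp add: V_def)
  also have "smult (2 * real (Suc (Suc n)))
       ([:0,1:] * smult (2 ^ Suc n * fact (Suc n)) (legendre_poly (Suc n)) +
        smult (real (Suc n)) (smult (2 ^ Suc n * fact (Suc n)) V))
     = smult c ([:0,1:] * legendre_poly (Suc n) + smult (real n + 1) V)"
    unfolding c_def by (rule poly_ext) (simp add: algebra_simps)
  finally show "legendre_poly (Suc (Suc n)) = [:0,1:] * legendre_poly (Suc n) + smult (real n + 1) V"
    using c0 by (metis smult_cancel)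
qed

lemma legendre_three_term:
  "smult (real n + 2) (legendre_poly (Suc (Suc n))) =
     smult (2 * real n + 3) ([:0,1:] * legendre_poly (Suc n)) - smult (real n + 1) (legendre_poly n)"
proof -
  define V where "V = smult (1 / (2 ^ Suc n * fact (Suc n))) ((pderiv ^^ n) (rodrigues_base (Suc n)))"
  note * = legendre_Suc_Suc_aux[of n, folded V_def]
  show ?thesis
  proof (rule poly_ext)
    fix t
    have 1: "poly (legendre_poly (Suc (Suc n))) t = (2 * real n + 3) * poly V t + poly (legendre_poly n) t"
      by (subst *(1)) simp
    have 2: "poly (legendre_poly (Suc (Suc n))) t = t * poly (legendre_poly (Suc n)) t + (real n + 1) * poly V t"
      by (subst *(2)) simp
    have "(2 * real n + 3) * poly (legendre_poly (Suc (Suc n))) t =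
        (2 * real n + 3) * (t * poly (legendre_poly (Suc n)) t) + (real n + 1) * ((2 * real n + 3) * poly V t)"
      by (subst 2) (simp add: algebra_simps)
    also have "(2 * real n + 3) * poly V t = poly (legendre_poly (Suc (Suc n))) t - poly (legendre_poly n) t"
      using 1 by simp
    finally show "poly (smult (real n + 2) (legendre_poly (Suc (Suc n)))) t = poly
         (smult (2 * real n + 3) ([:0,1:] * legendre_poly (Suc n)) - smult (real n + 1) (legendre_poly n)) t"
      by (simp add: algebra_simps)
  qed
qed

definition dlegendre :: "nat \<Rightarrow> nat \<Rightarrow> real \<Rightarrow> real" where
  "dlegendre n m t = poly ((pderiv ^^ m) (legendre_poly n)) t"

lemma dlegendre_step:
  "(real n + 2) * dlegendre (Suc (Suc n)) m t =
     (2 * real n + 3) * (t * dlegendre (Suc n) m t + real m * dlegendre (Suc n) (m - 1) t)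
       - (real n + 1) * dlegendre n m t"
proof -
  have "(pderiv ^^ m) (smult (real n + 2) (legendre_poly (Suc (Suc n)))) =
    smult (2 * real n + 3) ((pderiv ^^ m) ([:0,1:] * legendre_poly (Suc n)))
      - smult (real n + 1) ((pderiv ^^ m) (legendre_poly n))"
    unfolding legendre_three_term by (simp only: higher_pderiv_diff_smult)
  from arg_cong[OF this, of "\<lambda>p. poly p t"] show ?thesis
    unfolding dlegendre_def higher_pderiv_X_mult by (simp add: higher_pderiv_smult)
qed

lemma dlegendre_0: "dlegendre 0 m t = (if m = 0 then 1 else 0)"
  by (cases m) (simp_all add: dlegendre_def legendre_poly_0 funpow_swap1 del: funpow.simps add: funpow_Suc_right)

lemma dlegendre_1: "dlegendre (Suc 0) m t = (if m = 0 then t else if m = 1 then 1 else 0)"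
proof -
  have "(pderiv ^^ k) (0::real poly) = 0" for k by (induction k) auto
  then show ?thesis
    by (cases m; cases "m - 1") (simp_all add: dlegendre_def legendre_poly_1 funpow_Suc_right pderiv_pCons del: funpow.simps)
qed

lemma dlegendre_eq_0: "n < m \<Longrightarrow> dlegendre n m t = 0"
proof (induction n arbitrary: m rule: induct_nat_012)
  case 0 then show ?case by (simp add: dlegendre_0)
next
  case 1 then show ?case by (simp add: dlegendre_1)
next
  case (ge2 n)
  have "(real n + 2) * dlegendre (Suc (Suc n)) m t = 0"
    unfolding dlegendre_step using ge2 by simp
  then show ?case by (simp add: add_eq_0_iff)
qed

lemma dlegendre_lower:
  "(2 * real n + 3) * dlegendre (Suc n) m t = dlegendre (Suc (Suc n)) (Suc m) t - dlegendre n (Suc m) t"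
proof -
  define V where "V = smult (1 / (2 ^ Suc n * fact (Suc n))) ((pderiv ^^ n) (rodrigues_base (Suc n)))"
  have "smult (2 ^ Suc n * fact (Suc n)) (pderiv V) = smult (2 ^ Suc n * fact (Suc n)) (legendre_poly (Suc n))"
    unfolding legendre_alt by (simp add: V_def pderiv_smult)
  then have V: "pderiv V = legendre_poly (Suc n)"
    by (metis smult_cancel fact_nonzero mult_eq_0_iff power_not_zero zero_neq_numeral)
  have "(pderiv ^^ Suc m) (legendre_poly (Suc (Suc n))) =
     smult (2 * real n + 3) ((pderiv ^^ m) (pderiv V)) + (pderiv ^^ Suc m) (legendre_poly n)"
    by (subst legendre_Suc_Suc_aux(1), fold V_def)
       (simp only: higher_pderiv_add higher_pderiv_smult pderiv_add pderiv_smult funpow_Suc_right comp_apply)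
  then show ?thesis unfolding V dlegendre_def by simp
qed

text \<open>Together with \<open>dlegendre_lower\<close> and \<open>dlegendre_raise\<close> this expresses the products of
  \<open>P\<^sub>n\<^sub>+\<^sub>1\<^sup>m\<close> with the coordinates of a point of the sphere through degrees \<open>n\<close> and \<open>n + 2\<close> only.
  These are the three relations that the addition theorem needs.\<close>

lemma dlegendre_mult_X:
  "(2 * real n + 3) * (t * dlegendre (Suc n) m t) =
     (real n + 2 - real m) * dlegendre (Suc (Suc n)) m t + (real n + 1 + real m) * dlegendre n m t"
proof (cases m)
  case 0
  then show ?thesis using dlegendre_step[of n 0 t] by simp
next
  case (Suc j)
  have s: "(real n + 2) * dlegendre (Suc (Suc n)) m t =
     (2 * real n + 3) * (t * dlegendre (Suc n) m t + real m * dlegendre (Suc n) j t)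
       - (real n + 1) * dlegendre n m t"
    using dlegendre_step[of n m t] Suc by simp
  show ?thesis using s dlegendre_lower[of n j t, folded Suc] by algebra
qed

lemma dlegendre_raise:
  "(2 * real n + 3) * ((1 - t\<^sup>2) * dlegendre (Suc n) (Suc m) t) =
     (real n + 1 + real m) * (real n + 2 + real m) * dlegendre n m t
     - (real n + 1 - real m) * (real n + 2 - real m) * dlegendre (Suc (Suc n)) m t"
proof -
  have A: "t * dlegendre (Suc n) (Suc m) t = (real n + 1 - real m) * dlegendre (Suc n) m t + dlegendre n (Suc m) t"
  proof -
    have "(2 * real n + 3) * (t * dlegendre (Suc n) (Suc m) t) =
      (2 * real n + 3) * ((real n + 1 - real m) * dlegendre (Suc n) m t + dlegendre n (Suc m) t)"
    proof -
      have "real (Suc m) = real m + 1" by simp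
      with dlegendre_mult_X[of n t "Suc m"] dlegendre_lower[of n m t] show ?thesis by algebra
    qed
    then show ?thesis by (subst (asm) mult_cancel_left) auto
  qed
  have B: "t * dlegendre n (Suc m) t = dlegendre (Suc n) (Suc m) t - (real n + 1 + real m) * dlegendre n m t"
  proof (cases n)
    case 0
    then show ?thesis by (simp add: dlegendre_0 dlegendre_1)
  next
    case (Suc k)
    have "(2 * real k + 3) * (t * dlegendre n (Suc m) t) =
      (2 * real k + 3) * (dlegendre (Suc n) (Suc m) t - (real n + 1 + real m) * dlegendre n m t)"
    proof -
      have "real (Suc m) = real m + 1" "real n = real k + 1" using Suc by simp_all
      with dlegendre_mult_X[of k t "Suc m"] dlegendre_lower[of k m t] show ?thesis unfolding Suc by algebra
    qed
    then show ?thesis by (subst (asm) mult_cancel_left) auto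
  qed
  have "(1 - t\<^sup>2) * dlegendre (Suc n) (Suc m) t = dlegendre (Suc n) (Suc m) t - t * (t * dlegendre (Suc n) (Suc m) t)"
    by (simp add: power2_eq_square algebra_simps)
  also have "\<dots> = (real n + 1 + real m) * dlegendre n m t - (real n + 1 - real m) * (t * dlegendre (Suc n) m t)"
    unfolding A using B by (simp add: algebra_simps)
  finally have "(2 * real n + 3) * ((1 - t\<^sup>2) * dlegendre (Suc n) (Suc m) t) =
     (2 * real n + 3) * ((real n + 1 + real m) * dlegendre n m t)
       - (real n + 1 - real m) * ((2 * real n + 3) * (t * dlegendre (Suc n) m t))"
    by algebra
  then show ?thesis unfolding dlegendre_mult_X by (simp add: algebra_simps)
qed

section \<open>The addition theorem for Legendre polynomials\<close>

text \<open>The coefficient of \<open>cos (m \<phi>)\<close> (up to the factor \<open>2\<close> for \<open>m > 0\<close> and powers of the sines) in the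
  expansion of \<open>P\<^sub>n\<close> at the cosine of the angle between two points with heights \<open>a\<close> and \<open>b\<close>.\<close>

definition addition_weight :: "real \<Rightarrow> real \<Rightarrow> nat \<Rightarrow> nat \<Rightarrow> real" where
  "addition_weight a b n m = fact (n - m) / fact (n + m) * dlegendre n m a * dlegendre n m b"

lemma addition_weight_eq_0: "n < m \<Longrightarrow> addition_weight a b n m = 0"
  by (simp add: addition_weight_def dlegendre_eq_0)

text \<open>The expansion is going to be proved by showing that it obeys the three-term recurrence of the
  Legendre polynomials. This lemma and the next one are that recurrence, read off at each power of
  the azimuthal variable. Expanding every product by the three relations above leaves products of
  degrees \<open>n\<close> and \<open>n + 2\<close>; the mixed ones cancel.\<close>

lemma addition_weight_step_0:
  "(real n + 2) * addition_weight a b (Suc (Suc n)) 0 + (real n + 1) * addition_weight a b n 0 =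
   (2 * real n + 3) * (a * b * addition_weight a b (Suc n) 0
      + (1 - a\<^sup>2) * (1 - b\<^sup>2) * addition_weight a b (Suc n) 1)"
proof -
  define A B A' B' where "A = dlegendre (Suc (Suc n)) 0 a" and "B = dlegendre n 0 a"
    and "A' = dlegendre (Suc (Suc n)) 0 b" and "B' = dlegendre n 0 b"
  define N where "N = 2 * real n + 3"
  have N0: "N \<noteq> 0" by (simp add: N_def)
  note R1 = dlegendre_mult_X[of n a 0, folded A_def B_def N_def] dlegendre_mult_X[of n b 0, folded A'_def B'_def N_def]
  note R3 = dlegendre_raise[of n a 0, folded A_def B_def N_def] dlegendre_raise[of n b 0, folded A'_def B'_def N_def]
  have f: "fact (Suc n - 1) / fact (Suc n + 1) = (1 / ((real n + 1) * (real n + 2)) :: real)"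
    by (simp add: divide_simps) (simp add: algebra_simps)
  have "N * (N * (a * b * addition_weight a b (Suc n) 0 + (1 - a\<^sup>2) * (1 - b\<^sup>2) * addition_weight a b (Suc n) 1))
    = (N * (a * dlegendre (Suc n) 0 a)) * (N * (b * dlegendre (Suc n) 0 b))
       + (N * ((1 - a\<^sup>2) * dlegendre (Suc n) (Suc 0) a)) * (N * ((1 - b\<^sup>2) * dlegendre (Suc n) (Suc 0) b))
          / ((real n + 1) * (real n + 2))"
    unfolding addition_weight_def One_nat_def[symmetric] f
    by (simp add: field_simps del: fact_Suc)
  also have "\<dots> = N * ((real n + 2) * (A * A') + (real n + 1) * (B * B'))"
    unfolding R1 R3 by (simp add: divide_simps N_def) (simp add: algebra_simps)
  finally have "N * ((real n + 2) * (A * A') + (real n + 1) * (B * B')) =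
     N * (N * (a * b * addition_weight a b (Suc n) 0 + (1 - a\<^sup>2) * (1 - b\<^sup>2) * addition_weight a b (Suc n) 1))" ..
  then have "(real n + 2) * (A * A') + (real n + 1) * (B * B') =
     N * (a * b * addition_weight a b (Suc n) 0 + (1 - a\<^sup>2) * (1 - b\<^sup>2) * addition_weight a b (Suc n) 1)"
    using N0 by simp
  then show ?thesis unfolding N_def
    by (simp add: addition_weight_def A_def B_def A'_def B'_def)
qed

text \<open>As \<open>fact (n - m)\<close> truncates, the quotients of factorials behave differently for \<open>m \<le> n\<close>,
  \<open>m = n + 1\<close> and \<open>m = n + 2\<close>; beyond that everything vanishes.\<close>

lemma addition_weight_step_Suc:
  "2 * (real n + 2) * addition_weight a b (Suc (Suc n)) (Suc j) + 2 * (real n + 1) * addition_weight a b n (Suc j) =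
   (2 * real n + 3) * (2 * a * b * addition_weight a b (Suc n) (Suc j) + addition_weight a b (Suc n) j
      + (1 - a\<^sup>2) * (1 - b\<^sup>2) * addition_weight a b (Suc n) (Suc (Suc j)))"
proof -
  define m where "m = Suc j"
  define A B A' B' where "A = dlegendre (Suc (Suc n)) m a" and "B = dlegendre n m a"
    and "A' = dlegendre (Suc (Suc n)) m b" and "B' = dlegendre n m b"
  define N where "N = 2 * real n + 3"
  have N0: "N \<noteq> 0" by (simp add: N_def)
  note R1 = dlegendre_mult_X[of n a m, folded A_def B_def N_def] dlegendre_mult_X[of n b m, folded A'_def B'_def N_def]
  note R2 = dlegendre_lower[of n j a, folded m_def, folded A_def B_def N_def] dlegendre_lower[of n j b, folded m_def, folded A'_def B'_def N_def]
  note R3 = dlegendre_raise[of n a m, folded A_def B_def N_def] dlegendre_raise[of n b m, folded A'_def B'_def N_def]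
  define c where "c n m = (fact (n - m) / fact (n + m) :: real)" for n m :: nat
  define RHS where "RHS = 2 * a * b * addition_weight a b (Suc n) m + addition_weight a b (Suc n) j
      + (1 - a\<^sup>2) * (1 - b\<^sup>2) * addition_weight a b (Suc n) (Suc m)"
  have "N * (N * RHS)
    = 2 * c (Suc n) m * (N * (a * dlegendre (Suc n) m a)) * (N * (b * dlegendre (Suc n) m b))
      + c (Suc n) j * (N * dlegendre (Suc n) j a) * (N * dlegendre (Suc n) j b)
       + c (Suc n) (Suc m) * (N * ((1 - a\<^sup>2) * dlegendre (Suc n) (Suc m) a)) * (N * ((1 - b\<^sup>2) * dlegendre (Suc n) (Suc m) b))"
    unfolding addition_weight_def c_def[symmetric] RHS_def by (simp add: algebra_simps)
  also have "\<dots> = N * (2 * (real n + 2) * (c (Suc (Suc n)) m * A * A') + 2 * (real n + 1) * (c n m * B * B'))"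
  proof -
    consider "m \<le> n" | "m = Suc n" | "m = Suc (Suc n)" | "m > Suc (Suc n)" by linarith
    then show ?thesis
    proof cases
      case 1
      then obtain k where n: "n = j + 1 + k" unfolding m_def by (metis Suc_eq_plus1 le_add_diff_inverse)
      have c1: "c (Suc n) m = c n m * (real k + 1) / (2 * real j + real k + 3)"
        unfolding c_def n m_def by (simp add: Suc_diff_le divide_simps) (simp add: algebra_simps)
      have c2: "c (Suc (Suc n)) m = c n m * (real k + 1) * (real k + 2) / ((2 * real j + real k + 3) * (2 * real j + real k + 4))"
        unfolding c_def n m_def by (simp add: Suc_diff_le divide_simps) (simp add: algebra_simps)
      have c3: "c (Suc n) j = c n m * (real k + 1) * (real k + 2)"
        unfolding c_def n m_def by (simp add: Suc_diff_le divide_simps) (simp add: algebra_simps)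
      have c4: "c (Suc n) (Suc m) = c n m / ((2 * real j + real k + 3) * (2 * real j + real k + 4))"
        unfolding c_def n m_def by (simp add: Suc_diff_le divide_simps) (simp add: algebra_simps)
      define C where "C = c n m"
      have p: "2 * real j + real k + 3 \<noteq> 0" "2 * real j + real k + 4 \<noteq> 0" by linarith+
      have r: "real n = real j + 1 + real k" "real m = real j + 1" by (simp_all add: n m_def)
      show ?thesis unfolding R1 R2 R3 unfolding c1 c2 c3 c4 C_def[symmetric] N_def r
        using p by (simp add: divide_simps) algebra
    next
      case 2
      then have z: "B = 0" "B' = 0" by (simp_all add: B_def B'_def dlegendre_eq_0)
      have jn: "j = n" using 2 by (simp add: m_def)
      have c1: "c (Suc n) m = c (Suc n) j / (2 * real n + 2)"
        unfolding c_def 2 jn by (simp add: divide_simps)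
      have c2: "c (Suc (Suc n)) m = c (Suc n) j / ((2 * real n + 2) * (2 * real n + 3))"
        unfolding c_def 2 jn by (simp add: divide_simps) (simp add: algebra_simps)
      have p: "2 * real n + 2 \<noteq> 0" "2 * real n + 3 \<noteq> 0" by linarith+
      have r: "real m = real n + 1" by (simp add: 2)
      show ?thesis unfolding R1 R2 R3 unfolding c1 c2 z N_def r
        using p by (simp add: divide_simps) algebra
    next
      case 3
      then have z: "B = 0" "B' = 0" by (simp_all add: B_def B'_def dlegendre_eq_0)
      have jn: "j = Suc n" using 3 by (simp add: m_def)
      have c2: "c (Suc (Suc n)) m = c (Suc n) j / ((2 * real n + 3) * (2 * real n + 4))"
        unfolding c_def 3 jn by (simp add: divide_simps) (simp add: algebra_simps)
      have p: "2 * real n + 3 \<noteq> 0" "2 * real n + 4 \<noteq> 0" by linarith+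
      have r: "real m = real n + 2" by (simp add: 3)
      show ?thesis unfolding R1 R2 R3 unfolding c2 z N_def r
        using p by (simp add: divide_simps)
    next
      case 4
      then have z: "B = 0" "B' = 0" "A = 0" "A' = 0"
        by (simp_all add: A_def A'_def B_def B'_def dlegendre_eq_0)
      show ?thesis unfolding R1 R2 R3 z by simp
    qed
  qed
  finally have "N * RHS = 2 * (real n + 2) * (c (Suc (Suc n)) m * A * A') + 2 * (real n + 1) * (c n m * B * B')"
    using N0 by simp
  then show ?thesis unfolding RHS_def N_def m_def[symmetric]
    by (simp add: addition_weight_def A_def B_def A'_def B'_def c_def algebra_simps)
qed

lemma Re_power_Suc_Suc: "Re (z ^ Suc (Suc j)) = 2 * Re z * Re (z ^ Suc j) - (cmod z)\<^sup>2 * Re (z ^ j)"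
proof -
  have "z ^ Suc (Suc j) = of_real (2 * Re z) * z ^ Suc j - of_real ((cmod z)\<^sup>2) * z ^ j"
  proof -
    have "of_real (2 * Re z) * z - of_real ((cmod z)\<^sup>2) = z * z"
      by (simp add: complex_eq_iff cmod_power2) (simp add: power2_eq_square)
    then have "z * z * z ^ j = (of_real (2 * Re z) * z - of_real ((cmod z)\<^sup>2)) * z ^ j" by simp
    then show ?thesis by (simp add: algebra_simps)
  qed
  then show ?thesis by (simp only: minus_complex.simps Re_complex_of_real times_complex.simps Im_complex_of_real mult_zero_left diff_zero)
qed

text \<open>Here \<open>a\<close> and \<open>b\<close> are the heights of two points of the unit sphere and \<open>z\<close> is the product of the
  planar part of the first with the conjugate planar part of the second, so that \<open>a * b + Re z\<close> is
  their inner product. Multiplication by \<open>a * b + Re z\<close> shifts the powers of \<open>z\<close> by one in each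
  direction, and the two step lemmas say that the right-hand side satisfies the same three-term
  recurrence in \<open>n\<close> as the left-hand side.\<close>

lemma legendre_addition:
  assumes "(cmod z)\<^sup>2 = (1 - a\<^sup>2) * (1 - b\<^sup>2)"
  shows "poly (legendre_poly n) (a * b + Re z) =
           addition_weight a b n 0 + 2 * (\<Sum>j<n. addition_weight a b n (Suc j) * Re (z ^ Suc j))"
proof -
  let ?w = "addition_weight a b"
  define Q where "Q n = ?w n 0 + 2 * (\<Sum>j<n. ?w n (Suc j) * Re (z ^ Suc j))" for n
  have Q_ext: "Q n = ?w n 0 + 2 * (\<Sum>j<K. ?w n (Suc j) * Re (z ^ Suc j))" if "n \<le> K" for n K
  proof -
    have "(\<Sum>j<n. ?w n (Suc j) * Re (z ^ Suc j)) = (\<Sum>j<K. ?w n (Suc j) * Re (z ^ Suc j))"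
      by (rule sum.mono_neutral_left) (use that in \<open>auto simp: addition_weight_eq_0\<close>)
    then show ?thesis by (simp add: Q_def)
  qed
  \<comment> \<open>Any \<open>K \<ge> n + 3\<close> serves as a common upper limit, since the weights vanish beyond the degree.\<close>
  have step: "(real n + 2) * Q (Suc (Suc n)) + (real n + 1) * Q n = (2 * real n + 3) * ((a * b + Re z) * Q (Suc n))" for n
  proof -
    define K where "K = n + 3"
    let ?S = "\<lambda>f. (\<Sum>j<K. f j * Re (z ^ Suc j))"
    have wK: "?w (Suc n) K = 0" "?w (Suc n) (Suc K) = 0" by (simp_all add: addition_weight_eq_0 K_def)
    have shift: "Re z * Q (Suc n) = ?S (?w (Suc n)) + (cmod z)\<^sup>2 * (?w (Suc n) 1 + ?S (\<lambda>j. ?w (Suc n) (Suc (Suc j))))"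
    proof -
      have "2 * (Re z * (?w (Suc n) (Suc j) * Re (z ^ Suc j))) =
          ?w (Suc n) (Suc j) * Re (z ^ Suc (Suc j)) + (cmod z)\<^sup>2 * (?w (Suc n) (Suc j) * Re (z ^ j))" for j
        unfolding Re_power_Suc_Suc by (simp add: algebra_simps)
      then have "(\<Sum>j<K. 2 * (Re z * (?w (Suc n) (Suc j) * Re (z ^ Suc j)))) =
          (\<Sum>j<K. ?w (Suc n) (Suc j) * Re (z ^ Suc (Suc j)) + (cmod z)\<^sup>2 * (?w (Suc n) (Suc j) * Re (z ^ j)))"
        by (intro sum.cong refl)
      then have "Re z * Q (Suc n) = ?w (Suc n) 0 * Re z + (\<Sum>j<K. ?w (Suc n) (Suc j) * Re (z ^ Suc (Suc j)))
           + (cmod z)\<^sup>2 * (\<Sum>j<K. ?w (Suc n) (Suc j) * Re (z ^ j))"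
        by (subst Q_ext[of _ K]) (simp_all add: K_def distrib_left sum_distrib_left sum.distrib mult.left_commute mult.commute del: power_Suc sum.lessThan_Suc)
      moreover have "?w (Suc n) 0 * Re z + (\<Sum>j<K. ?w (Suc n) (Suc j) * Re (z ^ Suc (Suc j))) = ?S (?w (Suc n))"
      proof -
        have "?w (Suc n) 0 * Re z + (\<Sum>j<K. ?w (Suc n) (Suc j) * Re (z ^ Suc (Suc j)))
            = (\<Sum>j<Suc K. ?w (Suc n) j * Re (z ^ Suc j))"
          by (subst sum.lessThan_Suc_shift) simp
        then show ?thesis by (simp add: wK del: power_Suc)
      qed
      moreover have "(\<Sum>j<K. ?w (Suc n) (Suc j) * Re (z ^ j)) = ?w (Suc n) 1 + ?S (\<lambda>j. ?w (Suc n) (Suc (Suc j)))"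
      proof -
        have "(\<Sum>j<K. ?w (Suc n) (Suc j) * Re (z ^ j)) = (\<Sum>j<Suc K. ?w (Suc n) (Suc j) * Re (z ^ j))"
          by (simp add: wK del: power_Suc)
        also have "\<dots> = ?w (Suc n) 1 + ?S (\<lambda>j. ?w (Suc n) (Suc (Suc j)))"
          by (subst sum.lessThan_Suc_shift) simp
        finally show ?thesis .
      qed
      ultimately show ?thesis by simp
    qed
    have "(2 * real n + 3) * ((a * b + Re z) * Q (Suc n)) =
        (2 * real n + 3) * (a * b * ?w (Suc n) 0 + (cmod z)\<^sup>2 * ?w (Suc n) 1)
        + ((2 * real n + 3) * (2 * a * b * ?S (\<lambda>j. ?w (Suc n) (Suc j)) + ?S (?w (Suc n))
            + (cmod z)\<^sup>2 * ?S (\<lambda>j. ?w (Suc n) (Suc (Suc j)))))"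
      unfolding distrib_right[of "a * b"] shift
      by (subst Q_ext[of _ K]) (simp_all add: K_def algebra_simps del: power_Suc sum.lessThan_Suc)
    also have "(2 * real n + 3) * (2 * a * b * ?S (\<lambda>j. ?w (Suc n) (Suc j)) + ?S (?w (Suc n))
            + (cmod z)\<^sup>2 * ?S (\<lambda>j. ?w (Suc n) (Suc (Suc j)))) =
        ?S (\<lambda>j. (2 * real n + 3) * (2 * a * b * ?w (Suc n) (Suc j) + ?w (Suc n) j + (cmod z)\<^sup>2 * ?w (Suc n) (Suc (Suc j))))"
      by (simp add: sum_distrib_left sum.distrib[symmetric] algebra_simps del: power_Suc sum.lessThan_Suc)
    also have "\<dots> = ?S (\<lambda>j. 2 * (real n + 2) * ?w (Suc (Suc n)) (Suc j) + 2 * (real n + 1) * ?w n (Suc j))"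
      unfolding assms addition_weight_step_Suc ..
    also have "(2 * real n + 3) * (a * b * ?w (Suc n) 0 + (cmod z)\<^sup>2 * ?w (Suc n) 1) =
       (real n + 2) * ?w (Suc (Suc n)) 0 + (real n + 1) * ?w n 0"
      unfolding assms addition_weight_step_0 ..
    also have "\<dots> + ?S (\<lambda>j. 2 * (real n + 2) * ?w (Suc (Suc n)) (Suc j) + 2 * (real n + 1) * ?w n (Suc j)) =
       (real n + 2) * Q (Suc (Suc n)) + (real n + 1) * Q n"
      by (subst (1 2) Q_ext[of _ K])
         (simp_all add: K_def sum_distrib_left sum.distrib[symmetric] algebra_simps del: power_Suc sum.lessThan_Suc)
    finally show ?thesis ..
  qed
  have "poly (legendre_poly n) (a * b + Re z) = Q n"
  proof (induction n rule: induct_nat_012)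
    case 0
    then show ?case by (simp add: Q_def legendre_poly_0 addition_weight_def dlegendre_0)
  next
    case 1
    then show ?case by (simp add: Q_def legendre_poly_1 addition_weight_def dlegendre_1)
  next
    case (ge2 n)
    have "(real n + 2) * poly (legendre_poly (Suc (Suc n))) (a * b + Re z) =
       (2 * real n + 3) * ((a * b + Re z) * Q (Suc n)) - (real n + 1) * Q n"
      using arg_cong[OF legendre_three_term[of n], of "\<lambda>p. poly p (a * b + Re z)"] ge2 by simp
    also have "\<dots> = (real n + 2) * Q (Suc (Suc n))" using step[of n] by simp
    finally show ?case by simp
  qed
  then show ?thesis by (simp add: Q_def)
qed

section \<open>The plane wave expansion\<close>

definition psi_coeff :: "nat \<Rightarrow> nat \<Rightarrow> complex" where
  "psi_coeff n q = (-1) ^ q / (2 ^ q * fact q * (\<Prod>i\<le>n + q. of_nat (2 * i + 1)))"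

text \<open>The entire function \<open>\<psi>\<^sub>n\<close> with \<open>j\<^sub>n t = t\<^sup>n \<psi>\<^sub>n (t\<^sup>2)\<close>. It makes wave functions analytic in the
  Cartesian coordinates, because only the square of the radius enters.\<close>

definition bessel_psi :: "nat \<Rightarrow> complex \<Rightarrow> complex" where
  "bessel_psi n w = (\<Sum>q. psi_coeff n q * w ^ q)"

lemma norm_psi_coeff_le: "norm (psi_coeff n q) \<le> 1 / (fact n * fact q)"
proof -
  have d: "(\<Prod>i\<le>n + q. real (2 * i + 1)) \<ge> fact n"
  proof -
    have "fact n = (\<Prod>i\<in>{1..n}. real i)" by (simp add: fact_prod)
    also have "\<dots> \<le> (\<Prod>i\<in>{1..n}. real (2 * i + 1))" by (rule prod_mono) auto
    also have "\<dots> \<le> (\<Prod>i\<le>n + q. real (2 * i + 1))" by (rule prod_mono2) auto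
    finally show ?thesis .
  qed
  have "norm (psi_coeff n q) = 1 / (2 ^ q * fact q * (\<Prod>i\<le>n + q. real (2 * i + 1)))"
    unfolding psi_coeff_def norm_divide norm_mult norm_power prod_norm[symmetric] norm_of_nat by simp
  also have "\<dots> \<le> 1 / (1 * fact q * fact n)"
    by (intro divide_left_mono mult_mono d mult_pos_pos prod_pos) auto
  finally show ?thesis by (simp add: mult.commute)
qed

lemma norm_psi_term_le: "norm (psi_coeff n q * w ^ q) \<le> (1 / fact n) * (inverse (fact q) * norm w ^ q)"
  using mult_right_mono[OF norm_psi_coeff_le, of "norm w ^ q" n q]
  by (simp add: norm_mult norm_power divide_simps)

lemma summable_psi: "summable (\<lambda>q. psi_coeff n q * w ^ q)"
  by (rule summable_comparison_test'[OF summable_mult[OF summable_exp[of "norm w"]]])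
     (rule norm_psi_term_le)

lemma norm_bessel_psi_le: "norm (bessel_psi n w) \<le> exp (norm w) / fact n"
proof -
  have s: "summable (\<lambda>q. (1 / fact n) * (inverse (fact q) * norm w ^ q))"
    by (rule summable_mult[OF summable_exp])
  have "norm (bessel_psi n w) \<le> (\<Sum>q. (1 / fact n) * (inverse (fact q) * norm w ^ q))"
    unfolding bessel_psi_def by (rule norm_suminf_le[OF _ s]) (rule norm_psi_term_le)
  also have "\<dots> = exp (norm w) / fact n"
    by (subst suminf_mult[OF summable_exp]) (simp add: exp_def scaleR_conv_of_real)
  finally show ?thesis .
qed

lemma psi_coeff_Suc: "psi_coeff n (Suc q) * of_nat (Suc q) = - psi_coeff (Suc n) q / 2"
  unfolding psi_coeff_def by (simp add: divide_simps prod_zero_iff del: of_nat_Suc of_nat_add of_nat_mult)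

lemma bessel_psi_has_field_derivative:
  "(bessel_psi n has_field_derivative - bessel_psi (Suc n) w / 2) (at w)"
proof -
  have "diffs (psi_coeff n) = (\<lambda>q. - (1 / 2) * psi_coeff (Suc n) q)"
    using psi_coeff_Suc by (auto simp: diffs_def fun_eq_iff mult.commute)
  then have "(\<Sum>q. diffs (psi_coeff n) q * w ^ q) = - bessel_psi (Suc n) w / 2"
    unfolding bessel_psi_def using suminf_mult[OF summable_psi, of "- (1/2)" "Suc n" w] by (simp add: mult.assoc)
  then show ?thesis
    using termdiffs_strong_converges_everywhere[of "psi_coeff n" w, OF summable_psi]
    unfolding bessel_psi_def[abs_def] by simp
qed

lemma bessel_psi_chain [derivative_intros]:
  assumes "(f has_field_derivative f') (at x within S)"
  shows "((\<lambda>x. bessel_psi n (f x)) has_field_derivative - bessel_psi (Suc n) (f x) / 2 * f') (at x within S)"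
  by (rule DERIV_chain2[OF bessel_psi_has_field_derivative assms])

text \<open>This is \<open>j\<^sub>n + j\<^sub>n\<^sub>+\<^sub>2 = (2n+3)/t j\<^sub>n\<^sub>+\<^sub>1\<close>.\<close>

lemma bessel_psi_three_term:
  "(2 * of_nat n + 3) * bessel_psi (Suc n) w = bessel_psi n w + w * bessel_psi (Suc (Suc n)) w"
proof -
  let ?h = "\<lambda>q. case q of 0 \<Rightarrow> 0 | Suc q \<Rightarrow> psi_coeff (Suc (Suc n)) q * w ^ Suc q"
  have "(\<lambda>q. psi_coeff (Suc (Suc n)) q * w ^ Suc q) sums (w * bessel_psi (Suc (Suc n)) w)"
    using sums_mult[OF summable_sums[OF summable_psi], of w "Suc (Suc n)" w]
    unfolding bessel_psi_def by (simp add: mult_ac)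
  then have h: "?h sums (w * bessel_psi (Suc (Suc n)) w)"
    using sums_Suc_iff[of ?h "w * bessel_psi (Suc (Suc n)) w"] by simp
  have c: "(2 * of_nat n + 3) * (psi_coeff (Suc n) q * w ^ q) = psi_coeff n q * w ^ q + ?h q" for q
  proof (cases q)
    case 0
    have "(\<Prod>i\<le>n. of_nat (2 * i + 1)) \<noteq> (0::complex)" by (simp add: prod_zero_iff del: of_nat_Suc of_nat_add of_nat_mult)
    moreover have "(2 * of_nat n + 3 :: complex) \<noteq> 0"
      using of_nat_eq_0_iff[of "2 * n + 3", where 'a = complex] by simp
    ultimately show ?thesis using 0
      by (simp add: psi_coeff_def divide_simps prod_zero_iff del: of_nat_Suc of_nat_add of_nat_mult)
         (simp add: add_ac)
  next
    case (Suc k)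
    define P where "P = (\<Prod>i\<le>n + k. of_nat (2 * i + 1) :: complex)"
    define a b where "a = (of_nat (2 * (n + k + 1) + 1) :: complex)" and "b = (of_nat (2 * (n + k + 2) + 1) :: complex)"
    have nz: "P \<noteq> 0" "a \<noteq> 0" "b \<noteq> 0" "(of_nat (Suc k) :: complex) \<noteq> 0"
      unfolding P_def a_def b_def by (simp_all add: prod_zero_iff del: of_nat_Suc of_nat_add of_nat_mult)
    have p: "(\<Prod>i\<le>n + Suc k. of_nat (2 * i + 1)) = P * a" "(\<Prod>i\<le>Suc n + Suc k. of_nat (2 * i + 1)) = P * a * b"
         "(\<Prod>i\<le>Suc (Suc n) + k. of_nat (2 * i + 1)) = P * a * b"
      unfolding P_def a_def b_def by (simp_all add: algebra_simps)
    have ab: "2 * of_nat n + 3 = b - 2 * of_nat (Suc k)" unfolding b_def by simp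
    have f: "(fact (Suc k) :: complex) = of_nat (Suc k) * fact k" by simp
    show ?thesis unfolding Suc nat.case psi_coeff_def p ab f using nz
      by (simp add: divide_simps del: of_nat_Suc) (simp add: algebra_simps del: of_nat_Suc)
  qed
  have "(\<lambda>q. (2 * of_nat n + 3) * (psi_coeff (Suc n) q * w ^ q)) sums (bessel_psi n w + w * bessel_psi (Suc (Suc n)) w)"
    unfolding c bessel_psi_def[of n] by (intro sums_add h summable_sums summable_psi)
  moreover have "(\<lambda>q. (2 * of_nat n + 3) * (psi_coeff (Suc n) q * w ^ q)) sums ((2 * of_nat n + 3) * bessel_psi (Suc n) w)"
    unfolding bessel_psi_def by (intro sums_mult summable_sums summable_psi)
  ultimately show ?thesis by (rule sums_unique2[symmetric])
qed

lemma spherical_bessel_eq_psi: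
  "complex_of_real (spherical_bessel n t) = of_real t ^ n * bessel_psi n (of_real t ^ 2)"
proof -
  define u where "u q = (-1) ^ q * t ^ (n + 2 * q) / (2 ^ q * fact q * (\<Prod>i\<le>n + q. real (2 * i + 1)))" for q
  have u: "complex_of_real (u q) = of_real t ^ n * (psi_coeff n q * (of_real t ^ 2) ^ q)" for q
    unfolding u_def psi_coeff_def by (simp add: power_add power_mult)
  have "summable (\<lambda>q. complex_of_real (u q))" unfolding u by (intro summable_mult summable_psi)
  then have su: "summable u" by (rule summable_complex_of_real[THEN iffD1])
  have "complex_of_real (spherical_bessel n t) = (\<Sum>q. complex_of_real (u q))"
    unfolding spherical_bessel_def u_def[symmetric] using suminf_of_real[OF su] by simp
  also have "\<dots> = of_real t ^ n * bessel_psi n (of_real t ^ 2)"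
    unfolding u bessel_psi_def by (rule suminf_mult[OF summable_psi])
  finally show ?thesis .
qed

text \<open>The Legendre polynomial made homogeneous: at \<open>p = x \<bullet> y\<close> and \<open>s = y \<bullet> y\<close> with a unit vector \<open>x\<close>
  this is \<open>|y|\<^sup>n P\<^sub>n\<close> of the cosine of the angle between \<open>x\<close> and \<open>y\<close>, a polynomial in \<open>y\<close> that makes
  sense for complex arguments.\<close>

fun hom_legendre :: "nat \<Rightarrow> complex \<Rightarrow> complex \<Rightarrow> complex" where
  "hom_legendre 0 p s = 1"
| "hom_legendre (Suc 0) p s = p"
| "hom_legendre (Suc (Suc n)) p s =
     ((2 * of_nat n + 3) * p * hom_legendre (Suc n) p s - (of_nat n + 1) * s * hom_legendre n p s) / (of_nat n + 2)"

lemma of_nat_plus2_neq0: "(of_nat n + 2 :: complex) \<noteq> 0"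
  using of_nat_eq_0_iff[of "n + 2", where 'a = complex] by (simp add: add.commute)

lemma hom_legendre_real: "hom_legendre n (of_real t) 1 = of_real (poly (legendre_poly n) t)"
proof (induction n rule: induct_nat_012)
  case 0 then show ?case by (simp add: legendre_poly_0)
next
  case 1 then show ?case by (simp add: legendre_poly_1)
next
  case (ge2 n)
  have *: "(real n + 2) * poly (legendre_poly (Suc (Suc n))) t =
      (2 * real n + 3) * t * poly (legendre_poly (Suc n)) t - (real n + 1) * poly (legendre_poly n) t"
    using arg_cong[OF legendre_three_term[of n], of "\<lambda>p. poly p t"] by simp
  have "(real n + 2) \<noteq> 0" by linarith
  with * have "poly (legendre_poly (Suc (Suc n))) t =
      ((2 * real n + 3) * t * poly (legendre_poly (Suc n)) t - (real n + 1) * poly (legendre_poly n) t) / (real n + 2)"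
    by (simp add: field_simps)
  then show ?case using ge2 by simp
qed

lemma hom_legendre_scale: "hom_legendre n (c * p) (c ^ 2 * s) = c ^ n * hom_legendre n p s"
proof (induction n rule: induct_nat_012)
  case (ge2 n)
  show ?case using of_nat_plus2_neq0[of n] unfolding hom_legendre.simps ge2
    by (simp add: field_simps power2_eq_square)
qed simp_all

lemma norm_hom_legendre_le:
  assumes "norm p \<le> a" "norm s \<le> b"
  shows "norm (hom_legendre n p s) \<le> (2 * a + b + 1) ^ n"
proof -
  have ab: "0 \<le> a" "0 \<le> b" using assms norm_ge_zero order_trans by blast+
  show ?thesis
  proof (induction n rule: induct_nat_012)
    case 0 then show ?case by simp
  next
    case 1 then show ?case using assms ab by simp
  next
    case (ge2 n)
    let ?C = "2 * a + b + 1"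
    have "norm (hom_legendre (Suc (Suc n)) p s) =
       norm ((2 * of_nat n + 3) * p * hom_legendre (Suc n) p s - (of_nat n + 1) * s * hom_legendre n p s) / (real n + 2)"
      unfolding hom_legendre.simps norm_divide using norm_of_nat[of "n + 2", where 'a = complex] by (simp add: add.commute)
    also have "\<dots> \<le> ((2 * real n + 3) * a * ?C ^ Suc n + (real n + 1) * b * ?C ^ n) / (real n + 2)"
    proof (intro divide_right_mono order_trans[OF norm_triangle_ineq4] add_mono)
      have n3: "norm (2 * of_nat n + 3 :: complex) = 2 * real n + 3"
        using norm_of_nat[of "2 * n + 3", where 'a = complex] by simp
      have n1: "norm (of_nat n + 1 :: complex) = real n + 1"
        using norm_of_nat[of "n + 1", where 'a = complex] by (simp add: add.commute)
      show "norm ((2 * of_nat n + 3) * p * hom_legendre (Suc n) p s) \<le> (2 * real n + 3) * a * ?C ^ Suc n"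
        unfolding norm_mult n3 using ge2 assms ab by (intro mult_mono) auto
      show "norm ((of_nat n + 1) * s * hom_legendre n p s) \<le> (real n + 1) * b * ?C ^ n"
        unfolding norm_mult n1 using ge2 assms ab by (intro mult_mono) auto
    qed simp
    also have "\<dots> \<le> ((2 * real n + 4) * a * ?C ^ Suc n + (real n + 2) * b * ?C ^ Suc n) / (real n + 2)"
    proof -
      have "?C ^ n \<le> ?C ^ Suc n" using ab by (intro power_increasing) auto
      then show ?thesis using ab
        by (intro divide_right_mono add_mono mult_mono) auto
    qed
    also have "\<dots> = (2 * a + b) * ?C ^ Suc n" by (simp add: field_simps)
    also have "\<dots> \<le> ?C * ?C ^ Suc n" using ab by (intro mult_right_mono) auto
    finally show ?case by simp
  qed
qed

definition plane_wave_term :: "nat \<Rightarrow> complex \<Rightarrow> complex \<Rightarrow> complex" where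
  "plane_wave_term n p s = (2 * of_nat n + 1) * (- \<i>) ^ n * hom_legendre n p s * bessel_psi n s"

lemma summable_linear_exp:
  fixes x :: real
  assumes "x \<ge> 0"
  shows "summable (\<lambda>n. (2 * real n + 1) * x ^ n / fact n)"
proof (rule summable_comparison_test'[OF summable_exp[of "3 * x"]])
  fix n :: nat
  have le: "2 * real n + 1 \<le> 3 ^ n" by (induction n) auto
  have "(2 * real n + 1) * x ^ n / fact n \<le> 3 ^ n * x ^ n / fact n"
    using assms le by (intro divide_right_mono mult_right_mono) auto
  then show "norm ((2 * real n + 1) * x ^ n / fact n) \<le> inverse (fact n) * (3 * x) ^ n"
    using assms by (simp add: power_mult_distrib divide_inverse mult_ac)
qed

lemma norm_2n1: "norm (2 * of_nat n + 1 :: complex) = 2 * real n + 1"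
  using norm_of_nat[of "2 * n + 1", where 'a = complex] by (simp add: add.commute)

lemma norm_plane_wave_term_le:
  assumes "norm p \<le> a" "norm s \<le> b"
  shows "norm (plane_wave_term n p s) \<le> exp b * ((2 * real n + 1) * (2 * a + b + 1) ^ n / fact n)"
proof -
  have ab: "0 \<le> a" "0 \<le> b" using assms norm_ge_zero order_trans by blast+
  have "norm (plane_wave_term n p s) \<le> (2 * real n + 1) * 1 * (2 * a + b + 1) ^ n * (exp b / fact n)"
    unfolding plane_wave_term_def norm_mult norm_2n1
    using norm_hom_legendre_le[OF assms, of n] order_trans[OF norm_bessel_psi_le[of n s] divide_right_mono[of _ "exp b"]] assms ab
    by (intro mult_mono) (auto simp: norm_power)
  then show ?thesis by (simp add: mult_ac)
qed

text \<open>Replace \<open>(p, s)\<close> by \<open>(\<lambda> p, \<lambda>\<^sup>2 s)\<close>. The derivative recurrence of the Bessel functions and the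
  three-term recurrence of the Legendre polynomials turn the \<open>\<lambda>\<close>-derivative of the series \<open>S\<close> into
  \<open>- \<i> p S\<close>, up to a sum that telescopes to zero; and \<open>S\<close> equals \<open>1\<close> at \<open>\<lambda> = 0\<close>.\<close>

theorem plane_wave_expansion: "(\<lambda>n. plane_wave_term n p s) sums exp (- \<i> * p)"
proof -
  define y where "y n l = l ^ n * bessel_psi n (l ^ 2 * s)" for n and l :: complex
  define f where "f n l = (2 * of_nat n + 1) * ((- \<i>) ^ n * hom_legendre n p s * y n l)" for n and l :: complex
  define A where "A n l = (- \<i>) ^ n * hom_legendre n p s * of_nat n * y (n - 1) l" for n and l :: complex
  define B where "B n l = (case n of 0 \<Rightarrow> 0 | Suc k \<Rightarrow> (- \<i>) ^ k * hom_legendre k p s * of_nat n * s * y n l)" for n and l :: complex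
  define f' where "f' n l = A n l - B (Suc n) l" for n l
  have f_eq: "f n l = plane_wave_term n (l * p) (l ^ 2 * s)" for n l
    unfolding f_def y_def plane_wave_term_def hom_legendre_scale by (simp add: mult_ac)
  have y_der: "((\<lambda>l. (2 * of_nat n + 1) * y n l) has_field_derivative
      of_nat n * y (n - 1) l - (of_nat n + 1) * s * y (Suc n) l) (at l)" for n l
  proof (cases n)
    case 0
    show ?thesis unfolding 0 y_def
      by (auto intro!: derivative_eq_intros simp: field_simps)
  next
    case (Suc k)
    have *: "bessel_psi k (l\<^sup>2 * s) = (2 * of_nat k + 3) * bessel_psi (Suc k) (l\<^sup>2 * s) - l\<^sup>2 * s * bessel_psi (Suc (Suc k)) (l\<^sup>2 * s)"
      using bessel_psi_three_term[of k "l\<^sup>2 * s"] by simp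
    show ?thesis unfolding Suc y_def
      by (auto intro!: derivative_eq_intros
          simp: * ) (cases k; simp add: algebra_simps power2_eq_square)
  qed
  have f_der: "(f n has_field_derivative f' n l) (at l)" for n l
    using DERIV_cmult[OF y_der[of n l], of "(- \<i>) ^ n * hom_legendre n p s"]
    unfolding f_def[abs_def] f'_def A_def B_def by (simp add: algebra_simps)
  have "\<exists>g g'. \<forall>l \<in> UNIV. ((\<lambda>n. f n l) sums g l) \<and> ((\<lambda>n. f' n l) sums g' l) \<and> (g has_field_derivative g' l) (at l)"
  proof (rule series_and_derivative_comparison_complex[OF open_UNIV f_der])
    fix l :: complex
    define a b where "a = (norm l + 1) * norm p" and "b = (norm l + 1) ^ 2 * norm s"
    define M where "M n = exp b * ((2 * real n + 1) * (2 * a + b + 1) ^ n / fact n)" for n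
    have ab: "0 \<le> a" "0 \<le> b" by (simp_all add: a_def b_def)
    have "summable M" unfolding M_def using ab by (intro summable_mult summable_linear_exp) auto
    moreover have "M n \<ge> 0" for n using ab by (simp add: M_def)
    moreover have "norm (f n x) \<le> M n" if "x \<in> ball l 1" for n x
    proof -
      have "norm x \<le> norm l + 1"
        using that norm_triangle_ineq2[of x l] by (simp add: dist_norm norm_minus_commute)
      then show ?thesis unfolding f_eq M_def
        by (intro norm_plane_wave_term_le) (auto simp: a_def b_def norm_mult norm_power intro!: mult_right_mono power_mono)
    qed
    ultimately show "\<exists>d h. 0 < d \<and> summable h \<and> range h \<subseteq> \<real>\<^sub>\<ge>\<^sub>0 \<and> (\<forall>\<^sub>F n in sequentially. \<forall>x\<in>ball l d \<inter> UNIV. cmod (f n x) \<le> cmod (h n))"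
      by (intro exI[of _ 1] exI[of _ "\<lambda>n. complex_of_real (M n)"]) (auto simp: summable_complex_of_real)
  qed
  then obtain g g' where g: "\<And>l. (\<lambda>n. f n l) sums g l" "\<And>l. (\<lambda>n. f' n l) sums g' l"
      "\<And>l. (g has_field_derivative g' l) (at l)" by auto
  have ode: "g' l = - \<i> * p * g l" for l
  proof -
    \<comment> \<open>\<open>f'\<close> is \<open>A n - B (n + 1)\<close> by the derivative recurrence, while \<open>- \<i> p f\<close> is
      \<open>A (n + 1) - B n\<close> by the three-term recurrence of the Legendre polynomials.\<close>
    define G where "G n = A n l + B n l" for n
    have tele: "f' n l - (- \<i> * p * f n l) = G n - G (Suc n)" for n
    proof -
      have "- \<i> * p * f n l = A (Suc n) l - B n l"
      proof (cases n)
        case 0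
        show ?thesis unfolding 0 f_def A_def B_def by simp
      next
        case (Suc k)
        have L: "(of_nat k + 2) * hom_legendre (Suc (Suc k)) p s =
            (2 * of_nat k + 3) * p * hom_legendre (Suc k) p s - (of_nat k + 1) * s * hom_legendre k p s"
          using of_nat_plus2_neq0[of k] by simp
        have "A (Suc n) l - B n l = (- \<i>) ^ k * y n l *
           (- ((of_nat k + 2) * hom_legendre (Suc (Suc k)) p s) - hom_legendre k p s * (of_nat k + 1) * s)"
          unfolding A_def B_def Suc by (simp add: algebra_simps del: hom_legendre.simps)
        also have "\<dots> = - \<i> * p * f n l" unfolding L f_def Suc by (simp add: algebra_simps del: hom_legendre.simps)
        finally show ?thesis ..
      qed
      then show ?thesis by (simp add: f'_def G_def)
    qed
    have "G \<longlonglongrightarrow> 0"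
    proof -
      define C where "C = 2 * norm p + norm s + 1"
      define K where "K = exp (norm (l\<^sup>2 * s))"
      have C1: "C \<ge> 1" "norm s \<le> C" by (simp_all add: C_def)
      have L: "norm (hom_legendre n p s) \<le> C ^ n" for n unfolding C_def by (rule norm_hom_legendre_le) auto
      have Y: "norm (y n l) \<le> norm l ^ n * (K / fact n)" for n
        using mult_left_mono[OF norm_bessel_psi_le[of n "l\<^sup>2 * s"], of "norm l ^ n"]
        by (simp add: y_def K_def norm_mult norm_power)
      define H where "H n = (2 * C * K) * ((2 * real n + 1) * (C * norm l) ^ n / fact n)" for n
      have H: "H \<longlonglongrightarrow> 0" unfolding H_def
        using C1 by (intro summable_LIMSEQ_zero summable_mult summable_linear_exp) auto
      have "(\<lambda>n. A (Suc n) l) \<longlonglongrightarrow> 0"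
      proof (rule Lim_null_comparison[OF _ H], intro always_eventually allI)
        fix n
        have "norm (A (Suc n) l) = norm (hom_legendre (Suc n) p s) * (real (Suc n)) * norm (y n l)"
          unfolding A_def norm_mult norm_of_nat norm_power by simp
        also have "\<dots> \<le> C ^ Suc n * real (Suc n) * (norm l ^ n * (K / fact n))"
          using C1 by (intro mult_mono L Y) (auto simp: K_def)
        also have "\<dots> = C * K * ((real n + 1) * (C * norm l) ^ n / fact n)" by (simp add: power_mult_distrib field_simps)
        also have "\<dots> \<le> H n" unfolding H_def using C1
          by (intro mult_mono divide_right_mono mult_right_mono) (auto simp: K_def)
        finally show "norm (A (Suc n) l) \<le> H n" .
      qed
      moreover have "(\<lambda>n. B n l) \<longlonglongrightarrow> 0"
      proof (rule Lim_null_comparison[OF _ H], intro always_eventually allI)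
        fix n
        show "norm (B n l) \<le> H n"
        proof (cases n)
          case 0 then show ?thesis using C1 by (simp add: B_def H_def K_def)
        next
          case (Suc k)
          have "norm (B n l) = norm (hom_legendre k p s) * real n * norm s * norm (y n l)"
            unfolding B_def Suc nat.case norm_mult norm_of_nat norm_power by simp
          also have "\<dots> \<le> C ^ n * real n * C * (norm l ^ n * (K / fact n))"
          proof (intro mult_mono Y C1)
            show "norm (hom_legendre k p s) \<le> C ^ n"
              by (rule order_trans[OF L power_increasing]) (use C1 Suc in auto)
          qed (use C1 in \<open>auto simp: K_def\<close>)
          also have "\<dots> = C * K * (real n * (C * norm l) ^ n / fact n)" by (simp add: power_mult_distrib field_simps)
          also have "\<dots> \<le> H n" unfolding H_def using C1
            by (intro mult_mono divide_right_mono mult_right_mono) (auto simp: K_def)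
          finally show ?thesis .
        qed
      qed
      ultimately show ?thesis unfolding G_def using filterlim_sequentially_Suc[of "\<lambda>n. A n l"]
        by (auto intro: tendsto_add_zero)
    qed
    from telescope_sums'[OF this] have "(\<lambda>n. f' n l - (- \<i> * p * f n l)) sums 0"
      unfolding tele by (simp add: G_def A_def B_def)
    moreover have "(\<lambda>n. f' n l - (- \<i> * p * f n l)) sums (g' l - (- \<i> * p * g l))"
      by (intro sums_diff sums_mult g)
    ultimately have "0 = g' l - (- \<i> * p * g l)" by (rule sums_unique2)
    then show ?thesis by (simp add: eq_neg_iff_add_eq_0)
  qed
  \<comment> \<open>So \<open>g\<close> times the inverse exponential is constant.\<close>
  have "((\<lambda>l. g l * exp (\<i> * p * l)) has_field_derivative 0) (at l)" for l
    using g(3)[of l] unfolding ode by (auto intro!: derivative_eq_intros)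
  then have "\<exists>c. \<forall>l\<in>UNIV. g l * exp (\<i> * p * l) = c"
    by (intro has_field_derivative_zero_constant) auto
  then have "g 1 * exp (\<i> * p * 1) = g 0 * exp (\<i> * p * 0)"
    by (metis UNIV_I)
  moreover have "g 0 = 1"
  proof -
    have "bessel_psi 0 0 = psi_coeff 0 0"
      unfolding bessel_psi_def by (rule powser_zero)
    then have "bessel_psi 0 0 = 1" by (simp add: psi_coeff_def)
    then have "f n 0 = (if n = 0 then 1 else 0)" for n
      by (simp add: f_def y_def)
    then have "(\<lambda>n. f n 0) sums 1" using sums_single[of 0 "\<lambda>n. 1::complex"] by simp
    then show ?thesis using g(1)[of 0] sums_unique2 by blast
  qed
  ultimately have "g 1 = exp (- (\<i> * p))" by (simp add: exp_minus field_simps)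
  with g(1)[of 1] show ?thesis unfolding f_eq by simp
qed

section \<open>Entire functions of three complex variables\<close>

definition complexify :: "real^3 \<Rightarrow> complex^3" where
  "complexify y = (\<chi> i. of_real (y $ i))"

text \<open>Bilinear and not sesquilinear, so that it is holomorphic in both arguments.\<close>

definition cdot :: "complex^3 \<Rightarrow> complex^3 \<Rightarrow> complex" where
  "cdot z w = (\<Sum>i\<in>UNIV. z $ i * w $ i)"

text \<open>Wave functions and the terms of the plane wave expansion are built from coordinates and \<open>\<psi>\<^sub>n\<close> of the
  squared radius. This class is closed
  under partial derivatives, so that continuity and higher derivatives come without any theory of
  several complex variables. Derivatives are controlled by their values on a
  complex neighbourhood through Cauchy's inequality in one variable at a time.\<close>

inductive_set entire_class :: "real \<Rightarrow> (complex^3 \<Rightarrow> complex) set" for \<kappa> where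
  entire_const: "(\<lambda>z. c) \<in> entire_class \<kappa>"
| entire_coord: "(\<lambda>z. z $ i) \<in> entire_class \<kappa>"
| entire_add: "F \<in> entire_class \<kappa> \<Longrightarrow> G \<in> entire_class \<kappa> \<Longrightarrow> (\<lambda>z. F z + G z) \<in> entire_class \<kappa>"
| entire_mult: "F \<in> entire_class \<kappa> \<Longrightarrow> G \<in> entire_class \<kappa> \<Longrightarrow> (\<lambda>z. F z * G z) \<in> entire_class \<kappa>"
| entire_psi: "(\<lambda>z. bessel_psi n (of_real (\<kappa>\<^sup>2) * cdot z z)) \<in> entire_class \<kappa>"

lemma entire_diff:
  assumes "F \<in> entire_class \<kappa>" "G \<in> entire_class \<kappa>"
  shows "(\<lambda>z. F z - G z) \<in> entire_class \<kappa>"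
proof -
  have "(\<lambda>z. F z + (-1) * G z) \<in> entire_class \<kappa>" by (intro entire_class.intros assms)
  then show ?thesis by simp
qed

lemma entire_power: "F \<in> entire_class \<kappa> \<Longrightarrow> (\<lambda>z. F z ^ n) \<in> entire_class \<kappa>"
  by (induction n) (auto intro!: entire_class.intros)

lemma entire_sum: "(\<And>i. i \<in> I \<Longrightarrow> F i \<in> entire_class \<kappa>) \<Longrightarrow> (\<lambda>z. \<Sum>i\<in>I. F i z) \<in> entire_class \<kappa>"
  by (induction I rule: infinite_finite_induct) (auto intro!: entire_class.intros)

lemma entire_cdot: "(\<lambda>z. cdot w z) \<in> entire_class \<kappa>" "(\<lambda>z. cdot z z) \<in> entire_class \<kappa>"
  unfolding cdot_def by (intro entire_sum entire_class.intros)+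

lemma entire_hom_legendre:
  assumes "P \<in> entire_class \<kappa>" "Q \<in> entire_class \<kappa>"
  shows "(\<lambda>z. hom_legendre n (P z) (Q z)) \<in> entire_class \<kappa>"
proof (induction n rule: induct_nat_012)
  case (ge2 n)
  have "(\<lambda>z. inverse (of_nat n + 2) * ((2 * of_nat n + 3) * P z * hom_legendre (Suc n) (P z) (Q z)
      - (of_nat n + 1) * Q z * hom_legendre n (P z) (Q z))) \<in> entire_class \<kappa>"
    by (intro entire_class.intros entire_diff ge2 assms)
  then show ?case by (simp only: hom_legendre.simps divide_inverse mult.commute)
qed (auto intro!: entire_class.intros assms)

abbreviation along :: "3 \<Rightarrow> complex^3 \<Rightarrow> complex \<Rightarrow> complex^3" where
  "along l z a \<equiv> z + a *s axis l 1"

definition cpartial :: "3 \<Rightarrow> (complex^3 \<Rightarrow> complex) \<Rightarrow> complex^3 \<Rightarrow> complex" where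
  "cpartial l F z = deriv (\<lambda>a. F (along l z a)) 0"

lemma along_along: "along l (along l z a) b = along l z (b + a)"
  by (simp add: vec_eq_iff algebra_simps)

lemma entire_has_partial:
  assumes "F \<in> entire_class \<kappa>"
  shows "\<exists>F'\<in>entire_class \<kappa>. \<forall>z. ((\<lambda>a. F (along l z a)) has_field_derivative F' z) (at 0)"
  using assms
proof induction
  case (entire_const c)
  show ?case by (rule bexI[OF _ entire_class.entire_const[of 0]]) simp
next
  case (entire_coord i)
  show ?case
    by (rule bexI[OF _ entire_class.entire_const[of "axis l 1 $ i"]]) (auto intro!: derivative_eq_intros)
next
  case (entire_add F G)
  then obtain F' G' where *: "F' \<in> entire_class \<kappa>" "G' \<in> entire_class \<kappa>"
    "\<And>z. ((\<lambda>a. F (along l z a)) has_field_derivative F' z) (at 0)"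
    "\<And>z. ((\<lambda>a. G (along l z a)) has_field_derivative G' z) (at 0)" by blast
  show ?case
    by (rule bexI[OF _ entire_class.entire_add[OF *(1,2)]]) (auto intro!: derivative_eq_intros *)
next
  case (entire_mult F G)
  then obtain F' G' where *: "F' \<in> entire_class \<kappa>" "G' \<in> entire_class \<kappa>"
    "\<And>z. ((\<lambda>a. F (along l z a)) has_field_derivative F' z) (at 0)"
    "\<And>z. ((\<lambda>a. G (along l z a)) has_field_derivative G' z) (at 0)" by blast
  show ?case
    by (rule bexI[OF _ entire_class.entire_add[OF entire_class.entire_mult[OF entire_mult.hyps(1) *(2)]
            entire_class.entire_mult[OF *(1) entire_mult.hyps(2)]]])
       (auto intro!: derivative_eq_intros * simp: mult.commute)
next
  case (entire_psi n)
  have mem: "(\<lambda>z. - bessel_psi (Suc n) (of_real (\<kappa>\<^sup>2) * cdot z z) * of_real (\<kappa>\<^sup>2) * z $ l) \<in> entire_class \<kappa>"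
  proof -
    have "(\<lambda>z. (-1) * bessel_psi (Suc n) (of_real (\<kappa>\<^sup>2) * cdot z z) * of_real (\<kappa>\<^sup>2) * z $ l) \<in> entire_class \<kappa>"
      by (intro entire_class.intros)
    then show ?thesis by simp
  qed
  have der: "((\<lambda>a. bessel_psi n (of_real (\<kappa>\<^sup>2) * cdot (along l z a) (along l z a))) has_field_derivative
       - bessel_psi (Suc n) (of_real (\<kappa>\<^sup>2) * cdot z z) * of_real (\<kappa>\<^sup>2) * z $ l) (at 0)" for z
  proof -
    have c: "cdot (along l z a) (along l z a) = cdot z z + 2 * a * z $ l + a\<^sup>2" for a
      unfolding cdot_def UNIV_3 using exhaust_3[of l]
      by (auto simp: axis_def algebra_simps power2_eq_square)
    show ?thesis unfolding c by (auto intro!: derivative_eq_intros)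
  qed
  show ?case by (rule bexI[OF _ mem]) (use der in blast)
qed

lemma entire_cpartial:
  assumes "F \<in> entire_class \<kappa>"
  shows "cpartial l F \<in> entire_class \<kappa>"
    and "((\<lambda>a. F (along l z a)) has_field_derivative cpartial l F (along l z a)) (at a)"
proof -
  obtain F' where F': "F' \<in> entire_class \<kappa>" "\<And>z. ((\<lambda>a. F (along l z a)) has_field_derivative F' z) (at 0)"
    using entire_has_partial[OF assms] by blast
  have eq: "cpartial l F = F'"
    unfolding cpartial_def using F'(2) by (auto simp: fun_eq_iff intro: DERIV_imp_deriv)
  show "cpartial l F \<in> entire_class \<kappa>" using F' eq by simp
  have "((\<lambda>b. F (along l z (b + a))) has_field_derivative F' (along l z a)) (at 0)"
    using F'(2)[of "along l z a"] unfolding along_along .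
  then show "((\<lambda>a. F (along l z a)) has_field_derivative cpartial l F (along l z a)) (at a)"
    unfolding eq using DERIV_shift[of "\<lambda>a. F (along l z a)" _ 0 a] by simp
qed

lemma entire_continuous: "F \<in> entire_class \<kappa> \<Longrightarrow> continuous_on S F"
proof (induction rule: entire_class.induct)
  case (entire_psi n)
  have "continuous_on UNIV (bessel_psi n)"
    by (rule DERIV_continuous_on[OF bessel_psi_has_field_derivative])
  moreover have "continuous_on S (\<lambda>z. of_real (\<kappa>\<^sup>2) * cdot z z)"
    unfolding cdot_def by (intro continuous_intros)
  ultimately show ?case by (rule continuous_on_compose2) auto
qed (auto intro!: continuous_intros)

lemma continuous_on_complexify: "continuous_on S complexify"
  unfolding complexify_def by (intro continuous_intros)

lemma complexify_along: "complexify (y + t *\<^sub>R axis l 1) = along l (complexify y) (of_real t)"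
  by (simp add: complexify_def vec_eq_iff axis_def)

lemma partial_deriv_complexify:
  assumes "((\<lambda>a. F (along l (complexify y) a)) has_field_derivative D) (at 0)"
  shows "partial_deriv l (\<lambda>y. F (complexify y)) y = D"
proof -
  have "((\<lambda>t. F (along l (complexify y) (of_real t))) has_vector_derivative D) (at 0)"
    using has_vector_derivative_real_field[of _ D 0 UNIV] assms by simp
  then show ?thesis
    unfolding partial_deriv_def complexify_along by (rule vector_derivative_at)
qed

lemma partial_deriv_local:
  assumes "open S" "y \<in> S" "\<And>x. x \<in> S \<Longrightarrow> f x = g x"
  shows "partial_deriv l f y = partial_deriv l g y"
proof -
  have "((\<lambda>t::real. y + t *\<^sub>R axis l 1) \<longlongrightarrow> y + 0 *\<^sub>R axis l 1) (nhds 0)"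
    by (intro tendsto_intros filterlim_ident)
  then have "\<forall>\<^sub>F t::real in nhds 0. y + t *\<^sub>R axis l 1 \<in> S"
    using assms(1,2) by (auto dest: topological_tendstoD)
  then have "\<forall>\<^sub>F t::real in nhds 0. t \<in> UNIV \<longrightarrow> f (y + t *\<^sub>R axis l 1) = g (y + t *\<^sub>R axis l 1)"
    by eventually_elim (use assms(3) in auto)
  then show ?thesis unfolding partial_deriv_def
    by (intro vector_derivative_cong_eq) auto
qed

lemma hessian_local:
  assumes "open S" "y \<in> S" "\<And>x. x \<in> S \<Longrightarrow> f x = g x"
  shows "hessian f y = hessian g y"
proof -
  have "partial_deriv l (partial_deriv s f) y = partial_deriv l (partial_deriv s g) y" for l s
    by (rule partial_deriv_local[OF assms(1,2) partial_deriv_local[OF assms(1) _ assms(3)]])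
  then show ?thesis by (simp add: hessian_def)
qed

lemma hessian_entire:
  assumes "F \<in> entire_class \<kappa>"
  shows "hessian (\<lambda>y. F (complexify y)) y $ l $ s = cpartial l (cpartial s F) (complexify y)"
proof -
  have "partial_deriv k (\<lambda>y. G (complexify y)) = (\<lambda>y. cpartial k G (complexify y))" if "G \<in> entire_class \<kappa>" for k G
    using entire_cpartial(2)[OF that, where a = 0] by (intro ext partial_deriv_complexify) simp
  then show ?thesis unfolding hessian_def using assms entire_cpartial(1) by simp
qed

lemma cpartial_sum:
  assumes "finite I" "\<And>i. i \<in> I \<Longrightarrow> F i \<in> entire_class \<kappa>"
  shows "cpartial l (\<lambda>z. \<Sum>i\<in>I. c i * F i z) z = (\<Sum>i\<in>I. c i * cpartial l (F i) z)"
proof -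
  have "((\<lambda>a. F i (along l z a)) has_field_derivative cpartial l (F i) z) (at 0)" if "i \<in> I" for i
    using entire_cpartial(2)[OF assms(2)[OF that], where l = l and z = z and a = 0] by simp
  then have "((\<lambda>a. \<Sum>i\<in>I. c i * F i (along l z a)) has_field_derivative (\<Sum>i\<in>I. c i * cpartial l (F i) z)) (at 0)"
    by (intro DERIV_sum DERIV_cmult)
  then show ?thesis unfolding cpartial_def[of l "\<lambda>z. \<Sum>i\<in>I. c i * F i z"] by (rule DERIV_imp_deriv)
qed

definition polydisc :: "real \<Rightarrow> (complex^3) set" where
  "polydisc \<rho> = {z. \<forall>i. cmod (z $ i) \<le> \<rho>}"

lemma along_polydisc: "z \<in> polydisc \<rho> \<Longrightarrow> cmod a \<le> d \<Longrightarrow> along l z a \<in> polydisc (\<rho> + d)"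
proof -
  assume z: "z \<in> polydisc \<rho>" and a: "cmod a \<le> d"
  have "cmod (along l z a $ i) \<le> \<rho> + d" for i
  proof -
    have "cmod (axis l 1 $ i :: complex) \<le> 1" by (simp add: axis_def)
    then have "cmod a * cmod (axis l 1 $ i :: complex) \<le> d * 1"
      using a by (intro mult_mono) (auto intro: order_trans[OF norm_ge_zero a])
    then have "cmod (z $ i) + cmod (a * axis l 1 $ i) \<le> \<rho> + d"
      using z by (auto simp: polydisc_def norm_mult intro!: add_mono)
    then show ?thesis
      using norm_triangle_ineq[of "z $ i" "a * axis l 1 $ i"] by simp
  qed
  then show ?thesis by (simp add: polydisc_def)
qed

text \<open>Cauchy's inequality on the unit circle in the \<open>l\<close>-th variable. Since series are going to be bounded on
  all polydiscs, increasing the radius by one does no harm.\<close>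

lemma cpartial_bound:
  assumes "F \<in> entire_class \<kappa>" "\<And>z. z \<in> polydisc (\<rho> + 1) \<Longrightarrow> cmod (F z) \<le> B" "z \<in> polydisc \<rho>"
  shows "cmod (cpartial l F z) \<le> B"
proof -
  let ?f = "\<lambda>a. F (along l z a)"
  have hol: "?f holomorphic_on UNIV"
    using entire_cpartial(2)[OF assms(1)] by (auto simp: holomorphic_on_open)
  have "norm ((deriv ^^ 1) ?f 0) \<le> fact 1 * B / 1 ^ 1"
  proof (rule Cauchy_inequality)
    show "?f holomorphic_on ball 0 1" "continuous_on (cball 0 1) ?f"
      using hol holomorphic_on_subset holomorphic_on_imp_continuous_on by blast+
    show "norm (F (along l z a)) \<le> B" if "norm (0 - a) = 1" for a
      using that by (intro assms(2) along_polydisc assms(3)) auto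
  qed simp
  then show ?thesis by (simp add: cpartial_def)
qed

text \<open>Absolute convergence with a summable bound on every polydisc, which is inherited by partial
  derivatives.\<close>

definition normally_sums :: "real \<Rightarrow> (nat \<Rightarrow> complex^3 \<Rightarrow> complex) \<Rightarrow> (complex^3 \<Rightarrow> complex) \<Rightarrow> bool" where
  "normally_sums \<kappa> F G \<longleftrightarrow> (\<forall>n. F n \<in> entire_class \<kappa>) \<and> (\<forall>z. (\<lambda>n. F n z) sums G z) \<and>
     (\<forall>\<rho>. \<exists>M. summable M \<and> (\<forall>n. \<forall>z\<in>polydisc \<rho>. cmod (F n z) \<le> M n))"

lemma normally_sums_cpartial:
  assumes "normally_sums \<kappa> F G"
  shows "normally_sums \<kappa> (\<lambda>n. cpartial l (F n)) (cpartial l G)"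
    and "((\<lambda>a. G (along l z a)) has_field_derivative cpartial l G z) (at 0)"
proof -
  note E = assms[unfolded normally_sums_def, THEN conjunct1, rule_format]
  note S = assms[unfolded normally_sums_def, THEN conjunct2, THEN conjunct1, rule_format]
  note B = assms[unfolded normally_sums_def, THEN conjunct2, THEN conjunct2, rule_format]
  have main: "(\<lambda>n. cpartial l (F n) z) sums cpartial l G z \<and>
     ((\<lambda>a. G (along l z a)) has_field_derivative cpartial l G z) (at 0)" for z
  proof -
    define \<rho> where "\<rho> = (\<Sum>i\<in>UNIV. cmod (z $ i))"
    have z: "z \<in> polydisc \<rho>" by (auto simp: polydisc_def \<rho>_def intro: member_le_sum)
    obtain M where M: "summable M" "\<And>n z. z \<in> polydisc (\<rho> + 2) \<Longrightarrow> cmod (F n z) \<le> M n"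
      using B[of "\<rho> + 2"] by blast
    have "\<exists>g g'. \<forall>a\<in>ball 0 1. ((\<lambda>n. F n (along l z a)) sums g a) \<and>
        ((\<lambda>n. cpartial l (F n) (along l z a)) sums g' a) \<and> (g has_field_derivative g' a) (at a)"
    proof (rule series_and_derivative_comparison_complex[OF open_ball entire_cpartial(2)[OF E]])
      fix a :: complex assume "a \<in> ball 0 1"
      have b: "cmod (F n (along l z x)) \<le> M n" if "x \<in> ball a 1 \<inter> ball 0 1" for x n
        using that by (intro M(2) along_polydisc z) auto
      have "M n \<ge> 0" for n
        by (rule order_trans[OF norm_ge_zero b[of a]]) (use \<open>a \<in> ball 0 1\<close> in auto)
      then show "\<exists>d h. 0 < d \<and> summable h \<and> range h \<subseteq> \<real>\<^sub>\<ge>\<^sub>0 \<and>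
         (\<forall>\<^sub>F n in sequentially. \<forall>x\<in>ball a d \<inter> ball 0 1. cmod (F n (along l z x)) \<le> cmod (h n))"
        using b M(1) by (intro exI[of _ 1] exI[of _ "\<lambda>n. complex_of_real (M n)"])
          (auto simp: summable_complex_of_real)
    qed
    then obtain g g' where gg: "\<And>a. a \<in> ball 0 1 \<Longrightarrow> ((\<lambda>n. F n (along l z a)) sums g a) \<and>
        ((\<lambda>n. cpartial l (F n) (along l z a)) sums g' a) \<and> (g has_field_derivative g' a) (at a)"
      by blast
    have g: "\<And>a. a \<in> ball 0 1 \<Longrightarrow> (\<lambda>n. F n (along l z a)) sums g a"
       "(\<lambda>n. cpartial l (F n) z) sums g' 0" "(g has_field_derivative g' 0) (at 0)"
      using gg gg[of 0] by simp_all
    have "g a = G (along l z a)" if "a \<in> ball 0 1" for a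
      using g(1)[OF that] S sums_unique2 by blast
    then have "((\<lambda>a. G (along l z a)) has_field_derivative g' 0) (at 0)"
      by (intro has_field_derivative_transform_within_open[OF g(3) open_ball[of 0 1]]) auto
    moreover from this have "cpartial l G z = g' 0" unfolding cpartial_def by (rule DERIV_imp_deriv)
    ultimately show ?thesis using g(2) by simp
  qed
  show "((\<lambda>a. G (along l z a)) has_field_derivative cpartial l G z) (at 0)" using main by blast
  have "\<exists>M. summable M \<and> (\<forall>n. \<forall>z\<in>polydisc \<rho>. cmod (cpartial l (F n) z) \<le> M n)" for \<rho>
  proof -
    obtain M where M: "summable M" "\<And>n z. z \<in> polydisc (\<rho> + 1) \<Longrightarrow> cmod (F n z) \<le> M n"
      using B[of "\<rho> + 1"] by blast
    have "cmod (cpartial l (F n) z) \<le> M n" if "z \<in> polydisc \<rho>" for n z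
      by (rule cpartial_bound[OF E M(2) that])
    with M(1) show ?thesis by blast
  qed
  moreover have "cpartial l (F n) \<in> entire_class \<kappa>" for n
    by (rule entire_cpartial(1)[OF E])
  ultimately show "normally_sums \<kappa> (\<lambda>n. cpartial l (F n)) (cpartial l G)"
    unfolding normally_sums_def using main by simp
qed

lemma hessian_normally_sums:
  assumes "normally_sums \<kappa> F G"
  shows "hessian (\<lambda>y. G (complexify y)) y $ l $ s = cpartial l (cpartial s G) (complexify y)"
proof -
  have "partial_deriv s (\<lambda>y. G (complexify y)) = (\<lambda>y. cpartial s G (complexify y))"
    by (intro ext partial_deriv_complexify normally_sums_cpartial(2)[OF assms])
  then show ?thesis unfolding hessian_def
    using partial_deriv_complexify[OF normally_sums_cpartial(2)[OF normally_sums_cpartial(1)[OF assms]]] by simp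
qed

text \<open>The sum of all modes of degree \<open>n\<close> in the expansion of the plane wave with direction \<open>x\<close>.\<close>

definition wave_term :: "real \<Rightarrow> real^3 \<Rightarrow> nat \<Rightarrow> complex^3 \<Rightarrow> complex" where
  "wave_term \<kappa> x n z = plane_wave_term n (of_real \<kappa> * cdot (complexify x) z) (of_real (\<kappa>\<^sup>2) * cdot z z)"

lemma wave_term_normally_sums:
  "normally_sums \<kappa> (wave_term \<kappa> x) (\<lambda>z. exp (- \<i> * (of_real \<kappa> * cdot (complexify x) z)))"
  unfolding normally_sums_def
proof (intro conjI allI)
  show "wave_term \<kappa> x n \<in> entire_class \<kappa>" for n
  proof -
    have "(\<lambda>z. of_real \<kappa> * cdot (complexify x) z) \<in> entire_class \<kappa>"
      "(\<lambda>z. of_real (\<kappa>\<^sup>2) * cdot z z) \<in> entire_class \<kappa>"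
      by (rule entire_mult[OF entire_const entire_cdot(1)]) (rule entire_mult[OF entire_const entire_cdot(2)])
    from entire_mult[OF entire_mult[OF entire_const entire_hom_legendre[OF this]] entire_psi]
    show ?thesis unfolding wave_term_def[abs_def] plane_wave_term_def .
  qed
  show "(\<lambda>n. wave_term \<kappa> x n z) sums exp (- \<i> * (of_real \<kappa> * cdot (complexify x) z))" for z
    unfolding wave_term_def by (rule plane_wave_expansion)
  fix \<rho>
  define A where "A = \<bar>\<kappa>\<bar> * (\<Sum>i\<in>UNIV. \<bar>x $ i\<bar> * \<bar>\<rho>\<bar>)"
  define B where "B = \<kappa>\<^sup>2 * (\<Sum>i\<in>(UNIV :: 3 set). \<bar>\<rho>\<bar> * \<bar>\<rho>\<bar>)"
  have AB: "A \<ge> 0" "B \<ge> 0" by (auto simp: A_def B_def intro!: mult_nonneg_nonneg sum_nonneg)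
  have "cmod (wave_term \<kappa> x n z) \<le> exp B * ((2 * real n + 1) * (2 * A + B + 1) ^ n / fact n)" if "z \<in> polydisc \<rho>" for n z
  proof -
    have z: "cmod (z $ i) \<le> \<bar>\<rho>\<bar>" for i
      by (rule order_trans[OF _ abs_ge_self]) (use that in \<open>auto simp: polydisc_def\<close>)
    show ?thesis unfolding wave_term_def
    proof (rule norm_plane_wave_term_le)
      show "cmod (of_real \<kappa> * cdot (complexify x) z) \<le> A"
        unfolding A_def norm_mult cdot_def norm_of_real
        by (intro mult_left_mono order_trans[OF norm_sum] sum_mono)
           (auto simp: complexify_def norm_mult intro!: mult_left_mono z)
      show "cmod (of_real (\<kappa>\<^sup>2) * cdot z z) \<le> B"
        unfolding B_def norm_mult cdot_def norm_of_real
      proof (intro mult_mono order_trans[OF norm_sum] sum_mono)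
        show "cmod (z $ i * z $ i) \<le> \<bar>\<rho>\<bar> * \<bar>\<rho>\<bar>" for i
          unfolding norm_mult by (intro mult_mono z) auto
      qed auto
    qed
  qed
  then show "\<exists>M. summable M \<and> (\<forall>n. \<forall>z\<in>polydisc \<rho>. cmod (wave_term \<kappa> x n z) \<le> M n)"
    using AB by (intro exI[of _ "\<lambda>n. exp B * ((2 * real n + 1) * (2 * A + B + 1) ^ n / fact n)"] conjI
        summable_mult summable_linear_exp) auto
qed

lemma plane_wave_complexify:
  "exp (- \<i> * of_real (\<kappa> * (x \<bullet> y))) = exp (- \<i> * (of_real \<kappa> * cdot (complexify x) (complexify y)))"
  by (simp add: cdot_def complexify_def inner_vec_def)

lemma hessian_plane_wave:
  "hessian (\<lambda>y. exp (- \<i> * of_real (\<kappa> * (x \<bullet> y)))) y $ l $ s =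
     - of_real (\<kappa>\<^sup>2 * x $ l * x $ s) * exp (- \<i> * of_real (\<kappa> * (x \<bullet> y)))"
proof -
  have a: "cdot (complexify x) (along k z a) = cdot (complexify x) z + of_real (x $ k) * a" for k z a
    unfolding cdot_def complexify_def UNIV_3 using exhaust_3[of k]
    by (auto simp: axis_def algebra_simps)
  have d: "partial_deriv k (\<lambda>y. c * exp (- \<i> * of_real (\<kappa> * (x \<bullet> y)))) =
     (\<lambda>y. (c * (- \<i> * of_real (\<kappa> * x $ k))) * exp (- \<i> * of_real (\<kappa> * (x \<bullet> y))))" for c k
    unfolding plane_wave_complexify
    by (intro ext partial_deriv_complexify[where F = "\<lambda>z. c * exp (- \<i> * (of_real \<kappa> * cdot (complexify x) z))"])
       (unfold a, auto intro!: derivative_eq_intros simp: algebra_simps)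
  show ?thesis using d[of s 1] unfolding hessian_def
    by (simp only: vec_lambda_beta mult_1_left d) (simp add: power2_eq_square mult_ac)
qed

section \<open>Spherical harmonics and regular wave functions\<close>

definition harmonic_const :: "nat \<Rightarrow> nat \<Rightarrow> real" where
  "harmonic_const n k = (2 * real n + 1) / (4 * pi) * (fact (n - k) / fact (n + k))"

abbreviation planar :: "real^3 \<Rightarrow> complex" where
  "planar x \<equiv> Complex (x $ 1) (x $ 2)"

lemma norm_planar: "norm x = 1 \<Longrightarrow> (cmod (planar x))\<^sup>2 = 1 - (x $ 3)\<^sup>2"
proof -
  assume "norm x = 1"
  then have "x \<bullet> x = 1" by (simp add: norm_eq_1)
  then have "x $ 1 * x $ 1 + x $ 2 * x $ 2 + x $ 3 * x $ 3 = 1" by (simp add: inner_vec_def sum_3)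
  then have "(x $ 1)\<^sup>2 + (x $ 2)\<^sup>2 = 1 - (x $ 3)\<^sup>2" unfolding power2_eq_square by linarith
  then show ?thesis by (simp add: cmod_power2)
qed

text \<open>With the factor \<open>sin \<theta>\<close> of \<open>P\<^sub>n\<^sup>m\<close> absorbed, \<open>e\<^sup>i\<^sup>m\<^sup>\<phi>\<close> becomes a power of \<open>x\<^sub>1 + \<i> x\<^sub>2\<close> or of its
  conjugate, and the angle disappears.\<close>

definition planar_power :: "int \<Rightarrow> complex \<Rightarrow> complex" where
  "planar_power m z = (if m \<ge> 0 then z ^ nat m else cnj z ^ nat (- m))"

lemma planar_power_polar: "of_real (cmod z ^ nat \<bar>m\<bar>) * cis (of_int m * Arg z) = planar_power m z"
proof (cases m)
  case (nonneg k)
  have "of_real (cmod z) * cis (Arg z) = z" using rcis_cmod_Arg[of z] by (simp add: rcis_def)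
  then have "(of_real (cmod z) * cis (Arg z)) ^ k = z ^ k" by (rule arg_cong)
  then have "of_real (cmod z) ^ k * cis (real k * Arg z) = z ^ k"
    by (simp only: power_mult_distrib Complex.DeMoivre)
  then show ?thesis unfolding nonneg by (simp add: planar_power_def)
next
  case (neg k)
  have "of_real (cmod z) * cis (- Arg z) = cnj (rcis (cmod z) (Arg z))"
    unfolding rcis_def complex_cnj_mult complex_cnj_complex_of_real cis_cnj ..
  also have "\<dots> = cnj z" by (simp only: rcis_cmod_Arg)
  finally have "of_real (cmod z) * cis (- Arg z) = cnj z" .
  then have "(of_real (cmod z) * cis (- Arg z)) ^ Suc k = cnj z ^ Suc k" by (rule arg_cong)
  then have "of_real (cmod z) ^ Suc k * cis (real (Suc k) * (- Arg z)) = cnj z ^ Suc k"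
    by (simp only: power_mult_distrib Complex.DeMoivre)
  moreover have "nat \<bar>- int (Suc k)\<bar> = Suc k" "nat (- (- int (Suc k))) = Suc k" "\<not> - int (Suc k) \<ge> 0" by simp_all
  moreover have "of_int (- int (Suc k)) * Arg z = real (Suc k) * (- Arg z)" by (simp add: algebra_simps)
  ultimately show ?thesis unfolding neg planar_power_def of_real_power by (simp only: if_False)
qed

lemma sph_harmonic_unit:
  assumes "norm x = 1"
  shows "sph_harmonic n m x = of_real (sqrt (harmonic_const n (nat \<bar>m\<bar>)) * dlegendre n (nat \<bar>m\<bar>) (x $ 3)) * planar_power m (planar x)"
proof -
  have "sqrt (1 - (x $ 3)\<^sup>2) = cmod (planar x)"
    using norm_planar[OF assms] by (metis norm_ge_zero real_sqrt_unique)
  then have "sph_harmonic n m x = of_real (sqrt (harmonic_const n (nat \<bar>m\<bar>)) * dlegendre n (nat \<bar>m\<bar>) (x $ 3))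
      * (of_real (cmod (planar x) ^ nat \<bar>m\<bar>) * cis (of_int m * Arg (planar x)))"
    unfolding sph_harmonic_def assoc_legendre_def dlegendre_def harmonic_const_def by (simp add: mult_ac)
  then show ?thesis unfolding planar_power_polar .
qed

lemma sum_symmetric_int:
  fixes h :: "int \<Rightarrow> 'a::comm_monoid_add"
  shows "(\<Sum>m\<in>{- int n..int n}. h m) = h 0 + (\<Sum>j<n. h (int (Suc j)) + h (- int (Suc j)))"
proof (induction n)
  case (Suc n)
  have "{- int (Suc n)..int (Suc n)} = insert (int (Suc n)) (insert (- int (Suc n)) {- int n..int n})" by auto
  then show ?case using Suc by (simp add: add_ac)
qed simp

text \<open>The terms with indices \<open>m\<close> and \<open>-m\<close> carry the powers of \<open>z = planar x * cnj (planar u)\<close> and of its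
  conjugate with the same real factor. So they pair up to real parts, and \<open>legendre_addition\<close> sums them.\<close>

lemma sph_harmonic_addition:
  assumes x: "norm x = 1" and u: "norm u = 1"
  shows "(\<Sum>m\<in>{- int n..int n}. sph_harmonic n m x * cnj (sph_harmonic n m u)) =
           of_real ((2 * real n + 1) / (4 * pi) * poly (legendre_poly n) (x \<bullet> u))"
proof -
  define z where "z = planar x * cnj (planar u)"
  let ?w = "addition_weight (x $ 3) (u $ 3) n"
  define c where "c = (2 * real n + 1) / (4 * pi)"
  have prod: "sph_harmonic n m x * cnj (sph_harmonic n m u) = of_real (c * ?w (nat \<bar>m\<bar>)) * planar_power m z" for m
  proof -
    have pos: "harmonic_const n k \<ge> 0" for k by (simp add: harmonic_const_def)
    have "planar_power m (planar x) * cnj (planar_power m (planar u)) = planar_power m z"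
      by (simp add: planar_power_def z_def power_mult_distrib)
    moreover have "sqrt (harmonic_const n (nat \<bar>m\<bar>)) * sqrt (harmonic_const n (nat \<bar>m\<bar>)) = harmonic_const n (nat \<bar>m\<bar>)"
      using pos by simp
    ultimately have "sph_harmonic n m x * cnj (sph_harmonic n m u) =
        of_real (harmonic_const n (nat \<bar>m\<bar>) * (dlegendre n (nat \<bar>m\<bar>) (x $ 3) * dlegendre n (nat \<bar>m\<bar>) (u $ 3))) * planar_power m z"
    proof -
      assume a: "planar_power m (planar x) * cnj (planar_power m (planar u)) = planar_power m z"
        and b: "sqrt (harmonic_const n (nat \<bar>m\<bar>)) * sqrt (harmonic_const n (nat \<bar>m\<bar>)) = harmonic_const n (nat \<bar>m\<bar>)"
      define d d' r where "d = dlegendre n (nat \<bar>m\<bar>) (x $ 3)" and "d' = dlegendre n (nat \<bar>m\<bar>) (u $ 3)"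
        and "r = sqrt (harmonic_const n (nat \<bar>m\<bar>))"
      note X = sph_harmonic_unit[OF x, of n m, folded d_def r_def] and U = sph_harmonic_unit[OF u, of n m, folded d'_def r_def]
      have "sph_harmonic n m x * cnj (sph_harmonic n m u) =
          of_real (r * r * (d * d')) * (planar_power m (planar x) * cnj (planar_power m (planar u)))"
        unfolding X U by simp
      then show ?thesis unfolding a b[folded r_def] d_def d'_def .
    qed
    then show ?thesis by (simp add: addition_weight_def harmonic_const_def c_def mult_ac)
  qed
  have pair: "planar_power (int (Suc j)) z + planar_power (- int (Suc j)) z = of_real (2 * Re (z ^ Suc j))" for j
  proof -
    have "planar_power (- int (Suc j)) z = cnj (z ^ Suc j)"
      by (simp only: planar_power_def minus_minus nat_int complex_cnj_power) simp
    moreover have "planar_power (int (Suc j)) z = z ^ Suc j"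
      by (simp only: planar_power_def nat_int) simp
    ultimately show ?thesis by (simp only: complex_add_cnj)
  qed
  have L: "?w 0 + 2 * (\<Sum>j<n. ?w (Suc j) * Re (z ^ Suc j)) = poly (legendre_poly n) (x $ 3 * u $ 3 + Re z)"
    using norm_planar[OF x] norm_planar[OF u]
    by (intro legendre_addition[symmetric]) (simp add: z_def norm_mult power_mult_distrib)
  have xu: "x $ 3 * u $ 3 + Re z = x \<bullet> u" by (simp add: z_def inner_vec_def sum_3)
  have "(\<Sum>m\<in>{- int n..int n}. sph_harmonic n m x * cnj (sph_harmonic n m u)) =
     of_real (c * ?w 0) + (\<Sum>j<n. of_real (c * ?w (Suc j)) * (planar_power (int (Suc j)) z + planar_power (- int (Suc j)) z))"
    unfolding prod sum_symmetric_int by (simp add: planar_power_def distrib_left nat_add_distrib del: of_nat_Suc)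
  also have "\<dots> = of_real (c * (?w 0 + 2 * (\<Sum>j<n. ?w (Suc j) * Re (z ^ Suc j))))"
    unfolding pair by (simp add: distrib_left sum_distrib_left mult_ac del: power_Suc)
  finally show ?thesis unfolding L xu c_def .
qed

lemma cdot_complexify: "cdot (complexify x) (complexify y) = of_real (x \<bullet> y)"
  by (simp add: cdot_def complexify_def inner_vec_def)

text \<open>Summation over the order removes the spherical coordinates: what remains depends on \<open>x \<bullet> y\<close> and
  \<open>y \<bullet> y\<close> only.\<close>

lemma wave_fun_addition:
  assumes x: "norm x = 1" and y: "y \<noteq> 0"
  shows "4 * pi * (\<Sum>m\<in>{- int n..int n}. (- \<i>) ^ n * sph_harmonic n m x * wave_fun \<kappa> n m y) = wave_term \<kappa> x n (complexify y)"
proof -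
  define u where "u = y /\<^sub>R norm y"
  define t where "t = \<kappa> * norm y"
  have u: "norm u = 1" "y = norm y *\<^sub>R u" using y by (simp_all add: u_def)
  have "4 * pi * (\<Sum>m\<in>{- int n..int n}. (- \<i>) ^ n * sph_harmonic n m x * wave_fun \<kappa> n m y) =
     4 * pi * ((- \<i>) ^ n * of_real (spherical_bessel n t) * (\<Sum>m\<in>{- int n..int n}. sph_harmonic n m x * cnj (sph_harmonic n m u)))"
    unfolding wave_fun_def u_def[symmetric] t_def[symmetric] by (simp add: sum_distrib_left mult_ac)
  also have "\<dots> = (2 * of_nat n + 1) * (- \<i>) ^ n * (of_real t ^ n * of_real (poly (legendre_poly n) (x \<bullet> u))) * bessel_psi n (of_real t ^ 2)"
    unfolding sph_harmonic_addition[OF x u(1)] spherical_bessel_eq_psi by simp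
  also have "of_real t ^ n * of_real (poly (legendre_poly n) (x \<bullet> u)) = hom_legendre n (of_real t * of_real (x \<bullet> u)) (of_real t ^ 2 * 1)"
    unfolding hom_legendre_scale hom_legendre_real ..
  also have "of_real t * of_real (x \<bullet> u) = of_real \<kappa> * cdot (complexify x) (complexify y)"
    unfolding cdot_complexify t_def by (subst (2) u(2)) simp
  also have "(of_real t ^ 2 :: complex) = of_real (\<kappa>\<^sup>2) * cdot (complexify y) (complexify y)"
    unfolding cdot_complexify t_def by (simp add: power_mult_distrib power2_norm_eq_inner flip: of_real_power of_real_mult)
  finally show ?thesis unfolding wave_term_def plane_wave_term_def by simp
qed

lemma dlegendre_diagonal: "\<exists>c. \<forall>t. dlegendre n n t = c"
proof (induction n rule: induct_nat_012)
  case 0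
  show ?case by (intro exI[of _ 1] allI) (simp add: dlegendre_0)
next
  case 1
  show ?case by (intro exI[of _ 1] allI) (simp add: dlegendre_1)
next
  case (ge2 n)
  from ge2(2) obtain c where c: "\<forall>t. dlegendre (Suc n) (Suc n) t = c" by (rule exE)
  have "dlegendre (Suc (Suc n)) (Suc (Suc n)) t = (2 * real n + 3) * c" for t
    using dlegendre_lower[of n "Suc n" t] c by (simp add: dlegendre_eq_0)
  then show ?case by (intro exI allI)
qed

text \<open>The derivatives of \<open>P\<^sub>n\<close> have a parity, so multiplying by the appropriate power of \<open>|y|\<close> turns
  them into polynomials in \<open>y\<^sub>3\<close> and \<open>|y|\<^sup>2\<close>. The induction follows \<open>dlegendre_mult_X\<close>, which determines
  degree \<open>n + 2\<close> except for \<open>k = n + 2\<close>, where the derivative is a constant.\<close>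

lemma dlegendre_solid:
  "\<exists>G\<in>entire_class \<kappa>. \<forall>y. y \<noteq> 0 \<longrightarrow>
     G (complexify y) * of_real (norm y ^ k) = of_real (norm y ^ n * dlegendre n k (y $ 3 / norm y))"
proof (induction n rule: induct_nat_012)
  case 0
  show ?case
    by (intro bexI[OF _ entire_const[of "if k = 0 then 1 else 0"]] allI impI) (simp add: dlegendre_0)
next
  case 1
  consider "k = 0" | "k = 1" | "k > 1" by linarith
  then show ?case
  proof cases
    case 1
    show ?thesis by (intro bexI[OF _ entire_coord[of 3]] allI impI) (simp add: dlegendre_1 1 complexify_def)
  next
    case 2
    show ?thesis by (intro bexI[OF _ entire_const[of 1]] allI impI) (simp add: dlegendre_1 2)
  next
    case 3
    show ?thesis by (intro bexI[OF _ entire_const[of 0]] allI impI) (use 3 in \<open>simp add: dlegendre_1\<close>)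
  qed
next
  case (ge2 n)
  show ?case
  proof (cases "k = Suc (Suc n)")
    case True
    obtain c where "\<forall>t. dlegendre (Suc (Suc n)) (Suc (Suc n)) t = c"
      using dlegendre_diagonal[of "Suc (Suc n)"] by (rule exE)
    then show ?thesis
      by (intro bexI[OF _ entire_const[of "of_real c"]] allI impI) (simp add: True)
  next
    case False
    obtain G where G: "G \<in> entire_class \<kappa>" "\<forall>y. y \<noteq> 0 \<longrightarrow> G (complexify y) * of_real (norm y ^ k) = of_real (norm y ^ n * dlegendre n k (y $ 3 / norm y))"
      using ge2(1) by (rule bexE)
    obtain H where H: "H \<in> entire_class \<kappa>" "\<forall>y. y \<noteq> 0 \<longrightarrow> H (complexify y) * of_real (norm y ^ k) = of_real (norm y ^ Suc n * dlegendre (Suc n) k (y $ 3 / norm y))"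
      using ge2(2) by (rule bexE)
    define d where "d = real n + 2 - real k"
    have d: "d \<noteq> 0" using False unfolding d_def by linarith
    define K where "K = (\<lambda>z. (of_real ((2 * real n + 3) / d) * z $ 3) * H z - (of_real ((real n + 1 + real k) / d) * cdot z z) * G z)"
    have K: "K \<in> entire_class \<kappa>" unfolding K_def
      by (rule entire_diff[OF entire_mult[OF entire_mult[OF entire_const entire_coord] H(1)]
          entire_mult[OF entire_mult[OF entire_const entire_cdot(2)] G(1)]])
    have "K (complexify y) * of_real (norm y ^ k) = of_real (norm y ^ Suc (Suc n) * dlegendre (Suc (Suc n)) k (y $ 3 / norm y))"
      if y: "y \<noteq> 0" for y
    proof -
      have D: "d * dlegendre (Suc (Suc n)) k (y $ 3 / norm y) =
         (2 * real n + 3) * (y $ 3 / norm y * dlegendre (Suc n) k (y $ 3 / norm y)) - (real n + 1 + real k) * dlegendre n k (y $ 3 / norm y)"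
        using dlegendre_mult_X[of n "y $ 3 / norm y" k] by (simp add: d_def)
      have "K (complexify y) * of_real (norm y ^ k) =
         of_real ((2 * real n + 3) / d * y $ 3) * (H (complexify y) * of_real (norm y ^ k)) -
         of_real ((real n + 1 + real k) / d * (norm y)\<^sup>2) * (G (complexify y) * of_real (norm y ^ k))"
        unfolding K_def cdot_complexify by (simp add: complexify_def algebra_simps power2_norm_eq_inner)
      also have "\<dots> = of_real ((2 * real n + 3) / d * y $ 3 * (norm y ^ Suc n * dlegendre (Suc n) k (y $ 3 / norm y))
          - (real n + 1 + real k) / d * (norm y)\<^sup>2 * (norm y ^ n * dlegendre n k (y $ 3 / norm y)))"
        unfolding G(2)[rule_format, OF y] H(2)[rule_format, OF y] by simp
      also have "(2 * real n + 3) / d * y $ 3 * (norm y ^ Suc n * dlegendre (Suc n) k (y $ 3 / norm y))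
          - (real n + 1 + real k) / d * (norm y)\<^sup>2 * (norm y ^ n * dlegendre n k (y $ 3 / norm y)) =
           norm y ^ Suc (Suc n) / d * (d * dlegendre (Suc (Suc n)) k (y $ 3 / norm y))"
        unfolding D using y d by (simp add: field_simps power2_eq_square)
      also have "\<dots> = norm y ^ Suc (Suc n) * dlegendre (Suc (Suc n)) k (y $ 3 / norm y)" using d by simp
      finally show ?thesis .
    qed
    then show ?thesis by (intro bexI[OF _ K] allI impI)
  qed
qed

text \<open>The direction of \<open>y\<close> is undefined at the origin; a single point does not affect the integrals below.\<close>

lemma wave_fun_entire:
  "\<exists>F\<in>entire_class \<kappa>. \<forall>y. y \<noteq> 0 \<longrightarrow> wave_fun \<kappa> n m y = F (complexify y)"
proof -
  define k where "k = nat \<bar>m\<bar>"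
  define c where "c = complex_of_real (\<kappa> ^ n * sqrt (harmonic_const n k))"
  obtain G where G: "G \<in> entire_class \<kappa>" "\<forall>y. y \<noteq> 0 \<longrightarrow> G (complexify y) * of_real (norm y ^ k) = of_real (norm y ^ n * dlegendre n k (y $ 3 / norm y))"
    using dlegendre_solid[of \<kappa> k n] by (rule bexE)
  \<comment> \<open>The wave function contains the conjugate spherical harmonic, hence the sign.\<close>
  define e where "e = (if m \<ge> 0 then - \<i> else \<i>)"
  define F where "F = (\<lambda>z. ((c * bessel_psi n (of_real (\<kappa>\<^sup>2) * cdot z z)) * G z) * (z $ 1 + e * z $ 2) ^ k)"
  have F: "F \<in> entire_class \<kappa>" unfolding F_def
    by (rule entire_mult[OF entire_mult[OF entire_mult[OF entire_const entire_psi] G(1)]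
        entire_power[OF entire_add[OF entire_coord entire_mult[OF entire_const entire_coord]]]])
  have "wave_fun \<kappa> n m y = F (complexify y)" if y: "y \<noteq> 0" for y
  proof -
    define u where "u = y /\<^sub>R norm y"
    have u: "norm u = 1" using y by (simp add: u_def)
    have p: "cnj (planar_power m (planar u)) * of_real (norm y ^ k) = (complexify y $ 1 + e * complexify y $ 2) ^ k"
    proof -
      have "cnj (planar_power m (planar u)) = ((complexify y $ 1 + e * complexify y $ 2) / of_real (norm y)) ^ k"
      proof (cases "m \<ge> 0")
        case True
        have "cnj (planar u) = (complexify y $ 1 + e * complexify y $ 2) / of_real (norm y)"
          using True y by (simp add: e_def u_def complexify_def complex_eq_iff divide_inverse power2_eq_square)
        then show ?thesis using True by (simp add: planar_power_def k_def)
      next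
        case False
        have "planar u = (complexify y $ 1 + e * complexify y $ 2) / of_real (norm y)"
          using False y by (simp add: e_def u_def complexify_def complex_eq_iff divide_inverse power2_eq_square)
        then show ?thesis using False by (simp add: planar_power_def k_def)
      qed
      then show ?thesis using y by (simp add: power_divide)
    qed
    have "wave_fun \<kappa> n m y = of_real ((\<kappa> * norm y) ^ n) * bessel_psi n (of_real (\<kappa>\<^sup>2) * cdot (complexify y) (complexify y)) *
       (of_real (sqrt (harmonic_const n k) * dlegendre n k (y $ 3 / norm y)) * cnj (planar_power m (planar u)))"
    proof -
      have "(of_real (\<kappa> * norm y) ^ 2 :: complex) = of_real (\<kappa>\<^sup>2) * cdot (complexify y) (complexify y)"
        unfolding cdot_complexify by (simp add: power_mult_distrib power2_norm_eq_inner flip: of_real_power of_real_mult)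
      moreover have "u $ 3 = y $ 3 / norm y" by (simp add: u_def divide_inverse mult.commute)
      ultimately show ?thesis
        unfolding wave_fun_def u_def[symmetric] sph_harmonic_unit[OF u] spherical_bessel_eq_psi k_def by simp
    qed
    also have "\<dots> = c * bessel_psi n (of_real (\<kappa>\<^sup>2) * cdot (complexify y) (complexify y)) *
       of_real (norm y ^ n * dlegendre n k (y $ 3 / norm y)) * cnj (planar_power m (planar u))"
      by (simp add: c_def power_mult_distrib)
    also have "\<dots> = F (complexify y)"
      unfolding G(2)[rule_format, OF y, symmetric] F_def p[symmetric] by simp
    finally show ?thesis .
  qed
  then show ?thesis by (intro bexI[OF _ F] allI impI)
qed

section \<open>The Green function as a function of the inverse distance\<close>

text \<open>For \<open>x = e / \<tau>\<close> with a unit vector \<open>e\<close>, \<open>p = e \<bullet> y\<close> and \<open>s = |y|\<^sup>2\<close> one has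
  \<open>|x - y| = Q / \<tau>\<close>, where \<open>Q\<close> is the square root of \<open>1 - 2 \<tau> p + \<tau>\<^sup>2 s\<close>. Hence
  \<open>e\<^sup>i\<^sup>\<kappa>\<^sup>|\<^sup>x\<^sup>-\<^sup>y\<^sup>| / |x - y|\<close> is \<open>\<tau> e\<^sup>i\<^sup>\<kappa>\<^sup>/\<^sup>\<tau>\<close> times \<open>\<Phi> = exp (\<i> \<kappa> V) / Q\<close> with
  \<open>V = (Q - 1) / \<tau>\<close>, and \<open>\<Phi>\<close> is holomorphic in \<open>\<tau>\<close> near \<open>0\<close>. The functions below are \<open>Q\<^sup>2\<close>, \<open>Q\<close>, \<open>V\<close>
  (written without division by \<open>\<tau>\<close>), \<open>\<Phi>\<close>, and the derivatives of \<open>\<Phi>\<close> with respect to \<open>\<tau>\<close> and \<open>p\<close>.\<close>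

definition sph_arg :: "complex \<Rightarrow> complex \<Rightarrow> complex \<Rightarrow> complex" where
  "sph_arg \<tau> p s = 1 - 2 * \<tau> * p + \<tau>\<^sup>2 * s"

definition sph_root :: "complex \<Rightarrow> complex \<Rightarrow> complex \<Rightarrow> complex" where
  "sph_root \<tau> p s = csqrt (sph_arg \<tau> p s)"

definition sph_phase :: "complex \<Rightarrow> complex \<Rightarrow> complex \<Rightarrow> complex" where
  "sph_phase \<tau> p s = (\<tau> * s - 2 * p) / (sph_root \<tau> p s + 1)"

definition aw_kernel :: "real \<Rightarrow> complex \<Rightarrow> complex \<Rightarrow> complex \<Rightarrow> complex" where
  "aw_kernel \<kappa> \<tau> p s = exp (\<i> * of_real \<kappa> * sph_phase \<tau> p s) / sph_root \<tau> p s"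

definition aw_dtau :: "real \<Rightarrow> complex \<Rightarrow> complex \<Rightarrow> complex \<Rightarrow> complex" where
  "aw_dtau \<kappa> \<tau> p s = (let Q = sph_root \<tau> p s; V = sph_phase \<tau> p s; k = \<i> * of_real \<kappa> in
     exp (k * V) * (k * (s - V\<^sup>2) / (2 * Q ^ 2) - (\<tau> * s - p) / Q ^ 3))"

definition aw_dtau2 :: "real \<Rightarrow> complex \<Rightarrow> complex \<Rightarrow> complex \<Rightarrow> complex" where
  "aw_dtau2 \<kappa> \<tau> p s = (let Q = sph_root \<tau> p s; V = sph_phase \<tau> p s; k = \<i> * of_real \<kappa>;
     V' = (s - V\<^sup>2) / (2 * Q); Q' = (\<tau> * s - p) / Q in
     exp (k * V) * (k * V' * (k * (s - V\<^sup>2) / (2 * Q ^ 2) - (\<tau> * s - p) / Q ^ 3)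
       - k * V * V' / Q ^ 2 - k * (s - V\<^sup>2) * Q' / Q ^ 3 - s / Q ^ 3 + 3 * (\<tau> * s - p) * Q' / Q ^ 4))"

definition aw_dp :: "real \<Rightarrow> complex \<Rightarrow> complex \<Rightarrow> complex \<Rightarrow> complex" where
  "aw_dp \<kappa> \<tau> p s = (let Q = sph_root \<tau> p s; V = sph_phase \<tau> p s; k = \<i> * of_real \<kappa> in
     exp (k * V) * (\<tau> / Q ^ 3 - k / Q ^ 2))"

definition aw_dp2 :: "real \<Rightarrow> complex \<Rightarrow> complex \<Rightarrow> complex \<Rightarrow> complex" where
  "aw_dp2 \<kappa> \<tau> p s = (let Q = sph_root \<tau> p s; V = sph_phase \<tau> p s; k = \<i> * of_real \<kappa> in
     exp (k * V) * (k\<^sup>2 / Q ^ 3 - 3 * k * \<tau> / Q ^ 4 + 3 * \<tau>\<^sup>2 / Q ^ 5))"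

lemma deriv_exp_cmult:
  fixes V :: "complex \<Rightarrow> complex"
  assumes "(V has_field_derivative V') (at x)"
  shows "((\<lambda>x. exp (k * V x)) has_field_derivative exp (k * V x) * (k * V')) (at x)"
  using assms by (auto intro!: derivative_eq_intros)

lemma deriv_over_power:
  fixes N Q :: "complex \<Rightarrow> complex"
  assumes "(N has_field_derivative N') (at x)" "(Q has_field_derivative Q') (at x)" "Q x \<noteq> 0"
  shows "((\<lambda>x. N x / Q x ^ n) has_field_derivative N' / Q x ^ n - of_nat n * N x * Q' / Q x ^ Suc n) (at x)"
proof -
  have "((\<lambda>x. N x / Q x ^ n) has_field_derivative
      (N' * Q x ^ n - N x * (of_nat n * (Q' * Q x ^ (n - Suc 0)))) / (Q x ^ n * Q x ^ n)) (at x)"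
    by (rule DERIV_quotient[OF assms(1) DERIV_power[OF assms(2)], unfolded power2_eq_square, THEN DERIV_cong])
       (use assms(3) in \<open>auto simp: mult_ac\<close>)
  also have "(N' * Q x ^ n - N x * (of_nat n * (Q' * Q x ^ (n - Suc 0)))) / (Q x ^ n * Q x ^ n) =
      N' / Q x ^ n - of_nat n * N x * Q' / Q x ^ Suc n"
    using assms(3) by (cases n) (simp_all add: field_simps)
  finally show ?thesis .
qed

context
  fixes \<tau> p s :: complex
  assumes ok: "sph_arg \<tau> p s \<notin> \<real>\<^sub>\<le>\<^sub>0"
begin

lemma sph_root_nonzero: "sph_root \<tau> p s \<noteq> 0" "sph_root \<tau> p s + 1 \<noteq> 0"
proof -
  show "sph_root \<tau> p s \<noteq> 0" using ok by (auto simp: sph_root_def)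
  have "Re (sph_root \<tau> p s) \<ge> 0" unfolding sph_root_def by (rule Re_csqrt)
  then show "sph_root \<tau> p s + 1 \<noteq> 0" by (auto simp: complex_eq_iff)
qed

lemma sph_root_sq: "sph_root \<tau> p s ^ 2 = 1 - 2 * \<tau> * p + \<tau>\<^sup>2 * s"
  by (simp add: sph_root_def sph_arg_def)

text \<open>Since \<open>Q\<^sup>2 = 1 - 2 \<tau> p + \<tau>\<^sup>2 s\<close>, both \<open>Q\<close> and \<open>p\<close> are polynomials in \<open>V\<close>, \<open>\<tau>\<close> and \<open>s\<close>. After
  this substitution the Helmholtz equation becomes an identity of rational functions.\<close>

lemma sph_phase_relations:
  "sph_root \<tau> p s = 1 + \<tau> * sph_phase \<tau> p s"
  "2 * p = \<tau> * s - 2 * sph_phase \<tau> p s - \<tau> * (sph_phase \<tau> p s)\<^sup>2"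
proof -
  define Q where "Q = sph_root \<tau> p s"
  define V where "V = sph_phase \<tau> p s"
  have Q: "Q + 1 \<noteq> 0" "Q ^ 2 = 1 - 2 * \<tau> * p + \<tau>\<^sup>2 * s" using sph_root_nonzero sph_root_sq by (simp_all add: Q_def)
  have V: "V * (Q + 1) = \<tau> * s - 2 * p" using Q by (simp add: V_def Q_def sph_phase_def)
  have "(Q - 1) * (Q + 1) = \<tau> * V * (Q + 1)"
    using Q(2) V by algebra
  then have "Q - 1 = \<tau> * V" using Q(1) by simp
  then have Q1: "Q = 1 + \<tau> * V" by (simp add: algebra_simps)
  then show "sph_root \<tau> p s = 1 + \<tau> * sph_phase \<tau> p s" by (simp add: Q_def V_def)
  show "2 * p = \<tau> * s - 2 * sph_phase \<tau> p s - \<tau> * (sph_phase \<tau> p s)\<^sup>2"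
    using V Q1 unfolding V_def[symmetric] by (simp add: algebra_simps power2_eq_square)
qed

text \<open>The Helmholtz equation for \<open>\<tau> e\<^sup>i\<^sup>\<kappa>\<^sup>/\<^sup>\<tau> \<Phi>\<close> in the spherical coordinates \<open>(1 / \<tau>, e)\<close>; on functions of
  \<open>p = e \<bullet> y\<close> the Laplace--Beltrami operator in \<open>e\<close> is \<open>(s - p\<^sup>2) \<partial>\<^sub>p\<^sup>2 - 2 p \<partial>\<^sub>p\<close>. In terms of
  \<open>X = s - V\<^sup>2\<close>, \<open>V\<close> and \<open>\<tau>\<close> the left-hand side, without the exponential and the powers of \<open>Q\<close> in the denominator, is a
  polynomial multiple of \<open>Q - 1 - \<tau> V = 0\<close>.\<close>

lemma aw_pde:
  "\<tau>\<^sup>2 * aw_dtau2 \<kappa> \<tau> p s + (2 * \<tau> - 2 * \<i> * of_real \<kappa>) * aw_dtau \<kappa> \<tau> p s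
     + (s - p\<^sup>2) * aw_dp2 \<kappa> \<tau> p s - 2 * p * aw_dp \<kappa> \<tau> p s = 0"
proof -
  define Q where "Q = sph_root \<tau> p s"
  define V where "V = sph_phase \<tau> p s"
  define k where "k = \<i> * complex_of_real \<kappa>"
  have Q0: "Q \<noteq> 0" and Q: "Q = 1 + \<tau> * V" and p: "p = (\<tau> * s - 2 * V - \<tau> * V\<^sup>2) / 2"
    using sph_root_nonzero sph_phase_relations by (simp_all add: Q_def V_def field_simps)
  have Qn: "1 + \<tau> * V \<noteq> 0" using Q0 Q by simp
  have "\<tau>\<^sup>2 * (k * ((s - V\<^sup>2) / (2 * Q)) * (k * (s - V\<^sup>2) / (2 * Q ^ 2) - (\<tau> * s - p) / Q ^ 3)
       - k * V * ((s - V\<^sup>2) / (2 * Q)) / Q ^ 2 - k * (s - V\<^sup>2) * ((\<tau> * s - p) / Q) / Q ^ 3 - s / Q ^ 3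
       + 3 * (\<tau> * s - p) * ((\<tau> * s - p) / Q) / Q ^ 4)
     + (2 * \<tau> - 2 * k) * (k * (s - V\<^sup>2) / (2 * Q ^ 2) - (\<tau> * s - p) / Q ^ 3)
     + (s - p\<^sup>2) * (k\<^sup>2 / Q ^ 3 - 3 * k * \<tau> / Q ^ 4 + 3 * \<tau>\<^sup>2 / Q ^ 5) - 2 * p * (\<tau> / Q ^ 3 - k / Q ^ 2) = 0" (is "?A = 0")
  proof -
    \<comment> \<open>In terms of \<open>X\<close> the expressions \<open>\<tau> * s - p\<close> and \<open>s - p\<^sup>2\<close> become short.\<close>
    define X where "X = s - V\<^sup>2"
    have s: "s = X + V\<^sup>2" by (simp add: X_def)
    have p': "p = \<tau> * X / 2 - V" by (simp add: p X_def field_simps)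
    have Y: "\<tau> * s - p = \<tau> * X / 2 + V * Q"
      by (simp add: p' s Q algebra_simps power2_eq_square)
    have sp: "s - p\<^sup>2 = X * Q - \<tau>\<^sup>2 * X\<^sup>2 / 4"
      by (simp add: p' s Q algebra_simps power2_eq_square)
    have "?A = (Q - 1 - \<tau> * V) * (2 * k * \<tau> * X * Q\<^sup>2 - 3 * \<tau>\<^sup>2 * X * Q - 2 * \<tau> * V * Q\<^sup>2) / Q ^ 5"
      unfolding X_def[symmetric] Y sp unfolding p' s
      using Q0 by (simp add: field_simps power_numeral_reduce)
    then show ?thesis using Q by simp
  qed
  then have "exp (k * V) * ?A = 0" by simp
  then show ?thesis
    unfolding aw_dtau2_def aw_dtau_def aw_dp2_def aw_dp_def Let_def Q_def[symmetric] V_def[symmetric] k_def[symmetric]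
      mult.assoc[of 2 \<i>] by (simp add: algebra_simps)
qed

lemma sph_root_dtau: "((\<lambda>\<tau>. sph_root \<tau> p s) has_field_derivative (\<tau> * s - p) / sph_root \<tau> p s) (at \<tau>)"
proof -
  have "((\<lambda>\<tau>. sph_arg \<tau> p s) has_field_derivative 2 * (\<tau> * s - p)) (at \<tau>)"
    unfolding sph_arg_def by (auto intro!: derivative_eq_intros simp: algebra_simps)
  from has_field_derivative_csqrt'[OF this ok] show ?thesis
    unfolding sph_root_def mult_divide_mult_cancel_left[OF zero_neq_numeral[symmetric]] .
qed

lemma sph_root_dp: "((\<lambda>p. sph_root \<tau> p s) has_field_derivative - \<tau> / sph_root \<tau> p s) (at p)"
proof -
  have "((\<lambda>p. sph_arg \<tau> p s) has_field_derivative 2 * (- \<tau>)) (at p)"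
    unfolding sph_arg_def by (auto intro!: derivative_eq_intros simp: algebra_simps)
  from has_field_derivative_csqrt'[OF this ok] show ?thesis
    unfolding sph_root_def mult_divide_mult_cancel_left[OF zero_neq_numeral[symmetric]] .
qed

lemma sph_phase_dtau:
  "((\<lambda>\<tau>. sph_phase \<tau> p s) has_field_derivative (s - (sph_phase \<tau> p s)\<^sup>2) / (2 * sph_root \<tau> p s)) (at \<tau>)"
proof -
  define Q where "Q = sph_root \<tau> p s"
  define V where "V = sph_phase \<tau> p s"
  have nz: "Q \<noteq> 0" "Q + 1 \<noteq> 0" using sph_root_nonzero by (simp_all add: Q_def)
  have Q: "Q = 1 + \<tau> * V" and p: "2 * p = \<tau> * s - 2 * V - \<tau> * V\<^sup>2"
    using sph_phase_relations by (simp_all add: Q_def V_def)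
  have V: "V = (\<tau> * s - 2 * p) / (Q + 1)" by (simp add: V_def Q_def sph_phase_def)
  have "((\<lambda>\<tau>. sph_phase \<tau> p s) has_field_derivative
     (s * (Q + 1) - (\<tau> * s - 2 * p) * ((\<tau> * s - p) / Q)) / ((Q + 1) * (Q + 1))) (at \<tau>)"
    unfolding sph_phase_def
    by (rule derivative_eq_intros sph_root_dtau refl | use nz in \<open>simp add: Q_def\<close>)+
  also have "(s * (Q + 1) - (\<tau> * s - 2 * p) * ((\<tau> * s - p) / Q)) / ((Q + 1) * (Q + 1)) = (s - V\<^sup>2) / (2 * Q)"
  proof -
    have V1: "V * (Q + 1) = \<tau> * s - 2 * p" using nz V by simp
    have "(s * (Q + 1) * Q - (\<tau> * s - 2 * p) * (\<tau> * s - p)) * 2 = (s - V\<^sup>2) * ((Q + 1) * (Q + 1))"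
      using V1 Q p by algebra
    then show ?thesis using nz by (simp add: divide_simps)
  qed
  finally show ?thesis by (simp add: V_def Q_def)
qed

lemma sph_phase_dp: "((\<lambda>p. sph_phase \<tau> p s) has_field_derivative - 1 / sph_root \<tau> p s) (at p)"
proof -
  define Q where "Q = sph_root \<tau> p s"
  define V where "V = sph_phase \<tau> p s"
  have nz: "Q \<noteq> 0" "Q + 1 \<noteq> 0" using sph_root_nonzero by (simp_all add: Q_def)
  have Q: "Q = 1 + \<tau> * V" 
    using sph_phase_relations by (simp_all add: Q_def V_def)
  have V: "V = (\<tau> * s - 2 * p) / (Q + 1)" by (simp add: V_def Q_def sph_phase_def)
  have "((\<lambda>p. sph_phase \<tau> p s) has_field_derivative
     (- 2 * (Q + 1) - (\<tau> * s - 2 * p) * (- \<tau> / Q)) / ((Q + 1) * (Q + 1))) (at p)"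
    unfolding sph_phase_def
    by (rule derivative_eq_intros sph_root_dp refl | use nz in \<open>simp add: Q_def\<close>)+
  also have "(- 2 * (Q + 1) - (\<tau> * s - 2 * p) * (- \<tau> / Q)) / ((Q + 1) * (Q + 1)) = - 1 / Q"
  proof -
    have V1: "V * (Q + 1) = \<tau> * s - 2 * p" using nz V by simp
    have "- 2 * (Q + 1) * Q + (\<tau> * s - 2 * p) * \<tau> = - ((Q + 1) * (Q + 1))"
      using V1 Q by algebra
    then show ?thesis using nz by (simp add: divide_simps)
  qed
  finally show ?thesis by (simp add: V_def Q_def)
qed

lemma aw_kernel_dtau: "((\<lambda>\<tau>. aw_kernel \<kappa> \<tau> p s) has_field_derivative aw_dtau \<kappa> \<tau> p s) (at \<tau>)"
  unfolding aw_kernel_def aw_dtau_def Let_def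
  by (rule DERIV_cong[OF DERIV_mult[OF deriv_exp_cmult[OF sph_phase_dtau]
          deriv_over_power[OF DERIV_const[of 1] sph_root_dtau sph_root_nonzero(1), of 1], unfolded power_one_right mult_1_right
          times_divide_eq_right]])
     (use sph_root_nonzero in \<open>simp add: divide_simps power_numeral_reduce\<close>, simp add: algebra_simps)

lemma aw_dtau_dtau: "((\<lambda>\<tau>. aw_dtau \<kappa> \<tau> p s) has_field_derivative aw_dtau2 \<kappa> \<tau> p s) (at \<tau>)"
proof -
  let ?k = "\<i> * complex_of_real \<kappa>"
  have N1: "((\<lambda>\<tau>. ?k * (s - (sph_phase \<tau> p s)\<^sup>2) / 2) has_field_derivative
      - ?k * sph_phase \<tau> p s * ((s - (sph_phase \<tau> p s)\<^sup>2) / (2 * sph_root \<tau> p s))) (at \<tau>)"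
    by (auto intro!: derivative_eq_intros sph_phase_dtau)
  have N2: "((\<lambda>\<tau>. \<tau> * s - p) has_field_derivative s) (at \<tau>)"
    by (auto intro!: derivative_eq_intros)
  show ?thesis
    unfolding aw_dtau_def aw_dtau2_def Let_def
    by (rule DERIV_cong[OF DERIV_mult[OF deriv_exp_cmult[OF sph_phase_dtau] DERIV_diff[OF
          deriv_over_power[OF N1 sph_root_dtau sph_root_nonzero(1), of 2, unfolded divide_divide_eq_left]
          deriv_over_power[OF N2 sph_root_dtau sph_root_nonzero(1), of 3]]]])
       (use sph_root_nonzero in \<open>simp add: divide_simps power_numeral_reduce\<close>, simp add: algebra_simps)
qed

lemma aw_kernel_dp: "((\<lambda>p. aw_kernel \<kappa> \<tau> p s) has_field_derivative aw_dp \<kappa> \<tau> p s) (at p)"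
  unfolding aw_kernel_def aw_dp_def Let_def
  by (rule DERIV_cong[OF DERIV_mult[OF deriv_exp_cmult[OF sph_phase_dp]
          deriv_over_power[OF DERIV_const[of 1] sph_root_dp sph_root_nonzero(1), of 1], unfolded power_one_right mult_1_right
          times_divide_eq_right]])
     (use sph_root_nonzero in \<open>simp add: divide_simps power_numeral_reduce\<close>, simp add: algebra_simps)

lemma aw_dp_dp: "((\<lambda>p. aw_dp \<kappa> \<tau> p s) has_field_derivative aw_dp2 \<kappa> \<tau> p s) (at p)"
  unfolding aw_dp_def aw_dp2_def Let_def
  by (rule DERIV_cong[OF DERIV_mult[OF deriv_exp_cmult[OF sph_phase_dp] DERIV_diff[OF
          deriv_over_power[OF DERIV_const sph_root_dp sph_root_nonzero(1), of _ 3]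
          deriv_over_power[OF DERIV_const sph_root_dp sph_root_nonzero(1), of _ 2]]]])
     (use sph_root_nonzero in \<open>simp add: divide_simps power_numeral_reduce\<close>, simp add: algebra_simps)

end

section \<open>Parameter integrals and square roots\<close>

lemma tendsto_integral_mult:
  fixes k :: "'b::first_countable_topology \<Rightarrow> 'a \<Rightarrow> complex"
  assumes f: "integrable M f" and U: "open U" "a \<in> U"
    and meas: "\<And>h. h \<in> U - {a} \<Longrightarrow> k h \<in> borel_measurable M" "k0 \<in> borel_measurable M"
    and lim: "\<And>y. y \<in> space M \<Longrightarrow> ((\<lambda>h. k h y) \<longlongrightarrow> k0 y) (at a)"
    and bound: "\<And>h y. h \<in> U - {a} \<Longrightarrow> y \<in> space M \<Longrightarrow> cmod (k h y) \<le> B"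
  shows "((\<lambda>h. \<integral>y. k h y * f y \<partial>M) \<longlongrightarrow> (\<integral>y. k0 y * f y \<partial>M)) (at a)"
  unfolding tendsto_at_iff_sequentially comp_def
proof (intro allI impI)
  fix X :: "nat \<Rightarrow> 'b" assume X: "\<forall>i. X i \<in> UNIV - {a}" "X \<longlonglongrightarrow> a"
  have "\<forall>\<^sub>F i in sequentially. X i \<in> U" using X(2) U by (rule topological_tendstoD)
  then obtain N where N: "\<And>i. i \<ge> N \<Longrightarrow> X i \<in> U" by (auto simp: eventually_sequentially)
  have XN: "X (i + N) \<in> U - {a}" for i using N X(1) by auto
  have fm: "f \<in> borel_measurable M" using f by simp
  have "(\<lambda>i. \<integral>y. k (X (i + N)) y * f y \<partial>M) \<longlonglongrightarrow> (\<integral>y. k0 y * f y \<partial>M)"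
  proof (rule integral_dominated_convergence)
    show "integrable M (\<lambda>y. B * norm (f y))" using f by simp
    show "(\<lambda>y. k0 y * f y) \<in> borel_measurable M" using meas(2) fm by measurable
    show "(\<lambda>y. k (X (i + N)) y * f y) \<in> borel_measurable M" for i
      using meas(1)[OF XN] fm by measurable
    show "AE y in M. (\<lambda>i. k (X (i + N)) y * f y) \<longlonglongrightarrow> k0 y * f y"
    proof (rule AE_I2)
      fix y assume y: "y \<in> space M"
      have "(\<lambda>i. X (i + N)) \<longlonglongrightarrow> a" using X(2) by (rule LIMSEQ_ignore_initial_segment)
      then have "filterlim (\<lambda>i. X (i + N)) (at a) sequentially"
        using X(1) by (auto simp: filterlim_at)
      from filterlim_compose[OF lim[OF y] this] show "(\<lambda>i. k (X (i + N)) y * f y) \<longlonglongrightarrow> k0 y * f y"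
        by (intro tendsto_mult tendsto_const)
    qed
    show "AE y in M. norm (k (X (i + N)) y * f y) \<le> B * norm (f y)" for i
      using bound[OF XN] by (auto simp: norm_mult intro!: AE_I2 mult_right_mono)
  qed
  then show "(\<lambda>i. \<integral>y. k (X i) y * f y \<partial>M) \<longlonglongrightarrow> (\<integral>y. k0 y * f y \<partial>M)"
    by (rule LIMSEQ_offset)
qed

lemma integrable_bounded_mult:
  fixes k f :: "'a \<Rightarrow> complex"
  assumes "integrable M f" "k \<in> borel_measurable M" "\<And>y. y \<in> space M \<Longrightarrow> cmod (k y) \<le> B"
  shows "integrable M (\<lambda>y. k y * f y)"
proof (rule Bochner_Integration.integrable_bound)
  show "integrable M (\<lambda>y. B * norm (f y))" using assms(1) by simp
  have "f \<in> borel_measurable M" using assms(1) by simp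
  with assms(2) show "(\<lambda>y. k y * f y) \<in> borel_measurable M" by measurable
  show "AE y in M. norm (k y * f y) \<le> norm (B * norm (f y))"
    using assms(3) by (auto simp: norm_mult intro!: AE_I2 mult_right_mono order_trans[OF _ abs_ge_self])
qed

text \<open>The bound for the derivative of the kernel bounds the difference quotients as well, and these are
  what dominated convergence is applied to.\<close>

lemma deriv_under_integral:
  fixes k k' :: "complex \<Rightarrow> 'a \<Rightarrow> complex"
  assumes f: "integrable M f" and S: "open S" "z0 \<in> S"
    and der: "\<And>z y. z \<in> S \<Longrightarrow> y \<in> space M \<Longrightarrow> ((\<lambda>z. k z y) has_field_derivative k' z y) (at z)"
    and meas: "\<And>z. z \<in> S \<Longrightarrow> k z \<in> borel_measurable M" "\<And>z. z \<in> S \<Longrightarrow> k' z \<in> borel_measurable M"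
    and bound: "\<And>z y. z \<in> S \<Longrightarrow> y \<in> space M \<Longrightarrow> cmod (k z y) \<le> B"
      "\<And>z y. z \<in> S \<Longrightarrow> y \<in> space M \<Longrightarrow> cmod (k' z y) \<le> B'"
  shows "((\<lambda>z. \<integral>y. k z y * f y \<partial>M) has_field_derivative (\<integral>y. k' z0 y * f y \<partial>M)) (at z0)"
proof -
  obtain e where e: "e > 0" "ball z0 e \<subseteq> S" using S open_contains_ball by blast
  define q where "q h y = (k (z0 + h) y - k z0 y) / h" for h y
  have inS: "z0 + h \<in> S" if "h \<in> ball 0 e" for h using that e(2) by (auto simp: dist_norm)
  have int: "integrable M (\<lambda>y. k z y * f y)" if "z \<in> S" for z
    by (rule integrable_bounded_mult[OF f meas(1)[OF that] bound(1)[OF that]])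
  have "((\<lambda>h. \<integral>y. q h y * f y \<partial>M) \<longlongrightarrow> (\<integral>y. k' z0 y * f y \<partial>M)) (at 0)"
  proof (rule tendsto_integral_mult[OF f, of "ball 0 e"])
    show "k' z0 \<in> borel_measurable M" by (rule meas(2)[OF S(2)])
    show "q h \<in> borel_measurable M" if "h \<in> ball 0 e - {0}" for h
      using meas(1)[OF inS[of h]] meas(1)[OF S(2)] that unfolding q_def[abs_def] by (auto intro!: borel_measurable_divide borel_measurable_diff)
    show "((\<lambda>h. q h y) \<longlongrightarrow> k' z0 y) (at 0)" if "y \<in> space M" for y
      using der[OF S(2) that] unfolding DERIV_def q_def .
    show "cmod (q h y) \<le> B'" if "h \<in> ball 0 e - {0}" "y \<in> space M" for h y
    proof -
      have "norm (k (z0 + h) y - k z0 y) \<le> B' * norm (z0 + h - z0)"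
      proof (rule field_differentiable_bound[of "ball z0 e" _ "\<lambda>z. k' z y"])
        show "((\<lambda>z. k z y) has_field_derivative k' z y) (at z within ball z0 e)" if "z \<in> ball z0 e" for z
          by (rule has_field_derivative_at_within[OF der]) (use that e(2) \<open>y \<in> space M\<close> in auto)
        show "norm (k' z y) \<le> B'" if "z \<in> ball z0 e" for z
          using bound(2)[of z y] that e(2) \<open>y \<in> space M\<close> by auto
      qed (use that e(1) in \<open>auto simp: dist_norm\<close>)
      then show ?thesis using that by (simp add: q_def norm_divide divide_simps)
    qed
  qed (use e in auto)
  moreover have "\<forall>\<^sub>F h in at 0. (\<integral>y. q h y * f y \<partial>M) = ((\<integral>y. k (z0 + h) y * f y \<partial>M) - (\<integral>y. k z0 y * f y \<partial>M)) / h"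
  proof -
    have "(\<integral>y. q h y * f y \<partial>M) = ((\<integral>y. k (z0 + h) y * f y \<partial>M) - (\<integral>y. k z0 y * f y \<partial>M)) / h"
      if "h \<in> ball 0 e" for h
    proof -
      have "(\<integral>y. q h y * f y \<partial>M) = (\<integral>y. (k (z0 + h) y * f y - k z0 y * f y) / h \<partial>M)"
        by (simp add: q_def diff_divide_distrib left_diff_distrib)
      also have "\<dots> = (\<integral>y. (k (z0 + h) y * f y - k z0 y * f y) \<partial>M) / h" by simp
      also have "\<dots> = ((\<integral>y. k (z0 + h) y * f y \<partial>M) - (\<integral>y. k z0 y * f y \<partial>M)) / h"
        using int[OF inS[OF that]] int[OF S(2)] by simp
      finally show ?thesis .
    qed
    then show ?thesis using e(1) by (intro eventually_at_in_open'[THEN eventually_mono, of "ball 0 e"]) auto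
  qed
  ultimately show ?thesis unfolding DERIV_def by (rule Lim_transform_eventually)
qed

text \<open>The remainder of a symmetric second difference, with a constant that depends only on a bound for the
  function. This is why the functions of an angle below are considered for complex angles.\<close>

lemma symmetric_taylor_bound:
  assumes hol: "\<phi> holomorphic_on ball 0 2" and B: "\<And>z. z \<in> cball 0 1 \<Longrightarrow> cmod (\<phi> z) \<le> B"
    and z: "cmod z \<le> 1 / 2"
  shows "cmod (\<phi> z + \<phi> (- z) - 2 * \<phi> 0 - (deriv ^^ 2) \<phi> 0 * z\<^sup>2) \<le> 4 * B * cmod z ^ 3"
proof -
  define a where "a n = (deriv ^^ n) \<phi> 0 / fact n" for n
  have cont: "continuous_on (cball 0 1) \<phi>" and hol1: "\<phi> holomorphic_on ball 0 1"
    using hol by (auto intro!: holomorphic_on_imp_continuous_on intro: holomorphic_on_subset)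
  have B0: "B \<ge> 0" using order_trans[OF norm_ge_zero B[of 0]] by simp
  have a: "cmod (a n) \<le> B" for n
  proof -
    have "norm ((deriv ^^ n) \<phi> 0) \<le> fact n * B / 1 ^ n"
      by (rule Cauchy_inequality[OF hol1 cont]) (use B in auto)
    then show ?thesis by (simp add: a_def norm_divide divide_simps mult.commute)
  qed
  have ser: "(\<lambda>n. a n * w ^ n) sums \<phi> w" if "cmod w < 1" for w
    using holomorphic_power_series[OF hol1, of w] that by (simp add: a_def)
  define b where "b n = a n * z ^ n + a n * (- z) ^ n" for n
  have "b sums (\<phi> z + \<phi> (- z))" unfolding b_def using z by (intro sums_add ser) auto
  then have "(\<lambda>n. b (n + 3)) sums (\<phi> z + \<phi> (- z) - (\<Sum>i<3. b i))" by (rule sums_split_initial_segment)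
  moreover have "(\<Sum>i<3. b i) = 2 * \<phi> 0 + (deriv ^^ 2) \<phi> 0 * z\<^sup>2"
    by (simp add: eval_nat_numeral b_def a_def)
  ultimately have s: "(\<lambda>n. b (n + 3)) sums (\<phi> z + \<phi> (- z) - 2 * \<phi> 0 - (deriv ^^ 2) \<phi> 0 * z\<^sup>2)"
    by (simp add: algebra_simps)
  have bb: "cmod (b (n + 3)) \<le> (2 * B * cmod z ^ 3) * (1 / 2) ^ n" for n
  proof -
    have "cmod (b (n + 3)) \<le> cmod (a (n + 3) * z ^ (n + 3)) + cmod (a (n + 3) * (- z) ^ (n + 3))"
      unfolding b_def by (rule norm_triangle_ineq)
    also have "\<dots> = 2 * (cmod (a (n + 3)) * (cmod z ^ 3 * cmod z ^ n))"
      by (simp add: norm_mult norm_power power_add)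
    also have "\<dots> \<le> 2 * (B * (cmod z ^ 3 * (1 / 2) ^ n))"
      using z a B0 by (intro mult_left_mono mult_mono power_mono) auto
    finally show ?thesis by simp
  qed
  have g: "(\<lambda>n. (2 * B * cmod z ^ 3) * (1 / 2 :: real) ^ n) sums ((2 * B * cmod z ^ 3) * 2)"
    using sums_mult[OF geometric_sums[of "1 / 2 :: real"], of "2 * B * cmod z ^ 3"] by simp
  have "cmod (\<Sum>n. b (n + 3)) \<le> (\<Sum>n. (2 * B * cmod z ^ 3) * (1 / 2) ^ n)"
    by (rule norm_suminf_le[OF bb sums_summable[OF g]])
  then show ?thesis using sums_unique[OF s] sums_unique[OF g] by simp
qed

lemma nonpos_Reals_mult_Re_pos:
  assumes "Re a > 0" "Re b > 0"
  shows "a * b \<notin> \<real>\<^sub>\<le>\<^sub>0"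
proof
  assume "a * b \<in> \<real>\<^sub>\<le>\<^sub>0"
  then obtain c where c: "c \<le> 0" "a * b = of_real c" by (auto simp: nonpos_Reals_def)
  have "of_real ((cmod a)\<^sup>2) * b = (a * b) * cnj a"
    unfolding complex_norm_square by (simp only: mult_ac)
  then have "of_real ((cmod a)\<^sup>2) * b = of_real c * cnj a" unfolding c .
  then have "(cmod a)\<^sup>2 * Re b = c * Re a" by (simp add: complex_eq_iff)
  moreover have "(cmod a)\<^sup>2 * Re b > 0" using assms by (intro mult_pos_pos) auto
  moreover have "c * Re a \<le> 0" using c assms by (simp add: mult_nonpos_nonneg)
  ultimately show False by simp
qed

text \<open>The quadratic polynomial in \<open>\<tau>\<close> factors as \<open>(1 - \<tau> w) (1 - \<tau> w')\<close> with \<open>|w| = |w'| = |y|\<close>.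
  Both factors have positive real part, so their product avoids the cut of the square root.\<close>

lemma sph_arg_real_ok:
  assumes "norm x = 1" "cmod \<tau> * norm y < 1"
  shows "sph_arg \<tau> (of_real (x \<bullet> y)) (of_real (y \<bullet> y)) \<notin> \<real>\<^sub>\<le>\<^sub>0"
proof -
  define p where "p = x \<bullet> y"
  have "\<bar>p\<bar> \<le> norm y" using Cauchy_Schwarz_ineq2[of x y] assms by (simp add: p_def)
  then have "p\<^sup>2 \<le> (norm y)\<^sup>2" using power_mono[of "\<bar>p\<bar>" "norm y" 2] by simp
  then have p: "p\<^sup>2 \<le> y \<bullet> y" by (simp add: power2_norm_eq_inner)
  define q where "q = sqrt (y \<bullet> y - p\<^sup>2)"
  have q: "q\<^sup>2 = y \<bullet> y - p\<^sup>2" using p by (simp add: q_def)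
  have n: "cmod (Complex p q) = norm y" "cmod (Complex p (- q)) = norm y"
    using q by (simp_all add: cmod_def norm_eq_sqrt_inner)
  have eq: "sph_arg \<tau> (of_real p) (of_real (y \<bullet> y)) = (1 - \<tau> * Complex p q) * (1 - \<tau> * Complex p (- q))"
  proof -
    have gen: "(1 - \<tau> * A) * (1 - \<tau> * B) = 1 - \<tau> * (A + B) + \<tau>\<^sup>2 * (A * B)" for A B
      by (simp add: algebra_simps power2_eq_square)
    have ab: "Complex p q * Complex p (- q) = of_real (y \<bullet> y)" "Complex p q + Complex p (- q) = 2 * of_real p"
      using q by (simp_all add: complex_eq_iff power2_eq_square)
    show ?thesis unfolding gen ab by (simp add: sph_arg_def mult_ac)
  qed
  have R: "Re (1 - \<tau> * w) > 0" if "cmod w = norm y" for w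
  proof -
    have "Re (\<tau> * w) \<le> cmod (\<tau> * w)" by (rule complex_Re_le_cmod)
    also have "\<dots> < 1" using assms(2) that by (simp add: norm_mult)
    finally show ?thesis by simp
  qed
  show ?thesis unfolding p_def[symmetric] eq by (intro nonpos_Reals_mult_Re_pos R n)
qed

lemma sph_arg_small_ok:
  assumes "cmod (2 * \<tau> * p) + cmod (\<tau>\<^sup>2 * s) < 1"
  shows "sph_arg \<tau> p s \<notin> \<real>\<^sub>\<le>\<^sub>0"
proof -
  have "cmod (2 * \<tau> * p - \<tau>\<^sup>2 * s) < 1" using norm_triangle_ineq4[of "2 * \<tau> * p" "\<tau>\<^sup>2 * s"] assms by linarith
  then have "Re (2 * \<tau> * p - \<tau>\<^sup>2 * s) < 1" using complex_Re_le_cmod le_less_trans by blast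
  then have "Re (sph_arg \<tau> p s) > 0" by (simp add: sph_arg_def)
  then show ?thesis by (auto simp: complex_nonpos_Reals_iff)
qed

lemma aw_continuous:
  assumes T: "continuous_on K T" and P: "continuous_on K P" and S: "continuous_on K S"
    and ok: "\<And>z. z \<in> K \<Longrightarrow> sph_arg (T z) (P z) (S z) \<notin> \<real>\<^sub>\<le>\<^sub>0"
  shows "continuous_on K (\<lambda>z. aw_kernel \<kappa> (T z) (P z) (S z))" "continuous_on K (\<lambda>z. aw_dtau \<kappa> (T z) (P z) (S z))"
    "continuous_on K (\<lambda>z. aw_dtau2 \<kappa> (T z) (P z) (S z))"
    "continuous_on K (\<lambda>z. aw_dp \<kappa> (T z) (P z) (S z))" "continuous_on K (\<lambda>z. aw_dp2 \<kappa> (T z) (P z) (S z))"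
proof -
  have "continuous_on K (\<lambda>z. sph_arg (T z) (P z) (S z))"
    unfolding sph_arg_def by (intro continuous_intros T P S)
  then have Q: "continuous_on K (\<lambda>z. sph_root (T z) (P z) (S z))"
    unfolding sph_root_def using ok by (intro continuous_on_compose2[OF continuous_on_csqrt]) auto
  have nz: "\<forall>z\<in>K. sph_root (T z) (P z) (S z) \<noteq> 0" "\<forall>z\<in>K. sph_root (T z) (P z) (S z) + 1 \<noteq> 0"
    using sph_root_nonzero[OF ok] by auto
  have nzp: "\<forall>z\<in>K. sph_root (T z) (P z) (S z) ^ n \<noteq> 0" "\<forall>z\<in>K. 2 * sph_root (T z) (P z) (S z) ^ n \<noteq> 0"
    "\<forall>z\<in>K. 2 * sph_root (T z) (P z) (S z) \<noteq> 0" for n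
    using nz by auto
  have V: "continuous_on K (\<lambda>z. sph_phase (T z) (P z) (S z))"
    unfolding sph_phase_def by (intro continuous_intros T P S Q nz)
  show "continuous_on K (\<lambda>z. aw_kernel \<kappa> (T z) (P z) (S z))" "continuous_on K (\<lambda>z. aw_dtau \<kappa> (T z) (P z) (S z))"
    "continuous_on K (\<lambda>z. aw_dtau2 \<kappa> (T z) (P z) (S z))"
    "continuous_on K (\<lambda>z. aw_dp \<kappa> (T z) (P z) (S z))" "continuous_on K (\<lambda>z. aw_dp2 \<kappa> (T z) (P z) (S z))"
    unfolding aw_kernel_def aw_dtau_def aw_dtau2_def aw_dp_def aw_dp2_def Let_def
    by (intro continuous_intros T P S Q V nz nzp)+
qed

lemma compact_bound:
  fixes g :: "'a::topological_space \<Rightarrow> complex"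
  assumes "compact K" "continuous_on K g"
  obtains B where "B \<ge> 0" "\<And>z. z \<in> K \<Longrightarrow> cmod (g z) \<le> B"
proof -
  have "bounded (g ` K)" using assms by (intro compact_imp_bounded compact_continuous_image)
  then obtain B where "\<forall>z\<in>g ` K. norm z \<le> B" by (auto simp: bounded_iff)
  then show ?thesis by (intro that[of "max B 0"]) auto
qed

section \<open>The Atkinson--Wilcox recursion\<close>

lemma orthonormal_frame:
  fixes x :: "real^3"
  assumes "norm x = 1"
  obtains a b where "norm a = 1" "norm b = 1" "x \<bullet> a = 0" "x \<bullet> b = 0"
    "\<And>y. (x \<bullet> y)\<^sup>2 + (a \<bullet> y)\<^sup>2 + (b \<bullet> y)\<^sup>2 = y \<bullet> y"
proof -
  have "norm (axis 1 1 :: real^3) = norm x" using assms by simp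
  then have "\<exists>f. orthogonal_transformation f \<and> f (axis 1 1 :: real^3) = x"
    by (rule orthogonal_transformation_exists) (intro exI conjI, assumption+)
  then obtain f where f: "orthogonal_transformation f" "f (axis 1 1 :: real^3) = x"
    by (elim exE conjE)
  have inn: "f u \<bullet> f v = u \<bullet> v" for u v using f(1) by (simp add: orthogonal_transformation_def)
  have sj: "surj f" using f(1) by (rule orthogonal_transformation_surj)
  show ?thesis
  proof (rule that[of "f (axis 2 1)" "f (axis 3 1)"])
    show "norm (f (axis 2 1)) = 1" "norm (f (axis 3 1)) = 1"
      using f(1) by (simp_all add: orthogonal_transformation_norm)
    show "x \<bullet> f (axis 2 1) = 0" "x \<bullet> f (axis 3 1) = 0"
      unfolding f(2)[symmetric] inn by (simp_all add: inner_axis_axis)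
    fix y
    obtain u where u: "y = f u" using sj by blast
    show "(x \<bullet> y)\<^sup>2 + (f (axis 2 1) \<bullet> y)\<^sup>2 + (f (axis 3 1) \<bullet> y)\<^sup>2 = y \<bullet> y"
      unfolding f(2)[symmetric] u inn by (simp add: inner_axis' inner_vec_def[of u u] sum_3 power2_eq_square)
  qed
qed

text \<open>To be applied with one Cartesian component of the source for \<open>f\<close> and a ball that contains its support.\<close>

locale source_in_ball =
  fixes \<kappa> r :: real and f :: "real^3 \<Rightarrow> complex"
  assumes r: "r > 0" and \<kappa>: "\<kappa> > 0"
    and f: "integrable (lebesgue_on (cball 0 r)) f"
begin

abbreviation "M \<equiv> lebesgue_on (cball (0 :: real^3) r)"

abbreviation pr :: "real^3 \<Rightarrow> real^3 \<Rightarrow> complex" where "pr x y \<equiv> of_real (x \<bullet> y)"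

text \<open>The potential of \<open>f\<close> along the ray in direction \<open>x\<close> at distance \<open>1 / \<tau>\<close>, without its oscillating and
  decaying factors. Its Taylor coefficients at \<open>\<tau> = 0\<close> are the Atkinson--Wilcox coefficients; the
  coefficient of order zero is the far field.\<close>

definition aw_field :: "real^3 \<Rightarrow> complex \<Rightarrow> complex" where
  "aw_field x \<tau> = (\<integral>y. aw_kernel \<kappa> \<tau> (pr x y) (pr y y) * f y \<partial>M)"

definition aw_field1 :: "real^3 \<Rightarrow> complex \<Rightarrow> complex" where
  "aw_field1 x \<tau> = (\<integral>y. aw_dtau \<kappa> \<tau> (pr x y) (pr y y) * f y \<partial>M)"

definition aw_field2 :: "real^3 \<Rightarrow> complex \<Rightarrow> complex" where
  "aw_field2 x \<tau> = (\<integral>y. aw_dtau2 \<kappa> \<tau> (pr x y) (pr y y) * f y \<partial>M)"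

lemma measurable_M: "continuous_on (cball 0 r) g \<Longrightarrow> g \<in> borel_measurable M"
  by (rule continuous_imp_measurable_on_sets_lebesgue) auto

lemma arg_ok:
  assumes "norm x = 1" "\<tau> \<in> cball 0 \<rho>" "\<rho> < 1 / r" "y \<in> cball 0 r"
  shows "sph_arg \<tau> (pr x y) (pr y y) \<notin> \<real>\<^sub>\<le>\<^sub>0"
proof (rule sph_arg_real_ok[OF assms(1)])
  have "cmod \<tau> * norm y \<le> \<rho> * r" using assms by (intro mult_mono) (auto intro: order_trans[OF norm_ge_zero])
  also have "\<rho> * r < 1" using assms(3) r by (simp add: field_simps)
  finally show "cmod \<tau> * norm y < 1" .
qed

lemma kernel_bounds:
  assumes x: "norm x = 1" and \<rho>: "\<rho> < 1 / r"
  obtains B where "B \<ge> 0"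
    "\<And>\<tau> y. \<tau> \<in> cball 0 \<rho> \<Longrightarrow> y \<in> cball 0 r \<Longrightarrow> cmod (aw_kernel \<kappa> \<tau> (pr x y) (pr y y)) \<le> B"
    "\<And>\<tau> y. \<tau> \<in> cball 0 \<rho> \<Longrightarrow> y \<in> cball 0 r \<Longrightarrow> cmod (aw_dtau \<kappa> \<tau> (pr x y) (pr y y)) \<le> B"
    "\<And>\<tau> y. \<tau> \<in> cball 0 \<rho> \<Longrightarrow> y \<in> cball 0 r \<Longrightarrow> cmod (aw_dtau2 \<kappa> \<tau> (pr x y) (pr y y)) \<le> B"
proof -
  let ?K = "cball 0 \<rho> \<times> cball 0 r :: (complex \<times> (real^3)) set"
  have K: "compact ?K" by (intro compact_Times compact_cball)
  have c: "continuous_on ?K (\<lambda>z. fst z)" "continuous_on ?K (\<lambda>z. pr x (snd z))" "continuous_on ?K (\<lambda>z. pr (snd z) (snd z))"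
    by (intro continuous_intros)+
  have ok: "sph_arg (fst z) (pr x (snd z)) (pr (snd z) (snd z)) \<notin> \<real>\<^sub>\<le>\<^sub>0" if "z \<in> ?K" for z
    using that by (intro arg_ok[OF x _ \<rho>]) auto
  note cont = aw_continuous[OF c ok, of \<kappa>]
  obtain B1 where B1: "B1 \<ge> 0" "\<And>z. z \<in> ?K \<Longrightarrow> cmod (aw_kernel \<kappa> (fst z) (pr x (snd z)) (pr (snd z) (snd z))) \<le> B1"
    using compact_bound[OF K cont(1)] by auto
  obtain B2 where B2: "B2 \<ge> 0" "\<And>z. z \<in> ?K \<Longrightarrow> cmod (aw_dtau \<kappa> (fst z) (pr x (snd z)) (pr (snd z) (snd z))) \<le> B2"
    using compact_bound[OF K cont(2)] by auto
  obtain B3 where B3: "B3 \<ge> 0" "\<And>z. z \<in> ?K \<Longrightarrow> cmod (aw_dtau2 \<kappa> (fst z) (pr x (snd z)) (pr (snd z) (snd z))) \<le> B3"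
    using compact_bound[OF K cont(3)] by auto
  show ?thesis
  proof (rule that[of "B1 + B2 + B3"])
    show "B1 + B2 + B3 \<ge> 0" using B1 B2 B3 by simp
    fix \<tau> :: complex and y :: "real^3" assume "\<tau> \<in> cball 0 \<rho>" "y \<in> cball 0 r"
    then have "(\<tau>, y) \<in> ?K" by simp
    from B1(2)[OF this] B2(2)[OF this] B3(2)[OF this] B1(1) B2(1) B3(1)
    show "cmod (aw_kernel \<kappa> \<tau> (pr x y) (pr y y)) \<le> B1 + B2 + B3" "cmod (aw_dtau \<kappa> \<tau> (pr x y) (pr y y)) \<le> B1 + B2 + B3"
      "cmod (aw_dtau2 \<kappa> \<tau> (pr x y) (pr y y)) \<le> B1 + B2 + B3" by simp_all
  qed
qed

lemma kernel_measurable: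
  assumes x: "norm x = 1" and \<tau>: "\<tau> \<in> ball 0 (1 / r)"
  shows "(\<lambda>y. aw_kernel \<kappa> \<tau> (pr x y) (pr y y)) \<in> borel_measurable M"
    "(\<lambda>y. aw_dtau \<kappa> \<tau> (pr x y) (pr y y)) \<in> borel_measurable M"
    "(\<lambda>y. aw_dtau2 \<kappa> \<tau> (pr x y) (pr y y)) \<in> borel_measurable M"
    "(\<lambda>y. aw_dp \<kappa> \<tau> (pr x y) (pr y y)) \<in> borel_measurable M"
    "(\<lambda>y. aw_dp2 \<kappa> \<tau> (pr x y) (pr y y)) \<in> borel_measurable M"
proof -
  have c: "continuous_on (cball 0 r) (\<lambda>y. \<tau>)" "continuous_on (cball 0 r) (\<lambda>y. pr x y)" "continuous_on (cball 0 r) (\<lambda>y. pr y y)"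
    by (intro continuous_intros)+
  have ok: "sph_arg \<tau> (pr x y) (pr y y) \<notin> \<real>\<^sub>\<le>\<^sub>0" if "y \<in> cball 0 r" for y
    by (rule arg_ok[OF x _ _ that, of _ "cmod \<tau>"]) (use \<tau> in auto)
  note cont = aw_continuous[OF c ok, of \<kappa>]
  show "(\<lambda>y. aw_kernel \<kappa> \<tau> (pr x y) (pr y y)) \<in> borel_measurable M"
    "(\<lambda>y. aw_dtau \<kappa> \<tau> (pr x y) (pr y y)) \<in> borel_measurable M"
    "(\<lambda>y. aw_dtau2 \<kappa> \<tau> (pr x y) (pr y y)) \<in> borel_measurable M"
    "(\<lambda>y. aw_dp \<kappa> \<tau> (pr x y) (pr y y)) \<in> borel_measurable M"
    "(\<lambda>y. aw_dp2 \<kappa> \<tau> (pr x y) (pr y y)) \<in> borel_measurable M"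
    by (rule measurable_M[OF cont(1)] measurable_M[OF cont(2)] measurable_M[OF cont(3)]
        measurable_M[OF cont(4)] measurable_M[OF cont(5)]; assumption?)+
qed

lemma aw_field_deriv:
  assumes x: "norm x = 1" and \<tau>: "\<tau> \<in> ball 0 (1 / r)"
  shows "(aw_field x has_field_derivative aw_field1 x \<tau>) (at \<tau>)"
    and "(aw_field1 x has_field_derivative aw_field2 x \<tau>) (at \<tau>)"
    and "integrable M (\<lambda>y. aw_kernel \<kappa> \<tau> (pr x y) (pr y y) * f y)"
    and "integrable M (\<lambda>y. aw_dtau \<kappa> \<tau> (pr x y) (pr y y) * f y)"
    and "integrable M (\<lambda>y. aw_dtau2 \<kappa> \<tau> (pr x y) (pr y y) * f y)"
proof -
  define \<rho> where "\<rho> = (cmod \<tau> + 1 / r) / 2"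
  have \<rho>: "\<rho> < 1 / r" "\<tau> \<in> ball 0 \<rho>" using \<tau> by (auto simp: \<rho>_def)
  obtain B where B: "B \<ge> 0"
    "\<And>\<tau> y. \<tau> \<in> cball 0 \<rho> \<Longrightarrow> y \<in> cball 0 r \<Longrightarrow> cmod (aw_kernel \<kappa> \<tau> (pr x y) (pr y y)) \<le> B"
    "\<And>\<tau> y. \<tau> \<in> cball 0 \<rho> \<Longrightarrow> y \<in> cball 0 r \<Longrightarrow> cmod (aw_dtau \<kappa> \<tau> (pr x y) (pr y y)) \<le> B"
    "\<And>\<tau> y. \<tau> \<in> cball 0 \<rho> \<Longrightarrow> y \<in> cball 0 r \<Longrightarrow> cmod (aw_dtau2 \<kappa> \<tau> (pr x y) (pr y y)) \<le> B"
    by (rule kernel_bounds[OF x \<rho>(1)]) (rule that)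
  have ok: "sph_arg t (pr x y) (pr y y) \<notin> \<real>\<^sub>\<le>\<^sub>0" if "t \<in> ball 0 \<rho>" "y \<in> space M" for t y
    by (rule arg_ok[OF x _ \<rho>(1)]) (use that in auto)
  have sub: "t \<in> ball 0 (1 / r)" if "t \<in> ball 0 \<rho>" for t using that \<rho>(1) by auto
  show "(aw_field x has_field_derivative aw_field1 x \<tau>) (at \<tau>)"
    unfolding aw_field_def[abs_def] aw_field1_def
    by (rule deriv_under_integral[OF f open_ball \<rho>(2) aw_kernel_dtau[OF ok] kernel_measurable(1)[OF x sub]
        kernel_measurable(2)[OF x sub], of B B]) (use B in auto)
  show "(aw_field1 x has_field_derivative aw_field2 x \<tau>) (at \<tau>)"
    unfolding aw_field1_def[abs_def] aw_field2_def
    by (rule deriv_under_integral[OF f open_ball \<rho>(2) aw_dtau_dtau[OF ok] kernel_measurable(2)[OF x sub]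
        kernel_measurable(3)[OF x sub], of B B]) (use B in auto)
  show "integrable M (\<lambda>y. aw_kernel \<kappa> \<tau> (pr x y) (pr y y) * f y)"
    "integrable M (\<lambda>y. aw_dtau \<kappa> \<tau> (pr x y) (pr y y) * f y)"
    "integrable M (\<lambda>y. aw_dtau2 \<kappa> \<tau> (pr x y) (pr y y) * f y)"
    using B(2-4)[of \<tau>] \<rho>(2)
    by (auto intro!: integrable_bounded_mult[OF f, of _ B] kernel_measurable[OF x \<tau>])
qed

text \<open>For \<open>|\<tau>|\<close> up to this radius the square root stays away from its cut also when \<open>p\<close> comes from a point
  \<open>x cos \<theta> + a sin \<theta>\<close> with complex \<open>|\<theta>| \<le> 2\<close>. There cosine and sine are at most \<open>8\<close> in modulus, which
  gives \<open>|p| \<le> 16 r\<close>; the constant \<open>100\<close> is generous.\<close>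

definition small_radius :: real where "small_radius = 1 / (100 * r)"

lemma small_radius: "small_radius > 0" "small_radius < 1 / r"
  using r by (auto simp: small_radius_def field_simps)

lemma cos_sin_bound: "cmod (cos z) \<le> 8 \<and> cmod (sin z) \<le> 8" if "cmod z \<le> 2" for z :: complex
proof -
  have e: "exp 2 \<le> (8::real)"
  proof -
    have "exp 2 = exp (1::real) ^ 2" by (simp add: exp_double[symmetric])
    also have "\<dots> \<le> (272 / 100) ^ 2" using e_less_272 by (intro power_mono) auto
    finally show ?thesis by (simp add: power2_eq_square)
  qed
  have b: "cmod (exp (\<i> * w)) \<le> 8" if "cmod w \<le> 2" for w
  proof -
    have "cmod (exp (\<i> * w)) \<le> exp (cmod (\<i> * w))" by (rule norm_exp)
    also have "\<dots> \<le> exp 2" using that by (simp add: norm_mult)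
    finally show ?thesis using e by linarith
  qed
  have p: "cmod (exp (\<i> * z)) \<le> 8" "cmod (exp (- (\<i> * z))) \<le> 8" using b[of z] b[of "- z"] that by auto
  have "cmod (exp (\<i> * z) + exp (- (\<i> * z))) \<le> 16" "cmod (exp (\<i> * z) - exp (- (\<i> * z))) \<le> 16"
    using norm_triangle_ineq[of "exp (\<i> * z)" "exp (- (\<i> * z))"]
      norm_triangle_ineq4[of "exp (\<i> * z)" "exp (- (\<i> * z))"] p by linarith+
  then show ?thesis by (simp add: cos_exp_eq sin_exp_eq norm_divide norm_mult)
qed

text \<open>The second derivative of the field along the great circle from \<open>x\<close> towards \<open>a\<close> is the integral of
  the second derivative of the kernel. The error of the difference quotient is uniform in \<open>\<tau>\<close>, so
  that it passes to Taylor coefficients in \<open>\<tau>\<close> by Cauchy's inequality.\<close>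

lemma second_difference:
  assumes x: "norm x = 1" and a: "norm a = 1" and xa: "x \<bullet> a = 0"
  shows "\<exists>C\<ge>0. \<forall>\<tau>\<in>cball 0 small_radius. \<forall>\<theta>. 0 < \<theta> \<and> \<theta> \<le> 1 / 2 \<longrightarrow>
    cmod (aw_field (cos \<theta> *\<^sub>R x + sin \<theta> *\<^sub>R a) \<tau> + aw_field (cos \<theta> *\<^sub>R x - sin \<theta> *\<^sub>R a) \<tau> - 2 * aw_field x \<tau>
      - of_real (\<theta>\<^sup>2) * (\<integral>y. (aw_dp2 \<kappa> \<tau> (pr x y) (pr y y) * (pr a y)\<^sup>2 - aw_dp \<kappa> \<tau> (pr x y) (pr y y) * pr x y) * f y \<partial>M))
     \<le> C * \<theta> ^ 3"
proof -
  define P where "P \<theta> y = pr x y * cos \<theta> + pr a y * sin \<theta>" for \<theta> y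
  define \<phi> where "\<phi> \<tau> y \<theta> = aw_kernel \<kappa> \<tau> (P \<theta> y) (pr y y)" for \<tau> y \<theta>
  have prb: "cmod (pr u y) \<le> r" if "norm u = 1" "y \<in> cball 0 r" for u y
    using Cauchy_Schwarz_ineq2[of u y] that by simp
  have ok: "sph_arg \<tau> (P \<theta> y) (pr y y) \<notin> \<real>\<^sub>\<le>\<^sub>0" if "\<tau> \<in> cball 0 small_radius" "y \<in> cball 0 r" "cmod \<theta> \<le> 2" for \<tau> y \<theta>
  proof (rule sph_arg_small_ok)
    have "cmod (P \<theta> y) \<le> r * 8 + r * 8"
      unfolding P_def using prb[OF x that(2)] prb[OF a that(2)] cos_sin_bound[OF that(3)] r
      by (intro order_trans[OF norm_triangle_ineq] add_mono) (auto simp: norm_mult simp del: norm_of_real intro!: mult_mono)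
    then have "cmod \<tau> * cmod (P \<theta> y) \<le> small_radius * (r * 8 + r * 8)"
      using that(1) small_radius by (intro mult_mono) auto
    then have "cmod (2 * \<tau> * P \<theta> y) \<le> 2 * small_radius * (r * 8 + r * 8)"
      by (simp add: norm_mult mult_ac)
    also have "\<dots> < 1 / 2" using r by (simp add: small_radius_def)
    finally have 1: "cmod (2 * \<tau> * P \<theta> y) < 1 / 2" .
    have "y \<bullet> y \<le> r * r"
      using that(2) r unfolding power2_norm_eq_inner[symmetric] power2_eq_square by (intro mult_mono) auto
    then have "cmod (\<tau>\<^sup>2 * pr y y) \<le> small_radius\<^sup>2 * (r * r)"
      using that(1) by (auto simp: norm_mult norm_power intro!: mult_mono power_mono)
    also have "\<dots> < 1 / 2" using r by (simp add: small_radius_def power2_eq_square field_simps)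
    finally show "cmod (2 * \<tau> * P \<theta> y) + cmod (\<tau>\<^sup>2 * pr y y) < 1" using 1 by linarith
  qed
  have d1: "(\<phi> \<tau> y has_field_derivative aw_dp \<kappa> \<tau> (P \<theta> y) (pr y y) * (pr a y * cos \<theta> - pr x y * sin \<theta>)) (at \<theta>)"
    if "\<tau> \<in> cball 0 small_radius" "y \<in> cball 0 r" "cmod \<theta> < 2" for \<tau> y \<theta>
  proof -
    have "((\<lambda>\<theta>. P \<theta> y) has_field_derivative (pr a y * cos \<theta> - pr x y * sin \<theta>)) (at \<theta>)"
      unfolding P_def by (auto intro!: derivative_eq_intros)
    from DERIV_chain2[OF aw_kernel_dp[OF ok] this] that show ?thesis unfolding \<phi>_def by simp
  qed
  have hol: "\<phi> \<tau> y holomorphic_on ball 0 2" if "\<tau> \<in> cball 0 small_radius" "y \<in> cball 0 r" for \<tau> y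
    unfolding holomorphic_on_open[OF open_ball]
    by (intro ballI exI, rule d1[OF that]) simp
  have d2: "(deriv ^^ 2) (\<phi> \<tau> y) 0 = aw_dp2 \<kappa> \<tau> (pr x y) (pr y y) * (pr a y)\<^sup>2 - aw_dp \<kappa> \<tau> (pr x y) (pr y y) * pr x y"
    if t: "\<tau> \<in> cball 0 small_radius" "y \<in> cball 0 r" for \<tau> y
  proof -
    have P0: "P 0 y = pr x y" by (simp add: P_def)
    have "((\<lambda>\<theta>. P \<theta> y) has_field_derivative pr a y) (at 0)"
      unfolding P_def by (auto intro!: derivative_eq_intros)
    from DERIV_chain2[OF aw_dp_dp[OF ok[OF t, of 0]] this]
    have "((\<lambda>\<theta>. aw_dp \<kappa> \<tau> (P \<theta> y) (pr y y)) has_field_derivative aw_dp2 \<kappa> \<tau> (pr x y) (pr y y) * pr a y) (at 0)"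
      unfolding P0 by simp
    moreover have "((\<lambda>\<theta>. pr a y * cos \<theta> - pr x y * sin \<theta>) has_field_derivative - pr x y) (at 0)"
      by (auto intro!: derivative_eq_intros)
    ultimately have "((\<lambda>\<theta>. aw_dp \<kappa> \<tau> (P \<theta> y) (pr y y) * (pr a y * cos \<theta> - pr x y * sin \<theta>)) has_field_derivative
       aw_dp2 \<kappa> \<tau> (pr x y) (pr y y) * pr a y * (pr a y * cos 0 - pr x y * sin 0) + (- pr x y) * aw_dp \<kappa> \<tau> (P 0 y) (pr y y)) (at 0)"
      by (rule DERIV_mult)
    then have "(deriv (\<phi> \<tau> y) has_field_derivative
       aw_dp2 \<kappa> \<tau> (pr x y) (pr y y) * pr a y * pr a y + (- pr x y) * aw_dp \<kappa> \<tau> (pr x y) (pr y y)) (at 0)"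
      unfolding P0 by (rule has_field_derivative_transform_within_open[where S = "ball 0 2", THEN DERIV_cong])
         (auto intro!: DERIV_imp_deriv[symmetric] d1 t)
    from DERIV_imp_deriv[OF this] show ?thesis by (simp add: numeral_2_eq_2 power2_eq_square mult_ac)
  qed
  obtain B where B: "B \<ge> 0" "\<And>\<tau> y \<theta>. \<tau> \<in> cball 0 small_radius \<Longrightarrow> y \<in> cball 0 r \<Longrightarrow> \<theta> \<in> cball 0 1 \<Longrightarrow> cmod (\<phi> \<tau> y \<theta>) \<le> B"
  proof -
    let ?K = "cball 0 small_radius \<times> (cball 0 r \<times> cball 0 1) :: (complex \<times> ((real^3) \<times> complex)) set"
    have K: "compact ?K" by (intro compact_Times compact_cball)
    have c: "continuous_on ?K (\<lambda>z. fst z)" "continuous_on ?K (\<lambda>z. P (snd (snd z)) (fst (snd z)))" "continuous_on ?K (\<lambda>z. pr (fst (snd z)) (fst (snd z)))"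
      unfolding P_def by (intro continuous_intros)+
    have "continuous_on ?K (\<lambda>z. aw_kernel \<kappa> (fst z) (P (snd (snd z)) (fst (snd z))) (pr (fst (snd z)) (fst (snd z))))"
      by (rule aw_continuous(1)[OF c]) (rule ok; auto)
    then obtain B where "B \<ge> 0" "\<And>z. z \<in> ?K \<Longrightarrow> cmod (aw_kernel \<kappa> (fst z) (P (snd (snd z)) (fst (snd z))) (pr (fst (snd z)) (fst (snd z)))) \<le> B"
      using compact_bound[OF K] by blast
    then show ?thesis by (intro that[of B]) (auto simp: \<phi>_def)
  qed
  have pt: "cmod (\<phi> \<tau> y \<theta> + \<phi> \<tau> y (- \<theta>) - 2 * \<phi> \<tau> y 0 - (deriv ^^ 2) (\<phi> \<tau> y) 0 * \<theta>\<^sup>2) \<le> 4 * B * cmod \<theta> ^ 3"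
    if "\<tau> \<in> cball 0 small_radius" "y \<in> cball 0 r" "cmod \<theta> \<le> 1 / 2" for \<tau> y \<theta>
    by (rule symmetric_taylor_bound[OF hol[OF that(1,2)] B(2)[OF that(1,2)] that(3)])
  define C where "C = 4 * B * (\<integral>y. norm (f y) \<partial>M)"
  have C: "C \<ge> 0" using B(1) by (auto simp: C_def intro!: mult_nonneg_nonneg integral_nonneg_AE)
  have "cmod (aw_field (cos \<theta> *\<^sub>R x + sin \<theta> *\<^sub>R a) \<tau> + aw_field (cos \<theta> *\<^sub>R x - sin \<theta> *\<^sub>R a) \<tau> - 2 * aw_field x \<tau>
      - of_real (\<theta>\<^sup>2) * (\<integral>y. (aw_dp2 \<kappa> \<tau> (pr x y) (pr y y) * (pr a y)\<^sup>2 - aw_dp \<kappa> \<tau> (pr x y) (pr y y) * pr x y) * f y \<partial>M))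
     \<le> C * \<theta> ^ 3" if t: "\<tau> \<in> cball 0 small_radius" and th: "0 < \<theta>" "\<theta> \<le> 1 / 2" for \<tau> \<theta>
  proof -
    have t': "\<tau> \<in> ball 0 (1 / r)" using t small_radius by auto
    define u v where "u = cos \<theta> *\<^sub>R x + sin \<theta> *\<^sub>R a" and "v = cos \<theta> *\<^sub>R x - sin \<theta> *\<^sub>R a"
    have nu: "norm u = 1" "norm v = 1"
    proof -
      have "x \<bullet> x = 1" "a \<bullet> a = 1" using x a by (simp_all add: norm_eq_1)
      then have "u \<bullet> u = 1" "v \<bullet> v = 1"
        using xa sin_cos_squared_add[of \<theta>]
        by (simp_all add: u_def v_def algebra_simps inner_commute[of a x] power2_eq_square)
      then show "norm u = 1" "norm v = 1" by (simp_all add: norm_eq_1)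
    qed
    have uv: "aw_kernel \<kappa> \<tau> (pr u y) (pr y y) = \<phi> \<tau> y (of_real \<theta>)" "aw_kernel \<kappa> \<tau> (pr v y) (pr y y) = \<phi> \<tau> y (- of_real \<theta>)"
       "aw_kernel \<kappa> \<tau> (pr x y) (pr y y) = \<phi> \<tau> y 0" for y
      by (simp_all add: \<phi>_def P_def u_def v_def inner_add_left inner_diff_left cos_of_real sin_of_real mult.commute)
    define D where "D y = aw_dp2 \<kappa> \<tau> (pr x y) (pr y y) * (pr a y)\<^sup>2 - aw_dp \<kappa> \<tau> (pr x y) (pr y y) * pr x y" for y
    have Dd: "D y = (deriv ^^ 2) (\<phi> \<tau> y) 0" if "y \<in> space M" for y using d2[OF t] that by (simp add: D_def)
    have Dm: "D \<in> borel_measurable M"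
      unfolding D_def[abs_def]
      by (intro borel_measurable_diff borel_measurable_times kernel_measurable[OF x t'] measurable_M continuous_intros)
    have Db: "cmod (D y) \<le> 2 * B" if "y \<in> space M" for y
    proof -
      have "norm ((deriv ^^ 2) (\<phi> \<tau> y) 0) \<le> fact 2 * B / 1 ^ 2"
      proof (rule Cauchy_inequality)
        have "\<phi> \<tau> y holomorphic_on ball 0 2"
          using that by (intro hol[OF t]) auto
        then show "\<phi> \<tau> y holomorphic_on ball 0 1" "continuous_on (cball 0 1) (\<phi> \<tau> y)"
          by (auto intro!: holomorphic_on_imp_continuous_on intro: holomorphic_on_subset)
      qed (use B(2)[OF t] that in auto)
      then show ?thesis using Dd[OF that] by (simp add: numeral_2_eq_2)
    qed
    have Di: "integrable M (\<lambda>y. D y * f y)" by (rule integrable_bounded_mult[OF f Dm Db])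
    have i1: "integrable M (\<lambda>y. \<phi> \<tau> y (of_real \<theta>) * f y)" "integrable M (\<lambda>y. \<phi> \<tau> y (- of_real \<theta>) * f y)" "integrable M (\<lambda>y. \<phi> \<tau> y 0 * f y)"
      using aw_field_deriv(3)[OF nu(1) t'] aw_field_deriv(3)[OF nu(2) t'] aw_field_deriv(3)[OF x t'] unfolding uv .
    have expand: "(\<phi> \<tau> y (of_real \<theta>) + \<phi> \<tau> y (- of_real \<theta>) - 2 * \<phi> \<tau> y 0 - D y * (of_real \<theta>)\<^sup>2) * f y =
        \<phi> \<tau> y (of_real \<theta>) * f y + \<phi> \<tau> y (- of_real \<theta>) * f y - 2 * (\<phi> \<tau> y 0 * f y) - (of_real \<theta>)\<^sup>2 * (D y * f y)" for y
      by (simp add: algebra_simps)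
    have "aw_field u \<tau> + aw_field v \<tau> - 2 * aw_field x \<tau> - of_real (\<theta>\<^sup>2) * (\<integral>y. D y * f y \<partial>M) =
      (\<integral>y. (\<phi> \<tau> y (of_real \<theta>) + \<phi> \<tau> y (- of_real \<theta>) - 2 * \<phi> \<tau> y 0 - D y * (of_real \<theta>)\<^sup>2) * f y \<partial>M)"
    proof -
      have lin: "(\<integral>y. g1 y + g2 y - 2 * g3 y - c * g4 y \<partial>M) =
          (\<integral>y. g1 y \<partial>M) + (\<integral>y. g2 y \<partial>M) - 2 * (\<integral>y. g3 y \<partial>M) - c * (\<integral>y. g4 y \<partial>M)"
        if "integrable M g1" "integrable M g2" "integrable M g3" "integrable M g4" for g1 g2 g3 g4 and c :: complex
        using that by simp
      show ?thesis unfolding aw_field_def uv expand lin[OF i1 Di] by simp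
    qed
    also have "cmod \<dots> \<le> (\<integral>y. 4 * B * \<theta> ^ 3 * norm (f y) \<partial>M)"
    proof (rule Bochner_Integration.integral_norm_bound_integral)
      show "integrable M (\<lambda>y. (\<phi> \<tau> y (of_real \<theta>) + \<phi> \<tau> y (- of_real \<theta>) - 2 * \<phi> \<tau> y 0 - D y * (of_real \<theta>)\<^sup>2) * f y)"
        unfolding expand by (intro Bochner_Integration.integrable_diff Bochner_Integration.integrable_add integrable_mult_right i1 Di)
      show "norm ((\<phi> \<tau> y (of_real \<theta>) + \<phi> \<tau> y (- of_real \<theta>) - 2 * \<phi> \<tau> y 0 - D y * (of_real \<theta>)\<^sup>2) * f y) \<le> 4 * B * \<theta> ^ 3 * norm (f y)"
        if "y \<in> space M" for y
        unfolding norm_mult Dd[OF that]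
        using pt[OF t, of y "of_real \<theta>"] that th by (intro mult_right_mono) auto
    qed (use f in simp)
    also have "\<dots> = C * \<theta> ^ 3" by (simp add: C_def)
    finally show ?thesis unfolding u_def v_def D_def .
  qed
  with C show ?thesis by (intro exI[of _ C]) auto
qed

end

context source_in_ball
begin

lemma aw_field_holomorphic: "norm x = 1 \<Longrightarrow> aw_field x holomorphic_on ball 0 (1 / r)"
  unfolding holomorphic_on_open[OF open_ball]
  by (intro ballI exI, rule aw_field_deriv(1))

lemma aw_field_expansion:
  assumes "norm x = 1"
  shows "aw_field x has_fps_expansion fps_expansion (aw_field x) 0"
  using aw_field_holomorphic[OF assms] r
  by (intro analytic_at_imp_has_fps_expansion_0) (auto simp: analytic_at intro!: exI[of _ "ball 0 (1 / r)"])

lemma deriv_aw_field: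
  assumes "norm x = 1" "\<tau> \<in> ball 0 (1 / r)"
  shows "deriv (aw_field x) \<tau> = aw_field1 x \<tau>" "deriv (deriv (aw_field x)) \<tau> = aw_field2 x \<tau>"
proof -
  have 1: "deriv (aw_field x) t = aw_field1 x t" if "t \<in> ball 0 (1 / r)" for t
    by (rule DERIV_imp_deriv[OF aw_field_deriv(1)[OF assms(1) that]])
  then show "deriv (aw_field x) \<tau> = aw_field1 x \<tau>" using assms(2) .
  have "(deriv (aw_field x) has_field_derivative aw_field2 x \<tau>) (at \<tau>)"
    by (rule has_field_derivative_transform_within_open[OF aw_field_deriv(2)[OF assms] open_ball assms(2)])
       (simp add: 1)
  then show "deriv (deriv (aw_field x)) \<tau> = aw_field2 x \<tau>" by (rule DERIV_imp_deriv)
qed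

definition aw_radial :: "real^3 \<Rightarrow> complex \<Rightarrow> complex" where
  "aw_radial x \<tau> = \<tau>\<^sup>2 * deriv (deriv (aw_field x)) \<tau> + (2 * \<tau> - 2 * \<i> * of_real \<kappa>) * deriv (aw_field x) \<tau>"

text \<open>For an orthonormal frame \<open>x, a, b\<close> the second derivatives along the great circles towards \<open>a\<close> and
  \<open>b\<close> add up to the Laplace--Beltrami operator, since \<open>(a \<bullet> y)\<^sup>2 + (b \<bullet> y)\<^sup>2 = s - p\<^sup>2\<close>.\<close>

lemma aw_radial_angular:
  assumes x: "norm x = 1" and t: "\<tau> \<in> cball 0 small_radius"
    and frame: "\<And>y. (x \<bullet> y)\<^sup>2 + (a \<bullet> y)\<^sup>2 + (b \<bullet> y)\<^sup>2 = y \<bullet> y"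
  shows "(\<integral>y. (aw_dp2 \<kappa> \<tau> (pr x y) (pr y y) * (pr a y)\<^sup>2 - aw_dp \<kappa> \<tau> (pr x y) (pr y y) * pr x y) * f y \<partial>M)
     + (\<integral>y. (aw_dp2 \<kappa> \<tau> (pr x y) (pr y y) * (pr b y)\<^sup>2 - aw_dp \<kappa> \<tau> (pr x y) (pr y y) * pr x y) * f y \<partial>M)
     = - aw_radial x \<tau>"
proof -
  have t': "\<tau> \<in> ball 0 (1 / r)" using t small_radius by auto
  have c: "continuous_on (cball 0 r) (\<lambda>y. \<tau>)" "continuous_on (cball 0 r) (\<lambda>y. pr x y)" "continuous_on (cball 0 r) (\<lambda>y. pr y y)"
    by (intro continuous_intros)+
  have ok: "sph_arg \<tau> (pr x y) (pr y y) \<notin> \<real>\<^sub>\<le>\<^sub>0" if "y \<in> cball 0 r" for y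
    by (rule arg_ok[OF x _ _ that, of _ "cmod \<tau>"]) (use t' in auto)
  note cont = aw_continuous[OF c ok, of \<kappa>]
  have int: "integrable M (\<lambda>y. (aw_dp2 \<kappa> \<tau> (pr x y) (pr y y) * (pr e y)\<^sup>2 - aw_dp \<kappa> \<tau> (pr x y) (pr y y) * pr x y) * f y)" for e
  proof -
    have ce: "continuous_on (cball 0 r) (\<lambda>y. aw_dp2 \<kappa> \<tau> (pr x y) (pr y y) * (pr e y)\<^sup>2 - aw_dp \<kappa> \<tau> (pr x y) (pr y y) * pr x y)"
      by (intro continuous_intros cont)
    obtain B where "\<And>y. y \<in> cball 0 r \<Longrightarrow> cmod (aw_dp2 \<kappa> \<tau> (pr x y) (pr y y) * (pr e y)\<^sup>2 - aw_dp \<kappa> \<tau> (pr x y) (pr y y) * pr x y) \<le> B"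
      using compact_bound[OF compact_cball ce] by auto
    then show ?thesis by (intro integrable_bounded_mult[OF f measurable_M[OF ce], of B]) auto
  qed
  have pt: "(aw_dp2 \<kappa> \<tau> (pr x y) (pr y y) * (pr a y)\<^sup>2 - aw_dp \<kappa> \<tau> (pr x y) (pr y y) * pr x y) * f y
      + (aw_dp2 \<kappa> \<tau> (pr x y) (pr y y) * (pr b y)\<^sup>2 - aw_dp \<kappa> \<tau> (pr x y) (pr y y) * pr x y) * f y =
      - (\<tau>\<^sup>2 * (aw_dtau2 \<kappa> \<tau> (pr x y) (pr y y) * f y) + (2 * \<tau> - 2 * \<i> * of_real \<kappa>) * (aw_dtau \<kappa> \<tau> (pr x y) (pr y y) * f y))"
    if "y \<in> space M" for y
  proof -
    have ab: "(pr a y)\<^sup>2 + (pr b y)\<^sup>2 = pr y y - (pr x y)\<^sup>2"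
      unfolding frame[of y, symmetric] by simp
    define D1 D2 T1 T2 where "D1 = aw_dp \<kappa> \<tau> (pr x y) (pr y y)" and "D2 = aw_dp2 \<kappa> \<tau> (pr x y) (pr y y)"
      and "T1 = aw_dtau \<kappa> \<tau> (pr x y) (pr y y)" and "T2 = aw_dtau2 \<kappa> \<tau> (pr x y) (pr y y)"
    have pde: "\<tau>\<^sup>2 * T2 + (2 * \<tau> - 2 * \<i> * of_real \<kappa>) * T1 + (pr y y - (pr x y)\<^sup>2) * D2 - 2 * pr x y * D1 = 0"
      using aw_pde[OF ok[of y], of \<kappa>] that by (simp add: D1_def D2_def T1_def T2_def)
    have "D2 * (pr a y)\<^sup>2 - D1 * pr x y + (D2 * (pr b y)\<^sup>2 - D1 * pr x y) = D2 * ((pr a y)\<^sup>2 + (pr b y)\<^sup>2) - 2 * pr x y * D1"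
      by (simp add: algebra_simps)
    also have "\<dots> = - (\<tau>\<^sup>2 * T2 + (2 * \<tau> - 2 * \<i> * of_real \<kappa>) * T1)"
      using pde unfolding ab by (simp add: algebra_simps add_eq_0_iff)
    finally have "(D2 * (pr a y)\<^sup>2 - D1 * pr x y + (D2 * (pr b y)\<^sup>2 - D1 * pr x y)) * f y = - (\<tau>\<^sup>2 * T2 + (2 * \<tau> - 2 * \<i> * of_real \<kappa>) * T1) * f y"
      by (rule arg_cong)
    then show ?thesis unfolding D1_def[symmetric] D2_def[symmetric] T1_def[symmetric] T2_def[symmetric]
      by (simp add: algebra_simps)
  qed
  have "(\<integral>y. (aw_dp2 \<kappa> \<tau> (pr x y) (pr y y) * (pr a y)\<^sup>2 - aw_dp \<kappa> \<tau> (pr x y) (pr y y) * pr x y) * f y \<partial>M)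
     + (\<integral>y. (aw_dp2 \<kappa> \<tau> (pr x y) (pr y y) * (pr b y)\<^sup>2 - aw_dp \<kappa> \<tau> (pr x y) (pr y y) * pr x y) * f y \<partial>M)
    = (\<integral>y. - (\<tau>\<^sup>2 * (aw_dtau2 \<kappa> \<tau> (pr x y) (pr y y) * f y) + (2 * \<tau> - 2 * \<i> * of_real \<kappa>) * (aw_dtau \<kappa> \<tau> (pr x y) (pr y y) * f y)) \<partial>M)"
    unfolding Bochner_Integration.integral_add[OF int int, symmetric]
    by (rule Bochner_Integration.integral_cong[OF refl pt])
  also have "\<dots> = - aw_radial x \<tau>"
  proof -
    have lin: "(\<integral>y. - (c * g y + d * h y) \<partial>M) = - (c * (\<integral>y. g y \<partial>M) + d * (\<integral>y. h y \<partial>M))"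
      if "integrable M g" "integrable M h" for g h and c d :: complex using that by simp
    show ?thesis
      unfolding aw_radial_def deriv_aw_field[OF x t'] aw_field1_def aw_field2_def
      by (rule lin[OF aw_field_deriv(5)[OF x t'] aw_field_deriv(4)[OF x t']])
  qed
  finally show ?thesis .
qed

lemma aw_radial_expansion:
  assumes "norm x = 1"
  defines "E \<equiv> fps_expansion (aw_field x) 0"
  shows "aw_radial x has_fps_expansion
     fps_X ^ 2 * fps_deriv (fps_deriv E) + (fps_const 2 * fps_X - fps_const (2 * \<i> * of_real \<kappa>)) * fps_deriv E"
  unfolding aw_radial_def[abs_def] E_def
  by (intro fps_expansion_intros aw_field_expansion[OF assms(1)])

text \<open>Comparing coefficients of \<open>\<tau>\<^sup>m\<close> in the Helmholtz equation gives
  \<open>2 \<i> \<kappa> (m + 1) F\<^sub>m\<^sub>+\<^sub>1 = m (m + 1) F\<^sub>m + \<Delta> F\<^sub>m\<close>, where \<open>\<Delta>\<close> is the Laplace--Beltrami operator. If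
  \<open>F\<^sub>m\<close> vanishes on the whole sphere, so does \<open>\<Delta> F\<^sub>m\<close> and hence \<open>F\<^sub>m\<^sub>+\<^sub>1\<close>. The operator \<open>\<Delta>\<close> is
  represented by second differences: all of them have vanishing \<open>m\<close>-th coefficient, and they converge
  uniformly for small \<open>\<tau>\<close>.\<close>

lemma aw_coefficients_vanish:
  assumes far: "\<And>x. norm x = 1 \<Longrightarrow> (\<integral>y. exp (- \<i> * of_real \<kappa> * pr x y) * f y \<partial>M) = 0"
  shows "norm x = 1 \<Longrightarrow> fps_nth (fps_expansion (aw_field x) 0) n = 0"
proof (induction n arbitrary: x rule: less_induct)
  case (less n)
  define E where "E x = fps_expansion (aw_field x) 0" for x
  have IH: "fps_nth (E u) k = 0" if "k < n" "norm u = 1" for k u using less.IH[OF that] by (simp add: E_def)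
  have expn: "aw_field u has_fps_expansion E u" if "norm u = 1" for u
    using aw_field_expansion[OF that] by (simp add: E_def)
  show ?case
  proof (cases n)
    case 0
    have "aw_kernel \<kappa> 0 p s = exp (- \<i> * of_real \<kappa> * p)" for p s
      by (simp add: aw_kernel_def sph_phase_def sph_root_def sph_arg_def)
    then have "aw_field x 0 = 0" using far[OF less.prems] by (simp add: aw_field_def)
    then show ?thesis by (simp add: 0 fps_expansion_def)
  next
    case (Suc m)
    obtain a b where ab: "norm a = 1" "norm b = 1" "x \<bullet> a = 0" "x \<bullet> b = 0"
        "\<And>y. (x \<bullet> y)\<^sup>2 + (a \<bullet> y)\<^sup>2 + (b \<bullet> y)\<^sup>2 = y \<bullet> y"
      using orthonormal_frame[OF less.prems] by metis
    define I where "I e \<tau> = (\<integral>y. (aw_dp2 \<kappa> \<tau> (pr x y) (pr y y) * (pr e y)\<^sup>2 - aw_dp \<kappa> \<tau> (pr x y) (pr y y) * pr x y) * f y \<partial>M)" for e \<tau>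
    define up dn where "up e \<theta> = cos \<theta> *\<^sub>R x + sin \<theta> *\<^sub>R e" and "dn e \<theta> = cos \<theta> *\<^sub>R x - sin \<theta> *\<^sub>R e" for e \<theta>
    define S where "S e \<theta> \<tau> = aw_field (up e \<theta>) \<tau> + aw_field (dn e \<theta>) \<tau> - 2 * aw_field x \<tau>" for e \<theta> \<tau>
    obtain Ca where Ca: "Ca \<ge> 0" "\<And>\<tau> \<theta>. \<tau> \<in> cball 0 small_radius \<Longrightarrow> 0 < \<theta> \<Longrightarrow> \<theta> \<le> 1 / 2 \<Longrightarrow>
        cmod (S a \<theta> \<tau> - of_real (\<theta>\<^sup>2) * I a \<tau>) \<le> Ca * \<theta> ^ 3"
      using second_difference[OF less.prems ab(1,3)] unfolding S_def I_def up_def dn_def by blast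
    obtain Cb where Cb: "Cb \<ge> 0" "\<And>\<tau> \<theta>. \<tau> \<in> cball 0 small_radius \<Longrightarrow> 0 < \<theta> \<Longrightarrow> \<theta> \<le> 1 / 2 \<Longrightarrow>
        cmod (S b \<theta> \<tau> - of_real (\<theta>\<^sup>2) * I b \<tau>) \<le> Cb * \<theta> ^ 3"
      using second_difference[OF less.prems ab(2,4)] unfolding S_def I_def up_def dn_def by blast
    have unit: "norm (up e \<theta>) = 1" "norm (dn e \<theta>) = 1" if "norm e = 1" "x \<bullet> e = 0" for e \<theta>
    proof -
      have "x \<bullet> x = 1" "e \<bullet> e = 1" using less.prems that by (simp_all add: norm_eq_1)
      then have "up e \<theta> \<bullet> up e \<theta> = 1" "dn e \<theta> \<bullet> dn e \<theta> = 1"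
        using that(2) sin_cos_squared_add[of \<theta>]
        by (simp_all add: up_def dn_def algebra_simps inner_commute[of e x] power2_eq_square)
      then show "norm (up e \<theta>) = 1" "norm (dn e \<theta>) = 1" by (simp_all add: norm_eq_1)
    qed
    define X where "X = fps_X ^ 2 * fps_deriv (fps_deriv (E x)) + (fps_const 2 * fps_X - fps_const (2 * \<i> * of_real \<kappa>)) * fps_deriv (E x)"
    have X: "aw_radial x has_fps_expansion X"
      using aw_radial_expansion[OF less.prems] by (simp add: X_def E_def)
    define K where "K = fact m * (Ca + Cb) / small_radius ^ m"
    have main: "cmod (fact m * fps_nth X m) \<le> K * \<theta>" if th: "0 < \<theta>" "\<theta> \<le> 1 / 2" for \<theta>
    proof -
      \<comment> \<open>Sum of the second differences minus \<open>\<theta>\<^sup>2\<close> times the angular part: of order \<open>\<theta>\<^sup>3\<close>, while its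
        \<open>m\<close>-th coefficient is exactly \<open>\<theta>\<^sup>2\<close> times that of \<open>aw_radial\<close>.\<close>
      define G where "G \<tau> = S a \<theta> \<tau> + S b \<theta> \<tau> + of_real (\<theta>\<^sup>2) * aw_radial x \<tau>" for \<tau>
      have Ge: "G has_fps_expansion (E (up a \<theta>) + E (dn a \<theta>) - fps_const 2 * E x) + (E (up b \<theta>) + E (dn b \<theta>) - fps_const 2 * E x)
          + fps_const (of_real (\<theta>\<^sup>2)) * X"
        unfolding G_def[abs_def] S_def by (intro fps_expansion_intros expn unit ab less.prems X)
      have "(deriv ^^ m) G 0 / fact m = of_real (\<theta>\<^sup>2) * fps_nth X m"
        unfolding fps_nth_fps_expansion[OF Ge, symmetric]
        using IH[of m] Suc unit[OF ab(1,3)] unit[OF ab(2,4)] less.prems by simp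
      then have dG: "(deriv ^^ m) G 0 = of_real (\<theta>\<^sup>2) * (fact m * fps_nth X m)"
        by (simp add: field_simps)
      have Gb: "cmod (G \<tau>) \<le> (Ca + Cb) * \<theta> ^ 3" if t: "\<tau> \<in> cball 0 small_radius" for \<tau>
      proof -
        have "G \<tau> = (S a \<theta> \<tau> - of_real (\<theta>\<^sup>2) * I a \<tau>) + (S b \<theta> \<tau> - of_real (\<theta>\<^sup>2) * I b \<tau>)"
        proof -
          have ar: "aw_radial x \<tau> = - (I a \<tau> + I b \<tau>)"
            using aw_radial_angular[OF less.prems t ab(5)] unfolding I_def by simp
          show ?thesis unfolding G_def ar by (simp add: algebra_simps)
        qed
        then have "cmod (G \<tau>) \<le> Ca * \<theta> ^ 3 + Cb * \<theta> ^ 3"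
          using norm_triangle_le[OF add_mono[OF Ca(2)[OF t th] Cb(2)[OF t th]]] by simp
        then show ?thesis by (simp add: algebra_simps)
      qed
      have Gh: "G holomorphic_on ball 0 (1 / r)"
      proof -
        have "deriv (aw_field x) holomorphic_on ball 0 (1 / r)" "deriv (deriv (aw_field x)) holomorphic_on ball 0 (1 / r)"
          by (intro holomorphic_deriv aw_field_holomorphic less.prems open_ball)+
        then show ?thesis unfolding G_def[abs_def] S_def aw_radial_def
          by (intro holomorphic_intros aw_field_holomorphic unit ab less.prems open_ball)
      qed
      have "norm ((deriv ^^ m) G 0) \<le> fact m * ((Ca + Cb) * \<theta> ^ 3) / small_radius ^ m"
      proof (rule Cauchy_inequality)
        have sub: "cball 0 small_radius \<subseteq> ball (0::complex) (1 / r)" using small_radius by auto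
        show "G holomorphic_on ball 0 small_radius"
          using holomorphic_on_subset[OF Gh] sub by (meson ball_subset_cball order_trans)
        show "continuous_on (cball 0 small_radius) G"
          by (rule continuous_on_subset[OF holomorphic_on_imp_continuous_on[OF Gh] sub])
        show "norm (G w) \<le> (Ca + Cb) * \<theta> ^ 3" if "norm (0 - w) = small_radius" for w
          using Gb[of w] that by simp
      qed (rule small_radius)
      then have "\<theta>\<^sup>2 * cmod (fact m * fps_nth X m) \<le> \<theta>\<^sup>2 * (K * \<theta>)"
        using th unfolding dG by (simp add: norm_mult K_def power2_eq_square power3_eq_cube mult_ac)
      then show ?thesis using th by simp
    qed
    have "cmod (fact m * fps_nth X m) \<le> 0"
    proof (rule tendsto_lowerbound)
      show "((\<lambda>\<theta>. K * \<theta>) \<longlongrightarrow> 0) (at_right 0)" by (auto intro!: tendsto_eq_intros)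
      show "\<forall>\<^sub>F \<theta> in at_right 0. cmod (fact m * fps_nth X m) \<le> K * \<theta>"
        using main by (intro eventually_at_rightI[of 0 "1 / 2"]) auto
    qed simp
    then have "fps_nth X m = 0" by simp
    moreover have "fps_nth X m = - (2 * \<i> * of_real \<kappa>) * of_nat (Suc m) * fps_nth (E x) (Suc m)"
    proof -
      have Em: "fps_nth (E x) m = 0" using IH[of m x] Suc less.prems by simp
      have 1: "fps_nth (fps_X ^ 2 * fps_deriv (fps_deriv (E x))) m = 0"
      proof (cases "m < 2")
        case True then show ?thesis by (simp add: fps_X_power_mult_nth)
      next
        case False
        then have "Suc (Suc (m - 2)) = m" by simp
        then show ?thesis using Em False by (simp add: fps_X_power_mult_nth)
      qed
      have 2: "fps_nth (fps_X * fps_deriv (E x)) m = 0"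
        using Em by (cases m) simp_all
      have "X = fps_X ^ 2 * fps_deriv (fps_deriv (E x)) + fps_const 2 * (fps_X * fps_deriv (E x))
          - fps_const (2 * \<i> * of_real \<kappa>) * fps_deriv (E x)"
        by (simp add: X_def algebra_simps)
      then show ?thesis using 1 2 by simp
    qed
    ultimately show ?thesis using \<kappa> Suc by (simp add: E_def del: of_nat_Suc)
  qed
qed

theorem aw_field_zero:
  assumes far: "\<And>x. norm x = 1 \<Longrightarrow> (\<integral>y. exp (- \<i> * of_real \<kappa> * pr x y) * f y \<partial>M) = 0"
    and x: "norm x = 1" and t: "\<tau> \<in> ball 0 (1 / r)"
  shows "aw_field x \<tau> = 0"
proof (rule holomorphic_fun_eq_0_on_ball[OF aw_field_holomorphic[OF x] t])
  fix n
  have "fps_nth (fps_expansion (aw_field x) 0) n = 0" by (rule aw_coefficients_vanish[OF far x])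
  then show "(deriv ^^ n) (aw_field x) 0 = 0" by (simp add: fps_expansion_def)
qed

lemma aw_kernel_green:
  assumes x: "norm x > r" and y: "y \<in> cball 0 r"
  shows "exp (\<i> * of_real (\<kappa> * norm (x - y))) / of_real (norm (x - y)) =
     exp (\<i> * of_real (\<kappa> * norm x)) / of_real (norm x) * aw_kernel \<kappa> (of_real (1 / norm x)) (pr (x /\<^sub>R norm x) y) (pr y y)"
proof -
  define t where "t = norm x"
  define q where "q = norm (x - y) / t"
  have t: "t > 0" "t > r" using x r unfolding t_def by linarith+
  have "norm y < t" using y t by simp
  then have nz: "norm (x - y) > 0" unfolding t_def by auto
  have q: "q > 0" using nz t by (simp add: q_def)
  define c where "c = (x /\<^sub>R t) \<bullet> y"
  have xy: "x \<bullet> y = t * c" using t by (simp add: c_def)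
  have q2: "q\<^sup>2 = 1 - 2 * (1 / t) * c + (1 / t)\<^sup>2 * (y \<bullet> y)"
  proof -
    have "(norm (x - y))\<^sup>2 = t\<^sup>2 - 2 * t * c + y \<bullet> y"
      unfolding power2_norm_eq_inner t_def xy[symmetric, unfolded t_def]
      using xy by (simp add: inner_diff_left inner_diff_right inner_commute[of y x] t_def power2_norm_eq_inner)
    then show ?thesis using t by (simp add: q_def power_divide field_simps power2_eq_square)
  qed
  have "sph_arg (of_real (1 / t)) (of_real c) (pr y y) = of_real (q\<^sup>2)"
    unfolding q2 sph_arg_def by simp
  then have root: "sph_root (of_real (1 / t)) (of_real c) (pr y y) = of_real q"
    unfolding sph_root_def using q by (simp add: csqrt_of_real_nonneg real_sqrt_unique flip: of_real_power)
  have phase: "sph_phase (of_real (1 / t)) (of_real c) (pr y y) = of_real (t * (q - 1))"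
  proof -
    have "1 / t * (y \<bullet> y) - 2 * c = t * (q - 1) * (q + 1)"
    proof -
      have "t * (q - 1) * (q + 1) = t * (q\<^sup>2 - 1)" by (simp add: power2_eq_square algebra_simps)
      also have "\<dots> = 1 / t * (y \<bullet> y) - 2 * c" unfolding q2 using t by (simp add: field_simps power2_eq_square)
      finally show ?thesis ..
    qed
    then have "(1 / t * (y \<bullet> y) - 2 * c) / (q + 1) = t * (q - 1)" using q by simp
    then show ?thesis unfolding sph_phase_def root
      by (metis (no_types, lifting) of_real_1 of_real_add of_real_diff of_real_divide of_real_mult of_real_numeral)
  qed
  have n: "norm (x - y) = t * q" using t by (simp add: q_def)
  have "exp (\<i> * of_real (\<kappa> * norm x)) / of_real (norm x) * aw_kernel \<kappa> (of_real (1 / t)) (of_real c) (pr y y)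
     = exp (\<i> * of_real (\<kappa> * t) + \<i> * of_real \<kappa> * of_real (t * (q - 1))) / of_real (t * q)"
    unfolding aw_kernel_def root phase t_def[symmetric] exp_add by simp
  also have "\<i> * of_real (\<kappa> * t) + \<i> * of_real \<kappa> * of_real (t * (q - 1)) = \<i> * of_real (\<kappa> * (t * q))"
    by (simp add: algebra_simps)
  finally show ?thesis unfolding n c_def t_def by simp
qed

text \<open>A density in the ball whose Fourier transform vanishes on the sphere of radius \<open>\<kappa>\<close> has no potential
  outside. The point \<open>x\<close> has the parameter \<open>\<tau> = 1 / |x|\<close>, which lies in the disc of radius \<open>1 / r\<close> where
  the field is holomorphic and hence determined by its Taylor coefficients at \<open>0\<close>.\<close>

theorem green_potential_zero:
  assumes far: "\<And>x. norm x = 1 \<Longrightarrow> (\<integral>y. exp (- \<i> * of_real \<kappa> * pr x y) * f y \<partial>M) = 0"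
    and x: "norm x > r"
  shows "(\<integral>y. green_fun \<kappa> x y * f y \<partial>M) = 0"
proof -
  define u where "u = x /\<^sub>R norm x"
  have nx: "norm x > 0" using x r by linarith
  have u: "norm u = 1" using nx by (simp add: u_def)
  have t: "of_real (1 / norm x) \<in> ball (0 :: complex) (1 / r)"
  proof -
    have "1 / norm x < 1 / r" using x r nx by (intro divide_strict_left_mono) auto
    then show ?thesis by (simp add: norm_divide)
  qed
  define C where "C = exp (\<i> * of_real (\<kappa> * norm x)) / of_real (norm x) / of_real (4 * pi)"
  have "green_fun \<kappa> x y * f y = C * (aw_kernel \<kappa> (of_real (1 / norm x)) (pr u y) (pr y y) * f y)" if "y \<in> space M" for y
  proof -
    have "green_fun \<kappa> x y = exp (\<i> * of_real (\<kappa> * norm (x - y))) / of_real (norm (x - y)) / of_real (4 * pi)"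
      by (simp add: green_fun_def)
    also have "\<dots> = C * aw_kernel \<kappa> (of_real (1 / norm x)) (pr u y) (pr y y)"
      using that by (subst aw_kernel_green[OF x]) (simp_all add: C_def u_def)
    finally show ?thesis by simp
  qed
  then have "(\<integral>y. green_fun \<kappa> x y * f y \<partial>M) = (\<integral>y. C * (aw_kernel \<kappa> (of_real (1 / norm x)) (pr u y) (pr y y) * f y) \<partial>M)"
    by (intro Bochner_Integration.integral_cong refl)
  also have "\<dots> = C * aw_field u (of_real (1 / norm x))" by (simp add: aw_field_def)
  also have "\<dots> = 0" using aw_field_zero[OF far u t] by simp
  finally show ?thesis .
qed

end

section \<open>Derivatives of the Green function\<close>

text \<open>With \<open>\<phi>\<close> the radial profile of the Green function these are \<open>\<phi>' / \<rho>\<close> and \<open>(\<phi>' / \<rho>)' / \<rho>\<close>: each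
  differentiation of a radial function produces the factor \<open>(x - y) / \<rho>\<close>.\<close>

definition green_d1 :: "real \<Rightarrow> complex \<Rightarrow> complex" where
  "green_d1 \<kappa> \<rho> = exp (\<i> * of_real \<kappa> * \<rho>) * (\<i> * of_real \<kappa> * \<rho> - 1) / (of_real (4 * pi) * \<rho> ^ 3)"

definition green_d2 :: "real \<Rightarrow> complex \<Rightarrow> complex" where
  "green_d2 \<kappa> \<rho> = exp (\<i> * of_real \<kappa> * \<rho>) * (3 - 3 * \<i> * of_real \<kappa> * \<rho> - (of_real \<kappa>)\<^sup>2 * \<rho>\<^sup>2) / (of_real (4 * pi) * \<rho> ^ 5)"

definition green_grad :: "real \<Rightarrow> 3 \<Rightarrow> real^3 \<Rightarrow> real^3 \<Rightarrow> complex" where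
  "green_grad \<kappa> s x y = green_d1 \<kappa> (of_real (norm (x - y))) * of_real (x $ s - y $ s)"

definition green_hess :: "real \<Rightarrow> 3 \<Rightarrow> 3 \<Rightarrow> real^3 \<Rightarrow> real^3 \<Rightarrow> complex" where
  "green_hess \<kappa> l s x y = green_d2 \<kappa> (of_real (norm (x - y))) * of_real ((x $ l - y $ l) * (x $ s - y $ s))
     + (if l = s then green_d1 \<kappa> (of_real (norm (x - y))) else 0)"

lemma norm_along_deriv:
  fixes z :: "real^3"
  assumes "z \<noteq> 0"
  shows "((\<lambda>t. norm (z + t *\<^sub>R axis l 1)) has_real_derivative z $ l / norm z) (at 0)"
proof -
  have nrm: "norm (z + t *\<^sub>R axis l 1) = sqrt (z \<bullet> z + 2 * t * z $ l + t\<^sup>2)" for t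
    by (simp add: norm_eq_sqrt_inner inner_add_left inner_add_right inner_axis inner_axis' inner_axis_axis power2_eq_square algebra_simps)
  moreover have "((\<lambda>t. sqrt (z \<bullet> z + 2 * t * z $ l + t\<^sup>2)) has_real_derivative z $ l / norm z) (at 0)"
  proof -
    have "((\<lambda>t. z \<bullet> z + 2 * t * z $ l + t\<^sup>2) has_real_derivative 2 * z $ l) (at 0)"
      by (auto intro!: derivative_eq_intros)
    moreover have "(sqrt has_real_derivative inverse (sqrt (z \<bullet> z)) / 2) (at (z \<bullet> z + 2 * 0 * z $ l + 0\<^sup>2))"
      using assms DERIV_real_sqrt[of "z \<bullet> z"] by simp
    ultimately have "((\<lambda>t. sqrt (z \<bullet> z + 2 * t * z $ l + t\<^sup>2)) has_real_derivative inverse (sqrt (z \<bullet> z)) / 2 * (2 * z $ l)) (at 0)"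
      by (rule DERIV_chain2[rotated])
    moreover have "inverse n / 2 * (2 * w) = w / n" for n w :: real by (cases "n = 0") (simp_all add: field_simps)
    ultimately show ?thesis unfolding norm_eq_sqrt_inner[of z, symmetric] by (simp only:)
  qed
  ultimately show ?thesis unfolding nrm by (simp only:)
qed

lemma radial_along_deriv:
  fixes x y :: "real^3" and F :: "complex \<Rightarrow> complex"
  assumes "x \<noteq> y" and "(F has_field_derivative D) (at (of_real (norm (x - y))))"
  shows "((\<lambda>t. F (of_real (norm (x + t *\<^sub>R axis l 1 - y)))) has_vector_derivative
      D * of_real ((x $ l - y $ l) / norm (x - y))) (at 0)"
proof -
  have "((\<lambda>t. norm (x - y + t *\<^sub>R axis l 1)) has_real_derivative (x - y) $ l / norm (x - y)) (at 0)"
    using assms(1) by (intro norm_along_deriv) simp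
  then have "((\<lambda>t. complex_of_real (norm (x - y + t *\<^sub>R axis l 1))) has_vector_derivative
     of_real ((x - y) $ l / norm (x - y))) (at 0)"
    by (intro has_vector_derivative_of_real) (simp add: has_real_derivative_iff_has_vector_derivative)
  from field_vector_diff_chain_at[OF this, of F D] assms(2)
  have "(F \<circ> (\<lambda>t. complex_of_real (norm (x - y + t *\<^sub>R axis l 1))) has_vector_derivative
     of_real ((x - y) $ l / norm (x - y)) * D) (at 0)" by simp
  then show ?thesis by (simp add: comp_def algebra_simps)
qed

lemma green_grad_deriv:
  assumes "x \<noteq> y"
  shows "((\<lambda>t. green_fun \<kappa> (x + t *\<^sub>R axis s 1) y) has_vector_derivative green_grad \<kappa> s x y) (at 0)"
proof -
  define \<rho> where "\<rho> = complex_of_real (norm (x - y))"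
  have \<rho>: "\<rho> \<noteq> 0" using assms by (simp add: \<rho>_def)
  have "((\<lambda>\<rho>. exp (\<i> * of_real \<kappa> * \<rho>) / (of_real (4 * pi) * \<rho>)) has_field_derivative green_d1 \<kappa> \<rho> * \<rho>) (at \<rho>)"
    unfolding green_d1_def using \<rho>
    by (auto intro!: derivative_eq_intros simp: divide_simps power_numeral_reduce) (simp add: algebra_simps)
  from radial_along_deriv[OF assms this[unfolded \<rho>_def], of s] show ?thesis
    using \<rho> unfolding green_grad_def green_fun_def \<rho>_def by (simp add: mult.assoc)
qed

lemma green_hess_deriv:
  assumes "x \<noteq> y"
  shows "((\<lambda>t. green_grad \<kappa> s (x + t *\<^sub>R axis l 1) y) has_vector_derivative green_hess \<kappa> l s x y) (at 0)"
proof -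
  define \<rho> where "\<rho> = complex_of_real (norm (x - y))"
  have \<rho>: "\<rho> \<noteq> 0" using assms by (simp add: \<rho>_def)
  have "(green_d1 \<kappa> has_field_derivative green_d2 \<kappa> \<rho> * \<rho>) (at \<rho>)"
    unfolding green_d1_def[abs_def] green_d2_def using \<rho>
    by (auto intro!: derivative_eq_intros simp: divide_simps power_numeral_reduce) (simp add: algebra_simps power2_eq_square)
  from radial_along_deriv[OF assms this[unfolded \<rho>_def], of l]
  have "((\<lambda>t. green_d1 \<kappa> (of_real (norm (x + t *\<^sub>R axis l 1 - y)))) has_vector_derivative green_d2 \<kappa> \<rho> * of_real (x $ l - y $ l)) (at 0)"
    using \<rho> unfolding \<rho>_def by (simp add: mult.assoc)
  moreover have "((\<lambda>t. complex_of_real ((x + t *\<^sub>R axis l 1) $ s - y $ s)) has_vector_derivative of_real (axis l 1 $ s)) (at 0)"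
    by (intro has_vector_derivative_of_real) (auto intro!: derivative_eq_intros simp flip: has_real_derivative_iff_has_vector_derivative)
  ultimately have "((\<lambda>t. green_grad \<kappa> s (x + t *\<^sub>R axis l 1) y) has_vector_derivative
     green_d1 \<kappa> (of_real (norm (x + 0 *\<^sub>R axis l 1 - y))) * of_real (axis l 1 $ s)
       + green_d2 \<kappa> \<rho> * of_real (x $ l - y $ l) * complex_of_real ((x + 0 *\<^sub>R axis l 1) $ s - y $ s)) (at 0)"
    unfolding green_grad_def by (rule has_vector_derivative_mult)
  moreover have "green_d1 \<kappa> (of_real (norm (x + 0 *\<^sub>R axis l 1 - y))) * of_real (axis l 1 $ s)
       + green_d2 \<kappa> \<rho> * of_real (x $ l - y $ l) * complex_of_real ((x + 0 *\<^sub>R axis l 1) $ s - y $ s) = green_hess \<kappa> l s x y"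
    unfolding green_hess_def \<rho>_def by (simp add: axis_def)
  ultimately show ?thesis by simp
qed

lemma hessian_green:
  assumes "x \<noteq> y"
  shows "hessian (\<lambda>z. green_fun \<kappa> z y) x $ l $ s = green_hess \<kappa> l s x y"
proof -
  have g: "partial_deriv s (\<lambda>z. green_fun \<kappa> z y) z = green_grad \<kappa> s z y" if "z \<noteq> y" for z
    unfolding partial_deriv_def by (rule vector_derivative_at[OF green_grad_deriv[OF that]])
  have "partial_deriv l (partial_deriv s (\<lambda>z. green_fun \<kappa> z y)) x = partial_deriv l (\<lambda>z. green_grad \<kappa> s z y) x"
    by (rule partial_deriv_local[of "- {y}"]) (use assms g in auto)
  also have "\<dots> = green_hess \<kappa> l s x y"
    unfolding partial_deriv_def by (rule vector_derivative_at[OF green_hess_deriv[OF assms]])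
  finally show ?thesis by (simp add: hessian_def)
qed

lemma continuous_on_green_d: "continuous_on (- {0}) (green_d1 \<kappa>)" "continuous_on (- {0}) (green_d2 \<kappa>)"
  unfolding green_d1_def[abs_def] green_d2_def[abs_def] by (auto intro!: continuous_intros)

lemma vector_derivative_quotient:
  fixes g :: "real \<Rightarrow> complex"
  assumes "(g has_vector_derivative D) (at 0)"
  shows "((\<lambda>h. (g h - g 0) /\<^sub>R h) \<longlongrightarrow> D) (at 0)"
proof -
  have "((\<lambda>h. norm (g h - g 0 - (h - 0) *\<^sub>R D) / norm (h - 0)) \<longlongrightarrow> 0) (at 0)"
    using assms unfolding has_vector_derivative_def has_derivative_iff_norm by blast
  moreover have "\<forall>\<^sub>F h in at 0. norm (g h - g 0 - (h - 0) *\<^sub>R D) / norm (h - 0) = norm ((g h - g 0) /\<^sub>R h - D)"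
  proof -
    have "norm (g h - g 0 - (h - 0) *\<^sub>R D) / norm (h - 0) = norm ((g h - g 0) /\<^sub>R h - D)" if "h \<noteq> 0" for h
    proof -
      have "g h - g 0 - h *\<^sub>R D = h *\<^sub>R ((g h - g 0) /\<^sub>R h - D)" using that by (simp add: scaleR_diff_right)
      then show ?thesis using that by simp
    qed
    then show ?thesis by (simp add: eventually_at_filter)
  qed
  ultimately have "((\<lambda>h. norm ((g h - g 0) /\<^sub>R h - D)) \<longlongrightarrow> 0) (at 0)"
    by (rule Lim_transform_eventually)
  then have "((\<lambda>h. (g h - g 0) /\<^sub>R h - D) \<longlongrightarrow> 0) (at 0)" by (rule tendsto_norm_zero_cancel)
  then show ?thesis by (rule LIM_zero_cancel)
qed

lemma continuous_on_green:
  assumes X: "continuous_on K X" and Y: "continuous_on K Y" and ne: "\<And>z. z \<in> K \<Longrightarrow> X z \<noteq> Y z"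
  shows "continuous_on K (\<lambda>z. green_fun \<kappa> (X z) (Y z))" "continuous_on K (\<lambda>z. green_grad \<kappa> s (X z) (Y z))"
    "continuous_on K (\<lambda>z. green_hess \<kappa> l s (X z) (Y z))"
proof -
  have n: "continuous_on K (\<lambda>z. complex_of_real (norm (X z - Y z)))" by (intro continuous_intros X Y)
  have n0: "complex_of_real (norm (X z - Y z)) \<noteq> 0" if "z \<in> K" for z using ne[OF that] by simp
  have n5: "\<forall>z\<in>K. complex_of_real (4 * pi * norm (X z - Y z)) \<noteq> 0" using n0 by simp
  show "continuous_on K (\<lambda>z. green_fun \<kappa> (X z) (Y z))"
    unfolding green_fun_def by (intro continuous_intros X Y n5)
  have d1: "continuous_on K (\<lambda>z. green_d1 \<kappa> (of_real (norm (X z - Y z))))"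
    by (rule continuous_on_compose2[OF continuous_on_green_d(1) n]) (use n0 in auto)
  have d2: "continuous_on K (\<lambda>z. green_d2 \<kappa> (of_real (norm (X z - Y z))))"
    by (rule continuous_on_compose2[OF continuous_on_green_d(2) n]) (use n0 in auto)
  show "continuous_on K (\<lambda>z. green_grad \<kappa> s (X z) (Y z))"
    unfolding green_grad_def by (intro continuous_intros d1 X Y)
  show "continuous_on K (\<lambda>z. green_hess \<kappa> l s (X z) (Y z))"
  proof -
    have "continuous_on K (\<lambda>z. if l = s then green_d1 \<kappa> (of_real (norm (X z - Y z))) else 0)"
      by (cases "l = s") (simp_all add: d1)
    then show ?thesis unfolding green_hess_def by (intro continuous_intros d2 X Y)
  qed
qed

context source_in_ball
begin

text \<open>If an integral vanishes for all \<open>x\<close> outside the closed ball, so do its difference quotients, and by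
  dominated convergence the integral of the derivative.\<close>

lemma deriv_under_zero_integral:
  assumes zero: "\<And>x. norm x > r \<Longrightarrow> (\<integral>y. k x y * f y \<partial>M) = 0"
    and der: "\<And>x y. x \<noteq> y \<Longrightarrow> ((\<lambda>t. k (x + t *\<^sub>R axis l 1) y) has_vector_derivative k' x y) (at 0)"
    and contk: "\<And>x. norm x > r \<Longrightarrow> continuous_on (cball 0 r) (k x)"
    and contk': "\<And>K :: ((real^3) \<times> (real^3)) set. (\<And>z. z \<in> K \<Longrightarrow> fst z \<noteq> snd z) \<Longrightarrow> continuous_on K (\<lambda>z. k' (fst z) (snd z))"
    and x: "norm x > r"
  shows "(\<integral>y. k' x y * f y \<partial>M) = 0"
proof -
  define e where "e = (norm x - r) / 2"
  have e: "e > 0" using x by (simp add: e_def)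
  have far: "norm u > r" if "u \<in> cball x e" for u
    using that norm_triangle_ineq2[of x u] e by (simp add: e_def dist_norm field_simps)
  let ?K = "cball x e \<times> cball 0 r :: ((real^3) \<times> (real^3)) set"
  have ne: "u \<noteq> y" if "norm u > r" "y \<in> cball 0 r" for u y :: "real^3" using that by auto
  have "continuous_on ?K (\<lambda>z. k' (fst z) (snd z))" by (rule contk') (use ne far in auto)
  then obtain B where B: "B \<ge> 0" "\<And>z. z \<in> ?K \<Longrightarrow> cmod (k' (fst z) (snd z)) \<le> B"
    using compact_bound[OF compact_Times[OF compact_cball compact_cball]] by blast
  define p where "p t = x + t *\<^sub>R axis l 1" for t
  have p: "p t \<in> cball x e" if "\<bar>t\<bar> \<le> e" for t using that by (simp add: p_def dist_norm)
  have pder: "((\<lambda>t. k (p t) y) has_vector_derivative k' (p t) y) (at t)" if "\<bar>t\<bar> \<le> e" "y \<in> cball 0 r" for t y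
  proof -
    have "((\<lambda>h. k (p t + h *\<^sub>R axis l 1) y) has_vector_derivative k' (p t) y) (at 0)"
      by (rule der[OF ne[OF far[OF p[OF that(1)]] that(2)]])
    then have "((\<lambda>h. k (p (h + t)) y) has_vector_derivative k' (p t) y) (at 0)"
      by (simp add: p_def algebra_simps)
    moreover have "((\<lambda>h. h - t) has_vector_derivative 1) (at t)"
      by (auto intro!: derivative_eq_intros)
    ultimately have "((\<lambda>h. k (p (h + t)) y) \<circ> (\<lambda>h. h - t) has_vector_derivative 1 *\<^sub>R k' (p t) y) (at t)"
      by (intro vector_diff_chain_at) simp_all
    then show ?thesis by (simp add: comp_def)
  qed
  define q where "q h y = (k (p h) y - k x y) /\<^sub>R h" for h y
  have p0: "p 0 = x" by (simp add: p_def)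
  have "((\<lambda>h. \<integral>y. q h y * f y \<partial>M) \<longlongrightarrow> (\<integral>y. k' x y * f y \<partial>M)) (at 0)"
  proof (rule tendsto_integral_mult[OF f, of "ball 0 e"])
    have "continuous_on (cball 0 r) (\<lambda>y. k' (fst (x, y)) (snd (x, y)))"
    proof (rule continuous_on_compose2[of "{x} \<times> cball 0 r" "\<lambda>z. k' (fst z) (snd z)" _ "\<lambda>y. (x, y)"])
      show "continuous_on ({x} \<times> cball 0 r) (\<lambda>z. k' (fst z) (snd z))" by (rule contk') (use ne x in auto)
    qed (auto intro!: continuous_intros)
    then show "k' x \<in> borel_measurable M" by (intro measurable_M) simp
    show "q h \<in> borel_measurable M" if "h \<in> ball 0 e - {0}" for h
    proof -
      have "continuous_on (cball 0 r) (k (p h))" "continuous_on (cball 0 r) (k x)"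
        using that by (auto intro!: contk far p x)
      then show ?thesis unfolding q_def[abs_def] by (intro measurable_M continuous_intros)
    qed
    show "((\<lambda>h. q h y) \<longlongrightarrow> k' x y) (at 0)" if "y \<in> space M" for y
    proof -
      have "((\<lambda>t. k (p t) y) has_vector_derivative k' x y) (at 0)"
        using pder[of 0 y] that e p0 by simp
      from vector_derivative_quotient[OF this] have "((\<lambda>h. (k (p h) y - k (p 0) y) /\<^sub>R h) \<longlongrightarrow> k' x y) (at 0)" .
      then show ?thesis by (simp add: q_def p0)
    qed
    show "cmod (q h y) \<le> B" if h: "h \<in> ball 0 e - {0}" and y: "y \<in> space M" for h y
    proof -
      have "norm (k (p h) y - k (p 0) y) \<le> B * norm (h - 0)"
      proof (rule differentiable_bound[of "cball 0 e" _ "\<lambda>t d. d *\<^sub>R k' (p t) y"])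
        show "((\<lambda>t. k (p t) y) has_derivative (\<lambda>d. d *\<^sub>R k' (p t) y)) (at t within cball 0 e)" if "t \<in> cball 0 e" for t
          using pder[of t y] that y by (auto simp: has_vector_derivative_def intro: has_derivative_at_withinI)
        show "onorm (\<lambda>d. d *\<^sub>R k' (p t) y) \<le> B" if "t \<in> cball 0 e" for t
        proof (rule onorm_le)
          fix d :: real
          have "(p t, y) \<in> ?K" using p[of t] that y by simp
          from B(2)[OF this] have "\<bar>d\<bar> * cmod (k' (p t) y) \<le> \<bar>d\<bar> * B" by (intro mult_left_mono) auto
          then show "norm (d *\<^sub>R k' (p t) y) \<le> B * norm d" by (simp add: mult.commute)
        qed
      qed (use h e in auto)
      then show ?thesis using h by (simp add: q_def p0 divide_simps mult.commute)
    qed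
  qed (use e in auto)
  moreover have "\<forall>\<^sub>F h in at 0. (\<integral>y. q h y * f y \<partial>M) = 0"
  proof -
    have "(\<integral>y. q h y * f y \<partial>M) = 0" if h: "h \<in> ball 0 e" for h
    proof -
      have int: "integrable M (\<lambda>y. k u y * f y)" if u: "norm u > r" for u
      proof -
        obtain B where "\<And>y. y \<in> cball 0 r \<Longrightarrow> cmod (k u y) \<le> B" using compact_bound[OF compact_cball contk[OF u]] by blast
        then show ?thesis by (intro integrable_bounded_mult[OF f measurable_M[OF contk[OF u]], of B]) auto
      qed
      have ph: "norm (p h) > r" using far[OF p[of h]] h by simp
      have "(\<integral>y. q h y * f y \<partial>M) = (\<integral>y. (k (p h) y * f y - k x y * f y) /\<^sub>R h \<partial>M)"
        by (simp add: q_def algebra_simps)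
      also have "\<dots> = ((\<integral>y. k (p h) y * f y \<partial>M) - (\<integral>y. k x y * f y \<partial>M)) /\<^sub>R h"
        using int[OF ph] int[OF x] by simp
      finally show ?thesis using zero[OF ph] zero[OF x] by simp
    qed
    then show ?thesis using e by (intro eventually_at_in_open'[THEN eventually_mono, of "ball 0 e"]) auto
  qed
  ultimately have "((\<lambda>h::real. 0) \<longlongrightarrow> (\<integral>y. k' x y * f y \<partial>M)) (at 0)"
    by (rule Lim_transform_eventually)
  then show ?thesis by (rule LIM_const_eq[symmetric])
qed

theorem green_hess_zero:
  assumes far: "\<And>x. norm x = 1 \<Longrightarrow> (\<integral>y. exp (- \<i> * of_real \<kappa> * pr x y) * f y \<partial>M) = 0"
    and x: "norm x > r"
  shows "(\<integral>y. green_hess \<kappa> l s x y * f y \<partial>M) = 0"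
proof -
  have ne: "x \<noteq> y" if "norm x > r" "y \<in> cball 0 r" for x y :: "real^3" using that by auto
  have "(\<integral>y. green_grad \<kappa> s x y * f y \<partial>M) = 0" if "norm x > r" for x
    by (rule deriv_under_zero_integral[OF green_potential_zero[OF far] green_grad_deriv _ _ that])
       (auto intro!: continuous_on_green continuous_intros ne)
  then show ?thesis
    by (rule deriv_under_zero_integral[OF _ green_hess_deriv _ _ x])
       (auto intro!: continuous_on_green continuous_intros ne)
qed

end

section \<open>The field far away from the source\<close>

definition green_entry :: "real \<Rightarrow> 3 \<Rightarrow> 3 \<Rightarrow> real^3 \<Rightarrow> real^3 \<Rightarrow> complex" where
  "green_entry \<kappa> l s x y = (if l = s then green_fun \<kappa> x y else 0) + of_real (1 / \<kappa>\<^sup>2) * green_hess \<kappa> l s x y"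

lemma green_tensor_entry:
  assumes "x \<noteq> y"
  shows "green_tensor \<kappa> x y $ l $ s = green_entry \<kappa> l s x y"
  unfolding green_tensor_def green_entry_def
  by (simp add: hessian_green[OF assms] mat_def) (simp add: scaleR_conv_of_real divide_inverse mult.commute)

text \<open>An entry of the Green tensor divided by the Green function, as a polynomial in \<open>u = 1 / |x - y|\<close> and
  the unit vector \<open>e\<close> pointing from \<open>y\<close> to \<open>x\<close>. At \<open>u = 0\<close> only the projection onto the plane
  orthogonal to \<open>e\<close> is left.\<close>

definition entry_factor :: "real \<Rightarrow> 3 \<Rightarrow> 3 \<Rightarrow> real \<Rightarrow> real^3 \<Rightarrow> complex" where
  "entry_factor \<kappa> l s u e = (if l = s then 1 else 0) + of_real (1 / \<kappa>\<^sup>2) *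
     ((3 * of_real u ^ 2 - 3 * \<i> * of_real \<kappa> * of_real u - of_real \<kappa> ^ 2) * of_real (e $ l * e $ s)
       + (if l = s then \<i> * of_real \<kappa> * of_real u - of_real u ^ 2 else 0))"

lemma green_entry_factor:
  assumes "x \<noteq> y"
  shows "green_entry \<kappa> l s x y =
     green_fun \<kappa> x y * entry_factor \<kappa> l s (1 / norm (x - y)) ((x - y) /\<^sub>R norm (x - y))"
proof -
  define \<rho> where "\<rho> = norm (x - y)"
  have \<rho>: "\<rho> \<noteq> 0" using assms by (simp add: \<rho>_def)
  define E where "E = exp (\<i> * of_real \<kappa> * complex_of_real \<rho>)"
  have E: "exp (\<i> * of_real (\<kappa> * \<rho>)) = E" by (simp add: E_def mult.assoc)
  have e: "((x - y) /\<^sub>R \<rho>) $ i = (x $ i - y $ i) / \<rho>" for i by (simp add: divide_inverse mult.commute)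
  have 1: "green_d1 \<kappa> (of_real \<rho>) = E / of_real (4 * pi * \<rho>) * (\<i> * of_real \<kappa> * of_real (1 / \<rho>) - of_real (1 / \<rho>) ^ 2)"
    unfolding green_d1_def E_def[symmetric] using \<rho> by (simp add: field_simps power_numeral_reduce)
  have 2: "green_d2 \<kappa> (of_real \<rho>) * of_real (a * b) = E / of_real (4 * pi * \<rho>) *
     ((3 * of_real (1 / \<rho>) ^ 2 - 3 * \<i> * of_real \<kappa> * of_real (1 / \<rho>) - of_real \<kappa> ^ 2) * of_real ((a / \<rho>) * (b / \<rho>)))" for a b
    unfolding green_d2_def E_def[symmetric] using \<rho> by (simp add: field_simps power_numeral_reduce)
  have "(if b then G else 0) + c * (G * Y + (if b then G * Z else 0)) = G * ((if b then 1 else 0) + c * (Y + (if b then Z else 0)))"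
    for b and G c Y Z :: complex by (cases b) (simp_all add: algebra_simps)
  then show ?thesis
    unfolding green_entry_def green_hess_def green_fun_def entry_factor_def \<rho>_def[symmetric] e E 1 2 .
qed

lemma entry_factor_continuous:
  fixes e :: "'a::topological_space \<Rightarrow> real^3"
  assumes u: "continuous_on K u" and e: "\<And>i. continuous_on K (\<lambda>z. e z $ i)"
  shows "continuous_on K (\<lambda>z. entry_factor \<kappa> l s (u z) (e z))"
proof -
  have 1: "continuous_on K (\<lambda>z. if l = s then \<i> * of_real \<kappa> * of_real (u z) - of_real (u z) ^ 2 else 0)"
    by (cases "l = s") (auto intro!: continuous_intros u)
  have 2: "continuous_on K (\<lambda>z. 3 * of_real (u z) ^ 2 - 3 * \<i> * of_real \<kappa> * of_real (u z) - of_real \<kappa> ^ 2 :: complex)"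
    by (intro continuous_intros u)
  have 3: "continuous_on K (\<lambda>z. of_real (e z $ l * e z $ s) :: complex)"
    by (intro continuous_on_of_real continuous_on_mult e)
  show ?thesis unfolding entry_factor_def
    by (rule continuous_on_add[OF continuous_on_const continuous_on_mult[OF continuous_on_const
          continuous_on_add[OF continuous_on_mult[OF 2 3] 1]]])
qed

lemma entry_factor_tendsto:
  fixes e :: "'a \<Rightarrow> real^3" and b :: "real^3"
  assumes u: "(u \<longlongrightarrow> a) F" and e: "\<And>i. ((\<lambda>z. e z $ i) \<longlongrightarrow> b $ i) F"
  shows "((\<lambda>z. entry_factor \<kappa> l s (u z) (e z)) \<longlongrightarrow> entry_factor \<kappa> l s a b) F"
proof -
  have 1: "((\<lambda>z. if l = s then \<i> * of_real \<kappa> * of_real (u z) - of_real (u z) ^ 2 else 0) \<longlongrightarrow>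
      (if l = s then \<i> * of_real \<kappa> * of_real a - of_real a ^ 2 else 0)) F"
    by (cases "l = s") (auto intro!: tendsto_intros u)
  have 2: "((\<lambda>z. 3 * of_real (u z) ^ 2 - 3 * \<i> * of_real \<kappa> * of_real (u z) - of_real \<kappa> ^ 2 :: complex) \<longlongrightarrow>
      3 * of_real a ^ 2 - 3 * \<i> * of_real \<kappa> * of_real a - of_real \<kappa> ^ 2) F"
    by (intro tendsto_intros u)
  have 3: "((\<lambda>z. of_real (e z $ l * e z $ s) :: complex) \<longlongrightarrow> of_real (b $ l * b $ s)) F"
    by (intro tendsto_of_real tendsto_mult e)
  show ?thesis unfolding entry_factor_def
    by (rule tendsto_add[OF tendsto_const tendsto_mult[OF tendsto_const tendsto_add[OF tendsto_mult[OF 2 3] 1]]])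
qed

context source_in_ball
begin

text \<open>Along a ray the Green function has the profile \<open>aw_kernel\<close> at \<open>\<tau> = 1 / n\<close>, which tends to its value at
  \<open>\<tau> = 0\<close>, a plane wave.\<close>

lemma green_entry_asymptotic:
  assumes x: "norm x = 1"
  shows "(\<lambda>n. of_real (4 * pi * real n) * exp (- \<i> * of_real (\<kappa> * real n)) * (\<integral>y. green_entry \<kappa> l s (real n *\<^sub>R x) y * f y \<partial>M))
     \<longlonglongrightarrow> of_real ((if l = s then 1 else 0) - x $ l * x $ s) * (\<integral>y. exp (- \<i> * of_real \<kappa> * pr x y) * f y \<partial>M)"
proof -
  \<comment> \<open>Beyond distance \<open>2 r\<close> the kernels are bounded uniformly, as dominated convergence requires.\<close>
  define N where "N = nat \<lceil>2 * r\<rceil> + 1"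
  have N: "real (n + N) \<ge> 2 * r" "real (n + N) > 0" for n unfolding N_def using r by linarith+
  define t where "t n = real (n + N)" for n
  have t: "t n \<ge> 2 * r" "t n > 0" "t n > r" "norm (t n *\<^sub>R x) = t n" for n
    using N[of n] r x by (auto simp: t_def)
  have t_lim: "filterlim t at_top sequentially"
    unfolding t_def by (rule filterlim_compose[OF filterlim_real_sequentially]) (rule filterlim_add_const_nat_at_top)
  have dist: "norm (t n *\<^sub>R x - y) \<ge> t n - r" if "y \<in> cball 0 r" for n y
    using norm_triangle_ineq2[of "t n *\<^sub>R x" y] t(4)[of n] that by simp
  have ne: "t n *\<^sub>R x \<noteq> y" if "y \<in> cball 0 r" for n y using that t[of n] by auto
  define A where "A n y = aw_kernel \<kappa> (of_real (1 / t n)) (pr x y) (pr y y)" for n y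
  define F where "F n y = entry_factor \<kappa> l s (1 / norm (t n *\<^sub>R x - y)) ((t n *\<^sub>R x - y) /\<^sub>R norm (t n *\<^sub>R x - y))" for n y
  have AF: "of_real (4 * pi * t n) * exp (- \<i> * of_real (\<kappa> * t n)) * green_entry \<kappa> l s (t n *\<^sub>R x) y = A n y * F n y"
    if "y \<in> cball 0 r" for n y
  proof -
    have "green_fun \<kappa> (t n *\<^sub>R x) y = exp (\<i> * of_real (\<kappa> * norm (t n *\<^sub>R x - y))) / of_real (norm (t n *\<^sub>R x - y)) / of_real (4 * pi)"
      by (simp add: green_fun_def)
    also have "exp (\<i> * of_real (\<kappa> * norm (t n *\<^sub>R x - y))) / of_real (norm (t n *\<^sub>R x - y)) =
       exp (\<i> * of_real (\<kappa> * t n)) / of_real (t n) * A n y"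
      using aw_kernel_green[of "t n *\<^sub>R x" y] t[of n] that by (simp add: A_def)
    finally have g: "green_fun \<kappa> (t n *\<^sub>R x) y = exp (\<i> * of_real (\<kappa> * t n)) / of_real (t n) * A n y / of_real (4 * pi)" .
    have "exp (- \<i> * of_real (\<kappa> * t n)) * exp (\<i> * of_real (\<kappa> * t n)) = 1"
      by (simp flip: exp_add)
    then show ?thesis
      unfolding green_entry_factor[OF ne[OF that]] g F_def[symmetric] using t(2)[of n] by (simp add: field_simps)
  qed
  define B0 where "B0 = 1 + 1 / \<kappa>\<^sup>2 * (3 * (1 / r)\<^sup>2 + 3 * \<kappa> * (1 / r) + \<kappa>\<^sup>2 + \<kappa> * (1 / r) + (1 / r)\<^sup>2)"
  have Fb: "cmod (F n y) \<le> B0" if y: "y \<in> cball 0 r" for n y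
  proof -
    define u where "u = 1 / norm (t n *\<^sub>R x - y)"
    define e where "e = (t n *\<^sub>R x - y) /\<^sub>R norm (t n *\<^sub>R x - y)"
    have "norm (t n *\<^sub>R x - y) \<ge> r" using dist[OF y, of n] t(1)[of n] by linarith
    then have u: "0 \<le> u" "u \<le> 1 / r" using r by (auto simp: u_def intro!: divide_left_mono mult_pos_pos)
    have en: "norm e \<le> 1" using ne[OF y, of n] by (simp add: e_def)
    have ei: "\<bar>e $ i\<bar> \<le> 1" for i using component_le_norm_cart[of e i] en by linarith
    have els: "\<bar>e $ l * e $ s\<bar> \<le> 1" using mult_mono[OF ei[of l] ei[of s]] by (simp add: abs_mult)
    have u2: "u\<^sup>2 \<le> (1 / r)\<^sup>2" using u by (intro power_mono)
    have ku: "\<kappa> * u \<le> \<kappa> * (1 / r)" using u \<kappa> by (intro mult_left_mono) auto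
    have n1: "cmod (3 * of_real u ^ 2 - 3 * \<i> * of_real \<kappa> * of_real u - of_real \<kappa> ^ 2) \<le> 3 * (1 / r)\<^sup>2 + 3 * \<kappa> * (1 / r) + \<kappa>\<^sup>2"
    proof -
      have "cmod (3 * of_real u ^ 2 - 3 * \<i> * of_real \<kappa> * of_real u - of_real \<kappa> ^ 2) \<le>
          cmod (3 * of_real u ^ 2) + cmod (3 * \<i> * of_real \<kappa> * of_real u) + cmod (of_real \<kappa> ^ 2)"
        using norm_triangle_ineq4 by (meson add_right_mono order_trans)
      also have "\<dots> = 3 * u\<^sup>2 + 3 * (\<kappa> * u) + \<kappa>\<^sup>2" using u \<kappa> by (simp add: norm_mult norm_power)
      finally show ?thesis using u2 ku by linarith
    qed
    have n2: "cmod (\<i> * of_real \<kappa> * of_real u - of_real u ^ 2) \<le> \<kappa> * (1 / r) + (1 / r)\<^sup>2"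
    proof -
      have "cmod (\<i> * of_real \<kappa> * of_real u - of_real u ^ 2) \<le> cmod (\<i> * of_real \<kappa> * of_real u) + cmod (of_real u ^ 2)"
        by (rule norm_triangle_ineq4)
      also have "\<dots> = \<kappa> * u + u\<^sup>2" using u \<kappa> by (simp add: norm_mult norm_power)
      finally show ?thesis using u2 ku by linarith
    qed
    have n2': "cmod (if l = s then \<i> * of_real \<kappa> * of_real u - of_real u ^ 2 else 0) \<le> \<kappa> * (1 / r) + (1 / r)\<^sup>2"
      using n2 r \<kappa> by auto
    have n1': "cmod ((3 * of_real u ^ 2 - 3 * \<i> * of_real \<kappa> * of_real u - of_real \<kappa> ^ 2) * of_real (e $ l * e $ s)) \<le> 3 * (1 / r)\<^sup>2 + 3 * \<kappa> * (1 / r) + \<kappa>\<^sup>2"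
      using mult_mono[OF n1 els] r \<kappa> by (simp add: norm_mult abs_mult)
    have "cmod (entry_factor \<kappa> l s u e) \<le> 1 + 1 / \<kappa>\<^sup>2 *
        ((3 * (1 / r)\<^sup>2 + 3 * \<kappa> * (1 / r) + \<kappa>\<^sup>2) + (\<kappa> * (1 / r) + (1 / r)\<^sup>2))"
      unfolding entry_factor_def
    proof (intro order_trans[OF norm_triangle_ineq] add_mono)
      show "cmod (of_real (1 / \<kappa>\<^sup>2) * ((3 * of_real u ^ 2 - 3 * \<i> * of_real \<kappa> * of_real u - of_real \<kappa> ^ 2) * of_real (e $ l * e $ s)
          + (if l = s then \<i> * of_real \<kappa> * of_real u - of_real u ^ 2 else 0)))
          \<le> 1 / \<kappa>\<^sup>2 * ((3 * (1 / r)\<^sup>2 + 3 * \<kappa> * (1 / r) + \<kappa>\<^sup>2) + (\<kappa> * (1 / r) + (1 / r)\<^sup>2))"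
        unfolding norm_mult[of "of_real (1 / \<kappa>\<^sup>2)"] norm_of_real
        using order_trans[OF norm_triangle_ineq add_mono[OF n1' n2']]
        by (intro mult_mono) auto
    qed simp
    then show ?thesis unfolding F_def u_def e_def B0_def by (simp add: add_ac)
  qed
  have A0: "1 / (2 * r) < 1 / r" using r by (simp add: field_simps)
  obtain B where B: "B \<ge> 0"
    "\<And>\<tau> y. \<tau> \<in> cball 0 (1 / (2 * r)) \<Longrightarrow> y \<in> cball 0 r \<Longrightarrow> cmod (aw_kernel \<kappa> \<tau> (pr x y) (pr y y)) \<le> B"
    by (rule kernel_bounds[OF x A0]) (rule that)
  have tau: "of_real (1 / t n) \<in> cball (0 :: complex) (1 / (2 * r))" for n
  proof -
    have "1 / t n \<le> 1 / (2 * r)" using t[of n] r by (intro divide_left_mono) auto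
    then show ?thesis using t(2)[of n] by (simp add: norm_divide)
  qed
  have "(\<lambda>n. \<integral>y. A n y * F n y * f y \<partial>M) \<longlonglongrightarrow>
     (\<integral>y. exp (- \<i> * of_real \<kappa> * pr x y) * of_real ((if l = s then 1 else 0) - x $ l * x $ s) * f y \<partial>M)"
  proof (rule integral_dominated_convergence)
    have fm: "f \<in> borel_measurable M" using f by simp
    show "integrable M (\<lambda>y. B * B0 * norm (f y))" using f by simp
    have "(\<lambda>y. exp (- \<i> * of_real \<kappa> * pr x y) * of_real ((if l = s then 1 else 0) - x $ l * x $ s)) \<in> borel_measurable M"
      by (intro measurable_M continuous_intros)
    with fm show "(\<lambda>y. exp (- \<i> * of_real \<kappa> * pr x y) * of_real ((if l = s then 1 else 0) - x $ l * x $ s) * f y) \<in> borel_measurable M"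
      by measurable
    show "(\<lambda>y. A n y * F n y * f y) \<in> borel_measurable M" for n
    proof -
      have tb: "of_real (1 / t n) \<in> ball (0 :: complex) (1 / r)" using tau[of n] A0 by auto
      have Am: "A n \<in> borel_measurable M" unfolding A_def[abs_def] by (rule kernel_measurable(1)[OF x tb])
      have "continuous_on (cball 0 r) (F n)"
      proof -
        have n0: "norm (t n *\<^sub>R x - y) \<noteq> 0" if "y \<in> cball 0 r" for y using ne[OF that, of n] by simp
        have c1: "continuous_on (cball 0 r) (\<lambda>y. 1 / norm (t n *\<^sub>R x - y))" by (intro continuous_intros ballI n0)
        have c2: "continuous_on (cball 0 r) (\<lambda>y. ((t n *\<^sub>R x - y) /\<^sub>R norm (t n *\<^sub>R x - y)) $ i)" for i
          by (intro continuous_intros ballI n0)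
        show ?thesis unfolding F_def[abs_def] by (rule entry_factor_continuous[OF c1 c2])
      qed
      then have "F n \<in> borel_measurable M" by (rule measurable_M)
      with Am fm show ?thesis by measurable
    qed
    show "AE y in M. (\<lambda>n. A n y * F n y * f y) \<longlonglongrightarrow>
       exp (- \<i> * of_real \<kappa> * pr x y) * of_real ((if l = s then 1 else 0) - x $ l * x $ s) * f y"
    proof (rule AE_I2)
      fix y assume "y \<in> space M"
      then have y: "y \<in> cball 0 r" by simp
      have inv_t: "(\<lambda>n. 1 / t n) \<longlonglongrightarrow> 0"
        using tendsto_divide_0[OF tendsto_const filterlim_at_top_imp_at_infinity[OF t_lim]] .
      have cont0: "isCont (\<lambda>\<tau>. aw_kernel \<kappa> \<tau> (pr x y) (pr y y)) 0"
        by (rule DERIV_isCont[OF aw_kernel_dtau]) (rule arg_ok[OF x _ _ y, of _ 0], use r in auto)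
      have "(\<lambda>n. complex_of_real (1 / t n)) \<longlonglongrightarrow> of_real 0" by (rule tendsto_of_real[OF inv_t])
      then have "(\<lambda>n. complex_of_real (1 / t n)) \<longlonglongrightarrow> 0" by simp
      from isCont_tendsto_compose[OF cont0 this] have "(\<lambda>n. A n y) \<longlonglongrightarrow> aw_kernel \<kappa> 0 (pr x y) (pr y y)"
        unfolding A_def .
      moreover have "aw_kernel \<kappa> 0 (pr x y) (pr y y) = exp (- \<i> * of_real \<kappa> * pr x y)"
        by (simp add: aw_kernel_def sph_phase_def sph_root_def sph_arg_def)
      ultimately have Al: "(\<lambda>n. A n y) \<longlonglongrightarrow> exp (- \<i> * of_real \<kappa> * pr x y)" by simp
      have "filterlim (\<lambda>n. norm (t n *\<^sub>R x - y)) at_top sequentially"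
      proof (rule filterlim_at_top_mono)
        show "filterlim (\<lambda>n. - r + t n) at_top sequentially"
          by (intro filterlim_tendsto_add_at_top[OF tendsto_const t_lim])
        show "\<forall>\<^sub>F n in sequentially. - r + t n \<le> norm (t n *\<^sub>R x - y)" using dist[OF y] by (intro always_eventually) simp
      qed
      then have ul: "(\<lambda>n. 1 / norm (t n *\<^sub>R x - y)) \<longlonglongrightarrow> 0"
        using tendsto_divide_0[OF tendsto_const filterlim_at_top_imp_at_infinity] by blast
      have el: "(\<lambda>n. (t n *\<^sub>R x - y) /\<^sub>R norm (t n *\<^sub>R x - y)) \<longlonglongrightarrow> x"
      proof -
        have "(\<lambda>n. x - (1 / t n) *\<^sub>R y) \<longlonglongrightarrow> x - 0 *\<^sub>R y" by (intro tendsto_intros inv_t)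
        then have l0: "(\<lambda>n. x - (1 / t n) *\<^sub>R y) \<longlonglongrightarrow> x" by simp
        have "(\<lambda>n. (x - (1 / t n) *\<^sub>R y) /\<^sub>R norm (x - (1 / t n) *\<^sub>R y)) \<longlonglongrightarrow> x /\<^sub>R norm x"
          by (intro tendsto_intros l0) (use x in simp)
        moreover have "(t n *\<^sub>R x - y) /\<^sub>R norm (t n *\<^sub>R x - y) = (x - (1 / t n) *\<^sub>R y) /\<^sub>R norm (x - (1 / t n) *\<^sub>R y)" for n
        proof -
          have eq: "t n *\<^sub>R x - y = t n *\<^sub>R (x - (1 / t n) *\<^sub>R y)" using t(2)[of n] by (simp add: scaleR_diff_right)
          show ?thesis unfolding eq using t(2)[of n] by simp
        qed
        ultimately show ?thesis using x by simp
      qed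
      have eli: "(\<lambda>n. ((t n *\<^sub>R x - y) /\<^sub>R norm (t n *\<^sub>R x - y)) $ i) \<longlonglongrightarrow> x $ i" for i
        by (rule tendsto_vec_nth[OF el])
      have Fl: "(\<lambda>n. F n y) \<longlonglongrightarrow> of_real ((if l = s then 1 else 0) - x $ l * x $ s)"
      proof -
        have "(\<lambda>n. F n y) \<longlonglongrightarrow> entry_factor \<kappa> l s 0 x"
          unfolding F_def by (rule entry_factor_tendsto[OF ul eli])
        moreover have "entry_factor \<kappa> l s 0 x = of_real ((if l = s then 1 else 0) - x $ l * x $ s)"
          using \<kappa> by (simp add: entry_factor_def field_simps)
        ultimately show ?thesis by simp
      qed
      show "(\<lambda>n. A n y * F n y * f y) \<longlonglongrightarrow>
         exp (- \<i> * of_real \<kappa> * pr x y) * of_real ((if l = s then 1 else 0) - x $ l * x $ s) * f y"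
        by (intro tendsto_mult Al Fl tendsto_const)
    qed
    show "AE y in M. norm (A n y * F n y * f y) \<le> B * B0 * norm (f y)" for n
    proof (rule AE_I2)
      fix y assume "y \<in> space M"
      then have y: "y \<in> cball 0 r" by simp
      have "cmod (A n y) \<le> B" unfolding A_def by (rule B(2)[OF tau y])
      then show "norm (A n y * F n y * f y) \<le> B * B0 * norm (f y)"
        unfolding norm_mult using Fb[OF y, of n] B(1) by (intro mult_right_mono mult_mono) auto
    qed
  qed
  moreover have "(\<integral>y. A n y * F n y * f y \<partial>M) = of_real (4 * pi * t n) * exp (- \<i> * of_real (\<kappa> * t n)) * (\<integral>y. green_entry \<kappa> l s (t n *\<^sub>R x) y * f y \<partial>M)" for n
  proof -
    have "(\<integral>y. A n y * F n y * f y \<partial>M) = (\<integral>y. (of_real (4 * pi * t n) * exp (- \<i> * of_real (\<kappa> * t n))) * (green_entry \<kappa> l s (t n *\<^sub>R x) y * f y) \<partial>M)"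
      by (intro Bochner_Integration.integral_cong refl) (simp add: AF[symmetric] mult.assoc)
    then show ?thesis by simp
  qed
  moreover have "(\<integral>y. exp (- \<i> * of_real \<kappa> * pr x y) * of_real ((if l = s then 1 else 0) - x $ l * x $ s) * f y \<partial>M)
     = of_real ((if l = s then 1 else 0) - x $ l * x $ s) * (\<integral>y. exp (- \<i> * of_real \<kappa> * pr x y) * f y \<partial>M)"
  proof -
    have "(\<integral>y. g y * c * f y \<partial>M) = c * (\<integral>y. g y * f y \<partial>M)" for g and c :: complex
      by (simp only: integral_mult_right_zero[symmetric] mult_ac)
    then show ?thesis .
  qed
  ultimately have "(\<lambda>n. of_real (4 * pi * t n) * exp (- \<i> * of_real (\<kappa> * t n)) * (\<integral>y. green_entry \<kappa> l s (t n *\<^sub>R x) y * f y \<partial>M))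
     \<longlonglongrightarrow> of_real ((if l = s then 1 else 0) - x $ l * x $ s) * (\<integral>y. exp (- \<i> * of_real \<kappa> * pr x y) * f y \<partial>M)"
    by simp
  then show ?thesis unfolding t_def by (rule LIMSEQ_offset)
qed

lemma green_entry_zero:
  assumes far: "\<And>x. norm x = 1 \<Longrightarrow> (\<integral>y. exp (- \<i> * of_real \<kappa> * pr x y) * f y \<partial>M) = 0"
    and x: "norm x > r"
  shows "(\<integral>y. green_entry \<kappa> l s x y * f y \<partial>M) = 0"
proof -
  have ne: "x \<noteq> y" if "y \<in> cball 0 r" for y using that x by auto
  have c: "continuous_on (cball 0 r) (\<lambda>y. green_fun \<kappa> x y)" "continuous_on (cball 0 r) (\<lambda>y. green_hess \<kappa> l s x y)"
    by (intro continuous_on_green continuous_intros ne; assumption)+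
  have int: "integrable M (\<lambda>y. k y * f y)" if k: "continuous_on (cball 0 r) k" for k
  proof -
    obtain B where "\<And>y. y \<in> cball 0 r \<Longrightarrow> cmod (k y) \<le> B" using compact_bound[OF compact_cball k] by blast
    then show ?thesis by (intro integrable_bounded_mult[OF f measurable_M[OF k], of B]) auto
  qed
  have lin: "(\<integral>y. (d * g y + c * h y) * f y \<partial>M) = d * (\<integral>y. g y * f y \<partial>M) + c * (\<integral>y. h y * f y \<partial>M)"
    if "integrable M (\<lambda>y. g y * f y)" "integrable M (\<lambda>y. h y * f y)" for g h c d
    using that by (simp add: algebra_simps)
  have "green_entry \<kappa> l s x y = (if l = s then 1 else 0) * green_fun \<kappa> x y + of_real (1 / \<kappa>\<^sup>2) * green_hess \<kappa> l s x y" for y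
    by (simp add: green_entry_def)
  then show ?thesis
    using lin[OF int[OF c(1)] int[OF c(2)], of "if l = s then 1 else 0" "of_real (1 / \<kappa>\<^sup>2)"]
      green_potential_zero[OF far x] green_hess_zero[OF far x] by simp
qed

end

section \<open>Square integrable sources with compact support\<close>

text \<open>The complement of the essential support in the ball is a union of open sets on each of which \<open>J\<close> vanishes
  almost everywhere; by Lindelof's theorem countably many of them suffice.\<close>

lemma ess_support_radius:
  fixes J :: "real^3 \<Rightarrow> complex^3"
  assumes R: "R > 0" and K: "compact (ess_support (ball 0 R) J)"
  obtains r where "0 < r" "r < R" "AE y in lebesgue_on (ball 0 R). norm y \<le> r \<or> J y = 0"
proof -
  define K where "K = ess_support (ball 0 R) J"
  have KR: "K \<subseteq> ball 0 R" by (auto simp: K_def ess_support_def)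
  obtain r0 where r0: "r0 < R" "\<And>y. y \<in> K \<Longrightarrow> norm y \<le> r0"
  proof (cases "K = {}")
    case True
    then show ?thesis using R by (intro that[of "R / 2"]) auto
  next
    case False
    have "\<exists>z\<in>K. \<forall>y\<in>K. norm y \<le> norm z"
      by (rule continuous_attains_sup[OF K[folded K_def] False]) (intro continuous_intros)
    then obtain z where "z \<in> K" "\<forall>y\<in>K. norm y \<le> norm z" by blast
    then show ?thesis using KR by (intro that[of "norm z"]) auto
  qed
  \<comment> \<open>The maximum makes \<open>r\<close> positive when the support is empty or the origin.\<close>
  define r where "r = max r0 (R / 2)"
  have r: "0 < r" "r < R" using R r0 by (auto simp: r_def)
  define \<U> where "\<U> = {U. open U \<and> (AE y in lebesgue_on (ball 0 R). y \<in> U \<longrightarrow> J y = 0)}"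
  obtain \<V> where V: "\<V> \<subseteq> \<U>" "countable \<V>" "\<Union>\<V> = \<Union>\<U>"
    using Lindelof[of \<U>] by (auto simp: \<U>_def)
  have "\<forall>U\<in>\<V>. AE y in lebesgue_on (ball 0 R). y \<in> U \<longrightarrow> J y = 0"
    using V(1) by (auto simp: \<U>_def)
  then have "AE y in lebesgue_on (ball 0 R). \<forall>U\<in>\<V>. y \<in> U \<longrightarrow> J y = 0"
    unfolding AE_ball_countable[OF V(2)] .
  then have "AE y in lebesgue_on (ball 0 R). norm y \<le> r \<or> J y = 0"
  proof (rule AE_mp, intro AE_I2 impI)
    fix y assume y: "y \<in> space (lebesgue_on (ball 0 R))" and *: "\<forall>U\<in>\<V>. y \<in> U \<longrightarrow> J y = 0"
    show "norm y \<le> r \<or> J y = 0"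
    proof (cases "y \<in> K")
      case True then show ?thesis using r0(2)[of y] by (auto simp: r_def le_max_iff_disj)
    next
      case False
      then have "y \<in> \<Union>\<U>" using y by (auto simp: K_def ess_support_def \<U>_def)
      then show ?thesis using * V(3) by auto
    qed
  qed
  with r show ?thesis by (rule that)
qed

lemma L2_on_integrable:
  assumes "J \<in> L2_on (ball 0 R)"
  shows "integrable (lebesgue_on (ball 0 R)) J"
proof (rule Bochner_Integration.integrable_bound)
  interpret finite_measure "lebesgue_on (ball (0::real^3) R)" by (intro finite_measure_lebesgue_on) auto
  show "integrable (lebesgue_on (ball 0 R)) (\<lambda>y. 1 + (norm (J y))\<^sup>2)"
    using assms by (auto simp: L2_on_def)
  show "J \<in> borel_measurable (lebesgue_on (ball 0 R))" using assms by (simp add: L2_on_def)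
  have "norm v \<le> norm (1 + (norm v)\<^sup>2)" for v :: "complex^3"
  proof -
    have "0 \<le> (norm v - 1 / 2)\<^sup>2 + 3 / 4" by simp
    then have "norm v \<le> 1 + (norm v)\<^sup>2" by (simp add: power2_eq_square algebra_simps)
    then show ?thesis by simp
  qed
  then show "AE y in lebesgue_on (ball 0 R). norm (J y) \<le> norm (1 + (norm (J y))\<^sup>2)" by simp
qed

lemma integrable_vec:
  fixes v :: "'a \<Rightarrow> complex^3"
  assumes "\<And>i. integrable M (\<lambda>y. v y $ i)"
  shows "integrable M v"
proof -
  have "v y = (\<Sum>i\<in>UNIV. (\<chi> j. if j = i then v y $ i else 0))" for y by (simp add: vec_eq_iff)
  moreover have "integrable M (\<lambda>y. \<Sum>i\<in>UNIV. (\<chi> j. if j = i then v y $ i else 0))"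
  proof (intro Bochner_Integration.integrable_sum)
    fix i
    have "bounded_linear (\<lambda>c::complex. (\<chi> j. if j = i then c else 0) :: complex^3)"
    proof (rule bounded_linear_intro[of _ 1])
      fix c :: complex
      have "norm ((\<chi> j. if j = i then c else 0) :: complex^3) \<le> (\<Sum>j\<in>UNIV. norm (((\<chi> j. if j = i then c else 0) :: complex^3) $ j))"
        unfolding norm_vec_def by (rule L2_set_le_sum) simp
      also have "\<dots> = (\<Sum>j\<in>UNIV. if j = i then norm c else 0)" by (intro sum.cong) auto
      also have "\<dots> = norm c" by simp
      finally show "norm ((\<chi> j. if j = i then c else 0) :: complex^3) \<le> norm c * 1" by simp
    qed (auto simp: vec_eq_iff)
    from integrable_bounded_linear[OF this assms[of i]] show "integrable M (\<lambda>y. (\<chi> j. if j = i then v y $ i else 0) :: complex^3)" .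
  qed
  ultimately show ?thesis by simp
qed

lemma integral_vec_nth:
  fixes v :: "'a \<Rightarrow> complex^3"
  assumes "\<And>i. integrable M (\<lambda>y. v y $ i)"
  shows "(\<integral>y. v y \<partial>M) $ i = (\<integral>y. v y $ i \<partial>M)"
  using integral_bounded_linear[OF bounded_linear_vec_nth integrable_vec[OF assms], of i] by simp

lemma sums_vec:
  fixes v :: "nat \<Rightarrow> complex^3"
  assumes "\<And>i. (\<lambda>n. v n $ i) sums (w $ i)"
  shows "v sums w"
  unfolding sums_def by (rule vec_tendstoI) (use assms in \<open>simp add: sums_def\<close>)

lemma complexify_polydisc: "norm y \<le> R \<Longrightarrow> complexify y \<in> polydisc R"
  using component_le_norm_cart[of y] by (auto simp: polydisc_def complexify_def intro: order_trans)

lemma AE_ball_nonzero: "AE y in lebesgue_on (ball (0::real^3) R). y \<noteq> 0"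
proof -
  have "AE y in (lebesgue :: (real^3) measure). y \<noteq> 0" by (intro AE_completion AE_lborel_singleton)
  then have "AE y in (lebesgue :: (real^3) measure). y \<in> ball 0 R \<longrightarrow> y \<noteq> 0" by eventually_elim simp
  then show ?thesis by (simp add: AE_restrict_space_iff)
qed

locale ball_source =
  fixes \<kappa> R r :: real and J :: "real^3 \<Rightarrow> complex^3"
  assumes \<kappa>: "\<kappa> > 0" and r: "0 < r" "r < R"
    and J: "integrable (lebesgue_on (ball 0 R)) J"
    and supp: "AE y in lebesgue_on (ball 0 R). norm y \<le> r \<or> J y = 0"
begin

abbreviation "N \<equiv> lebesgue_on (ball (0 :: real^3) R)"

lemma J_nth: "integrable N (\<lambda>y. J y $ s)"
  using integrable_bounded_linear[OF bounded_linear_vec_nth J] by simp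

lemma measurable_N: "continuous_on (ball 0 R) g \<Longrightarrow> g \<in> borel_measurable N"
  by (rule continuous_imp_measurable_on_sets_lebesgue) auto

lemma J_nth_measurable: "(\<lambda>y. J y $ s) \<in> borel_measurable N"
  using J_nth by simp

lemma lebesgue_on_cball: "lebesgue_on (cball (0::real^3) r) = restrict_space N (cball 0 r)"
proof -
  have "ball (0::real^3) R \<inter> cball 0 r = cball 0 r" using r by auto
  then show ?thesis by (subst restrict_restrict_space) auto
qed

lemma cball_N: "cball 0 r \<in> sets N" "cball 0 r \<inter> space N \<in> sets N"
proof -
  show "cball 0 r \<in> sets N"
    using r by (auto simp: sets_restrict_space intro!: image_eqI[of _ _ "cball 0 r"])
  moreover have "cball (0::real^3) r \<inter> space N = cball 0 r" using r by auto
  ultimately show "cball 0 r \<inter> space N \<in> sets N" by simp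
qed

lemma AE_indicator: "AE y in N. indicator (cball 0 r) y *\<^sub>R (k y * J y $ s) = k y * J y $ s"
  using supp by (rule AE_mp) (auto intro!: AE_I2 simp: indicator_def)

lemma integral_cball:
  assumes "k \<in> borel_measurable N"
  shows "(\<integral>y. k y * J y $ s \<partial>lebesgue_on (cball 0 r)) = (\<integral>y. k y * J y $ s \<partial>N)"
proof -
  have m: "(\<lambda>y. k y * J y $ s) \<in> borel_measurable N" using assms J_nth_measurable by measurable
  show ?thesis
    unfolding lebesgue_on_cball integral_restrict_space[OF cball_N(2)]
  proof (rule integral_cong_AE[OF _ m AE_indicator])
    show "(\<lambda>y. indicat_real (cball 0 r) y *\<^sub>R (k y * J y $ s)) \<in> borel_measurable N"
      using cball_N(1) m by measurable
  qed
qed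

lemma integrable_kernel:
  assumes k: "k \<in> borel_measurable N" and b: "\<And>y. y \<in> cball 0 r \<Longrightarrow> cmod (k y) \<le> B"
  shows "integrable N (\<lambda>y. k y * J y $ s)"
proof (rule Bochner_Integration.integrable_bound)
  show "integrable N (\<lambda>y. B * norm (J y $ s))" using J_nth by simp
  show "(\<lambda>y. k y * J y $ s) \<in> borel_measurable N" using k J_nth_measurable by measurable
  show "AE y in N. norm (k y * J y $ s) \<le> norm (B * norm (J y $ s))"
    using supp
  proof (rule AE_mp, intro AE_I2 impI)
    fix y assume "norm y \<le> r \<or> J y = 0"
    then show "norm (k y * J y $ s) \<le> norm (B * norm (J y $ s))"
      using b[of y] by (cases "J y = 0") (auto simp: norm_mult intro!: mult_right_mono order_trans[OF _ abs_ge_self])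
  qed
qed

lemma source_comp: "source_in_ball \<kappa> r (\<lambda>y. J y $ s)"
proof
  show "integrable (lebesgue_on (cball 0 r)) (\<lambda>y. J y $ s)"
    unfolding lebesgue_on_cball integrable_restrict_space[OF cball_N(2)]
    by (rule integrable_mult_indicator[OF cball_N(1) J_nth])
qed (use \<kappa> r in auto)

text \<open>The Fourier transform of the source on the sphere of radius \<open>\<kappa>\<close>.\<close>

definition J_hat :: "real^3 \<Rightarrow> 3 \<Rightarrow> complex" where
  "J_hat x s = (\<integral>y. exp (- \<i> * of_real (\<kappa> * (x \<bullet> y))) * J y $ s \<partial>N)"

lemma J_hat_cball: "(\<integral>y. exp (- \<i> * of_real \<kappa> * of_real (x \<bullet> y)) * J y $ s \<partial>lebesgue_on (cball 0 r)) = J_hat x s"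
  unfolding J_hat_def by (subst integral_cball) (auto intro!: measurable_N continuous_intros simp: mult.assoc)

lemma plane_wave_integrable: "integrable N (\<lambda>y. exp (- \<i> * of_real (\<kappa> * (x \<bullet> y))) * J y $ s)"
  by (rule integrable_kernel[where B = 1]) (auto intro!: measurable_N continuous_intros)

lemma far_field_nth: "far_field \<kappa> R J x $ l = (\<Sum>s\<in>UNIV. of_real ((if l = s then 1 else 0) - x $ l * x $ s) * J_hat x s)"
proof -
  have "(\<integral>y. exp (- \<i> * of_real (\<kappa> * (x \<bullet> y))) *s J y \<partial>N) $ s = J_hat x s" for s
    using plane_wave_integrable by (subst integral_vec_nth) (simp_all add: J_hat_def)
  then show ?thesis unfolding far_field_def by (simp add: matrix_vector_mult_def G_hat_def)
qed

lemma electric_field_nth: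
  assumes x: "x \<notin> ball 0 R"
  shows "electric_field \<kappa> R J x $ l = (\<Sum>s\<in>UNIV. \<integral>y. green_entry \<kappa> l s x y * J y $ s \<partial>lebesgue_on (cball 0 r))"
proof -
  have ne: "x \<noteq> y" if "y \<in> ball 0 R" for y using x that by auto
  have cont: "continuous_on (ball 0 R) (\<lambda>y. green_entry \<kappa> l s x y)" for l s
  proof -
    have "continuous_on (ball 0 R) (\<lambda>y. green_fun \<kappa> x y)" "continuous_on (ball 0 R) (\<lambda>y. green_hess \<kappa> l s x y)"
      by (intro continuous_on_green continuous_intros ne; assumption)+
    note c = this
    have c0: "continuous_on (ball 0 R) (\<lambda>y. if l = s then green_fun \<kappa> x y else 0)" using c(1) by (cases "l = s") auto
    show ?thesis unfolding green_entry_def by (rule continuous_on_add[OF c0 continuous_on_mult[OF continuous_on_const c(2)]])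
  qed
  have int: "integrable N (\<lambda>y. green_entry \<kappa> l s x y * J y $ s)" for l s
  proof -
    have "continuous_on (cball 0 r) (\<lambda>y. green_entry \<kappa> l s x y)"
      by (rule continuous_on_subset[OF cont]) (use r in auto)
    then obtain B where "\<And>y. y \<in> cball 0 r \<Longrightarrow> cmod (green_entry \<kappa> l s x y) \<le> B"
      using compact_bound[OF compact_cball] by blast
    then show ?thesis by (rule integrable_kernel[OF measurable_N[OF cont]])
  qed
  have "(\<integral>y. green_tensor \<kappa> x y *v J y \<partial>N) = (\<integral>y. (\<chi> l. \<Sum>s\<in>UNIV. green_entry \<kappa> l s x y * J y $ s) \<partial>N)"
    by (intro Bochner_Integration.integral_cong refl)
       (simp add: matrix_vector_mult_def green_tensor_entry ne)
  then have "electric_field \<kappa> R J x $ l = (\<integral>y. (\<Sum>s\<in>UNIV. green_entry \<kappa> l s x y * J y $ s) \<partial>N)"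
    unfolding electric_field_def using int by (simp add: integral_vec_nth)
  also have "\<dots> = (\<Sum>s\<in>UNIV. \<integral>y. green_entry \<kappa> l s x y * J y $ s \<partial>N)"
    by (rule Bochner_Integration.integral_sum) (rule int)
  finally show ?thesis by (simp add: integral_cball[OF measurable_N[OF cont]])
qed

lemma nonradiating_imp_far_field_zero:
  assumes "nonradiating \<kappa> R J" and x: "norm x = 1"
  shows "far_field \<kappa> R J x = 0"
proof -
  have "far_field \<kappa> R J x $ l = 0" for l
  proof -
    define c where "c n = of_real (4 * pi * real n) * exp (- \<i> * of_real (\<kappa> * real n))" for n
    have "(\<lambda>n. c n * (\<integral>y. green_entry \<kappa> l s (real n *\<^sub>R x) y * J y $ s \<partial>lebesgue_on (cball 0 r))) \<longlonglongrightarrow>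
       of_real ((if l = s then 1 else 0) - x $ l * x $ s) * J_hat x s" for s
      using source_in_ball.green_entry_asymptotic[OF source_comp x, of l s s] unfolding J_hat_cball c_def .
    then have "(\<lambda>n. \<Sum>s\<in>UNIV. c n * (\<integral>y. green_entry \<kappa> l s (real n *\<^sub>R x) y * J y $ s \<partial>lebesgue_on (cball 0 r))) \<longlonglongrightarrow> far_field \<kappa> R J x $ l"
      unfolding far_field_nth by (intro tendsto_sum)
    moreover have "\<forall>\<^sub>F n in sequentially. (\<Sum>s\<in>UNIV. c n * (\<integral>y. green_entry \<kappa> l s (real n *\<^sub>R x) y * J y $ s \<partial>lebesgue_on (cball 0 r))) = 0"
      using eventually_ge_at_top[of "nat \<lceil>R\<rceil>"]
    proof eventually_elim
      case (elim n)
      then have out: "real n *\<^sub>R x \<notin> ball 0 R" using x by (simp add: nat_le_iff ceiling_le_iff)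
      have "electric_field \<kappa> R J (real n *\<^sub>R x) $ l = 0"
        using assms(1) out by (simp add: nonradiating_def)
      then show ?case unfolding electric_field_nth[OF out] sum_distrib_left[symmetric] by simp
    qed
    ultimately have "(\<lambda>n::nat. 0) \<longlonglongrightarrow> far_field \<kappa> R J x $ l" by (rule Lim_transform_eventually)
    then show ?thesis using LIMSEQ_unique tendsto_const by blast
  qed
  then show ?thesis by (simp add: vec_eq_iff)
qed

lemma J_hat_zero_imp_nonradiating:
  assumes "\<And>x s. norm x = 1 \<Longrightarrow> J_hat x s = 0"
  shows "nonradiating \<kappa> R J"
  unfolding nonradiating_def
proof (intro allI impI)
  fix x :: "real^3" assume x: "x \<notin> ball 0 R"
  then have nx: "norm x > r" using r by simp
  have "electric_field \<kappa> R J x $ l = 0" for l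
  proof -
    have "(\<integral>y. green_entry \<kappa> l s x y * J y $ s \<partial>lebesgue_on (cball 0 r)) = 0" for s
      by (rule source_in_ball.green_entry_zero[OF source_comp _ nx]) (simp only: J_hat_cball assms)
    then show ?thesis unfolding electric_field_nth[OF x] by simp
  qed
  then show "electric_field \<kappa> R J x = 0" by (simp add: vec_eq_iff)
qed

lemma entire_integrable:
  assumes "F \<in> entire_class \<kappa>"
  shows "integrable N (\<lambda>y. F (complexify y) * J y $ s)"
proof -
  have c: "continuous_on S (\<lambda>y. F (complexify y))" for S
    by (rule continuous_on_compose2[OF entire_continuous[OF assms, of UNIV] continuous_on_complexify]) auto
  obtain B where "\<And>y. y \<in> cball 0 r \<Longrightarrow> cmod (F (complexify y)) \<le> B" using compact_bound[OF compact_cball c] by blast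
  then show ?thesis by (rule integrable_kernel[OF measurable_N[OF c]])
qed

lemma normally_sums_integral:
  assumes "normally_sums \<kappa> F G"
  shows "(\<lambda>n. \<integral>y. F n (complexify y) * J y $ s \<partial>N) sums (\<integral>y. G (complexify y) * J y $ s \<partial>N)"
proof -
  note E = assms[unfolded normally_sums_def, THEN conjunct1, rule_format]
  note S = assms[unfolded normally_sums_def, THEN conjunct2, THEN conjunct1, rule_format]
  obtain B where B: "summable B" "\<And>n z. z \<in> polydisc R \<Longrightarrow> cmod (F n z) \<le> B n"
    using assms[unfolded normally_sums_def, THEN conjunct2, THEN conjunct2, rule_format, of R] by blast
  have b: "cmod (F n (complexify y) * J y $ s) \<le> B n * cmod (J y $ s)" if "y \<in> space N" for n y
    unfolding norm_mult using that by (intro mult_right_mono B(2) complexify_polydisc) auto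
  have "(\<lambda>n. \<integral>y. F n (complexify y) * J y $ s \<partial>N) sums (\<integral>y. (\<Sum>n. F n (complexify y) * J y $ s) \<partial>N)"
  proof (rule sums_integral[OF entire_integrable[OF E]])
    show "AE y in N. summable (\<lambda>n. norm (F n (complexify y) * J y $ s))"
    proof (rule AE_I2)
      fix y assume "y \<in> space N"
      then show "summable (\<lambda>n. norm (F n (complexify y) * J y $ s))"
        by (intro summable_comparison_test'[OF summable_mult2[OF B(1), of "cmod (J y $ s)"]]) (simp only: real_norm_def abs_norm_cancel b)
    qed
    show "summable (\<lambda>n. \<integral>y. norm (F n (complexify y) * J y $ s) \<partial>N)"
    proof (rule summable_comparison_test'[OF summable_mult2[OF B(1), of "\<integral>y. norm (J y $ s) \<partial>N"]])
      fix n
      have "(\<integral>y. norm (F n (complexify y) * J y $ s) \<partial>N) \<le> (\<integral>y. B n * norm (J y $ s) \<partial>N)"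
        using J_nth by (intro integral_mono integrable_norm entire_integrable[OF E] b) auto
      then show "norm (\<integral>y. norm (F n (complexify y) * J y $ s) \<partial>N) \<le> B n * (\<integral>y. norm (J y $ s) \<partial>N)"
        by (simp add: integral_nonneg_AE)
    qed
  qed
  moreover have "(\<Sum>n. F n (complexify y) * J y $ s) = G (complexify y) * J y $ s" for y
    by (rule sums_unique[symmetric]) (rule sums_mult2[OF S])
  ultimately show ?thesis by simp
qed

lemma integral_nonzero_cong:
  assumes F: "F \<in> entire_class \<kappa>" and eq: "\<And>y. y \<noteq> 0 \<Longrightarrow> k y = F (complexify y)"
  shows "integrable N (\<lambda>y. k y * J y $ s)"
    and "(\<integral>y. k y * J y $ s \<partial>N) = (\<integral>y. F (complexify y) * J y $ s \<partial>N)"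
proof -
  have c: "continuous_on (ball 0 R) (\<lambda>y. F (complexify y))"
    by (rule continuous_on_compose2[OF entire_continuous[OF F, of UNIV] continuous_on_complexify]) auto
  have Fm: "(\<lambda>y. F (complexify y)) \<in> borel_measurable N" by (rule measurable_N[OF c])
  have "{0} \<in> sets N"
    using r by (auto simp: sets_restrict_space intro!: image_eqI[of _ _ "{0}"])
  then have m0: "Measurable.pred N (\<lambda>y. y \<in> {0})" by measurable
  have "k = (\<lambda>y. if y \<in> {0} then k 0 else F (complexify y))" using eq by auto
  moreover have "(\<lambda>y. if y \<in> {0} then k 0 else F (complexify y)) \<in> borel_measurable N"
    using m0 Fm by measurable
  ultimately have km: "k \<in> borel_measurable N" by simp
  have ae: "AE y in N. F (complexify y) * J y $ s = k y * J y $ s"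
    using AE_ball_nonzero by (rule AE_mp) (auto simp: eq)
  have m: "(\<lambda>y. F (complexify y) * J y $ s) \<in> borel_measurable N" "(\<lambda>y. k y * J y $ s) \<in> borel_measurable N"
    using km Fm J_nth_measurable by measurable
  show "integrable N (\<lambda>y. k y * J y $ s)"
    using integrable_cong_AE[OF m ae] entire_integrable[OF F] by simp
  show "(\<integral>y. k y * J y $ s \<partial>N) = (\<integral>y. F (complexify y) * J y $ s \<partial>N)"
    using integral_cong_AE[OF m ae] by simp
qed

lemma wave_term_entire: "wave_term \<kappa> x n \<in> entire_class \<kappa>"
  using wave_term_normally_sums unfolding normally_sums_def by blast

definition mode_weight :: "real^3 \<Rightarrow> nat \<Rightarrow> int \<Rightarrow> complex" where
  "mode_weight x n m = 4 * pi * ((- \<i>) ^ n * sph_harmonic n m x)"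

lemma wave_fun_modes:
  assumes "norm x = 1" "y \<noteq> 0"
  shows "(\<Sum>m\<in>{- int n..int n}. mode_weight x n m * wave_fun \<kappa> n m y) = wave_term \<kappa> x n (complexify y)"
  unfolding wave_fun_addition[OF assms, symmetric] mode_weight_def by (simp add: sum_distrib_left mult.assoc)

lemma alpha_coeff_nth: "alpha_coeff \<kappa> R J n m $ s = (\<integral>y. wave_fun \<kappa> n m y * J y $ s \<partial>N)"
  and wave_fun_integrable: "integrable N (\<lambda>y. wave_fun \<kappa> n m y * J y $ s)"
proof -
  obtain F where F: "F \<in> entire_class \<kappa>" "\<forall>y. y \<noteq> 0 \<longrightarrow> wave_fun \<kappa> n m y = F (complexify y)"
    using wave_fun_entire by (rule bexE)
  have int: "integrable N (\<lambda>y. wave_fun \<kappa> n m y * J y $ s)" for s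
    by (rule integral_nonzero_cong(1)[OF F(1)]) (use F(2) in simp)
  then show "integrable N (\<lambda>y. wave_fun \<kappa> n m y * J y $ s)" .
  show "alpha_coeff \<kappa> R J n m $ s = (\<integral>y. wave_fun \<kappa> n m y * J y $ s \<partial>N)"
    unfolding alpha_coeff_def using int by (subst integral_vec_nth) simp_all
qed

lemma J_hat_series:
  assumes x: "norm x = 1"
  shows "(\<lambda>n. \<Sum>m\<in>{- int n..int n}. mode_weight x n m * alpha_coeff \<kappa> R J n m $ s) sums J_hat x s"
proof -
  have "(\<Sum>m\<in>{- int n..int n}. mode_weight x n m * alpha_coeff \<kappa> R J n m $ s) = (\<integral>y. wave_term \<kappa> x n (complexify y) * J y $ s \<partial>N)" for n
  proof -
    have "(\<Sum>m\<in>{- int n..int n}. mode_weight x n m * alpha_coeff \<kappa> R J n m $ s) =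
        (\<Sum>m\<in>{- int n..int n}. \<integral>y. mode_weight x n m * (wave_fun \<kappa> n m y * J y $ s) \<partial>N)"
      by (simp add: alpha_coeff_nth)
    also have "\<dots> = (\<integral>y. (\<Sum>m\<in>{- int n..int n}. mode_weight x n m * (wave_fun \<kappa> n m y * J y $ s)) \<partial>N)"
      by (rule Bochner_Integration.integral_sum[symmetric]) (intro integrable_mult_right wave_fun_integrable)
    also have "\<dots> = (\<integral>y. (\<Sum>m\<in>{- int n..int n}. mode_weight x n m * wave_fun \<kappa> n m y) * J y $ s \<partial>N)"
      by (simp add: sum_distrib_right mult.assoc)
    also have "\<dots> = (\<integral>y. wave_term \<kappa> x n (complexify y) * J y $ s \<partial>N)"
      by (rule integral_nonzero_cong(2)[OF wave_term_entire wave_fun_modes[OF x]])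
    finally show ?thesis .
  qed
  moreover have "J_hat x s = (\<integral>y. exp (- \<i> * (of_real \<kappa> * cdot (complexify x) (complexify y))) * J y $ s \<partial>N)"
    unfolding J_hat_def plane_wave_complexify ..
  ultimately show ?thesis using normally_sums_integral[OF wave_term_normally_sums, of x s] by simp
qed

lemma far_field_series:
  assumes x: "norm x = 1"
  shows "(\<lambda>n. (4 * pi) *\<^sub>R (\<Sum>m\<in>{- int n..int n}.
      ((- \<i>) ^ n * sph_harmonic n m x) *s (G_hat x *v alpha_coeff \<kappa> R J n m))) sums far_field \<kappa> R J x"
proof (rule sums_vec)
  fix l
  define g where "g s = complex_of_real ((if l = s then 1 else 0) - x $ l * x $ s)" for s
  have "((4 * pi) *\<^sub>R (\<Sum>m\<in>{- int n..int n}. ((- \<i>) ^ n * sph_harmonic n m x) *s (G_hat x *v alpha_coeff \<kappa> R J n m))) $ l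
     = (\<Sum>s\<in>UNIV. g s * (\<Sum>m\<in>{- int n..int n}. mode_weight x n m * alpha_coeff \<kappa> R J n m $ s))" for n
  proof -
    have "((4 * pi) *\<^sub>R (\<Sum>m\<in>{- int n..int n}. ((- \<i>) ^ n * sph_harmonic n m x) *s (G_hat x *v alpha_coeff \<kappa> R J n m))) $ l
      = (\<Sum>m\<in>{- int n..int n}. \<Sum>s\<in>UNIV. g s * (mode_weight x n m * alpha_coeff \<kappa> R J n m $ s))"
      unfolding vector_scaleR_component
      unfolding scaleR_conv_of_real
      by (simp add: matrix_vector_mult_def G_hat_def g_def mode_weight_def sum_distrib_left mult_ac)
    also have "\<dots> = (\<Sum>s\<in>UNIV. \<Sum>m\<in>{- int n..int n}. g s * (mode_weight x n m * alpha_coeff \<kappa> R J n m $ s))"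
      by (rule sum.swap)
    finally show ?thesis by (simp only: sum_distrib_left)
  qed
  moreover have "(\<lambda>n. \<Sum>s\<in>UNIV. g s * (\<Sum>m\<in>{- int n..int n}. mode_weight x n m * alpha_coeff \<kappa> R J n m $ s)) sums (far_field \<kappa> R J x $ l)"
    unfolding far_field_nth g_def[symmetric] by (intro sums_sum sums_mult J_hat_series x)
  ultimately show "(\<lambda>n. ((4 * pi) *\<^sub>R (\<Sum>m\<in>{- int n..int n}. ((- \<i>) ^ n * sph_harmonic n m x) *s (G_hat x *v alpha_coeff \<kappa> R J n m))) $ l)
     sums (far_field \<kappa> R J x $ l)" by simp
qed

lemma gamma_coeff_nth:
  assumes F: "F \<in> entire_class \<kappa>" "\<And>y. y \<noteq> 0 \<Longrightarrow> wave_fun \<kappa> n m y = F (complexify y)"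
  shows "gamma_coeff \<kappa> R J n m $ l =
     (1 / \<kappa>\<^sup>2) *\<^sub>R (\<Sum>s\<in>UNIV. \<integral>y. cpartial l (cpartial s F) (complexify y) * J y $ s \<partial>N)"
proof -
  have D: "cpartial l (cpartial s F) \<in> entire_class \<kappa>" for l s by (intro entire_cpartial F)
  have H: "hessian (wave_fun \<kappa> n m) y $ l $ s = cpartial l (cpartial s F) (complexify y)" if "y \<noteq> 0" for l s y
  proof -
    have "hessian (wave_fun \<kappa> n m) y = hessian (\<lambda>y. F (complexify y)) y"
      by (rule hessian_local[of "- {0}"]) (use that F(2) in auto)
    then show ?thesis using hessian_entire[OF F(1)] by simp
  qed
  have I1: "integrable N (\<lambda>y. hessian (wave_fun \<kappa> n m) y $ l $ s * J y $ s)" for l s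
    by (rule integral_nonzero_cong(1)[OF D H])
  have I2: "(\<integral>y. hessian (wave_fun \<kappa> n m) y $ l $ s * J y $ s \<partial>N) = (\<integral>y. cpartial l (cpartial s F) (complexify y) * J y $ s \<partial>N)" for l s
    by (rule integral_nonzero_cong(2)[OF D H])
  have "integrable N (\<lambda>y. (hessian (wave_fun \<kappa> n m) y *v J y) $ l)" for l
    unfolding matrix_vector_mult_def vec_lambda_beta by (intro Bochner_Integration.integrable_sum I1)
  then have "gamma_coeff \<kappa> R J n m $ l = (1 / \<kappa>\<^sup>2) *\<^sub>R (\<integral>y. (hessian (wave_fun \<kappa> n m) y *v J y) $ l \<partial>N)"
    unfolding gamma_coeff_def by (simp add: integral_vec_nth)
  also have "(\<integral>y. (hessian (wave_fun \<kappa> n m) y *v J y) $ l \<partial>N) =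
      (\<Sum>s\<in>UNIV. \<integral>y. cpartial l (cpartial s F) (complexify y) * J y $ s \<partial>N)"
  proof -
    have "(\<integral>y. (hessian (wave_fun \<kappa> n m) y *v J y) $ l \<partial>N) = (\<Sum>s\<in>UNIV. \<integral>y. hessian (wave_fun \<kappa> n m) y $ l $ s * J y $ s \<partial>N)"
      unfolding matrix_vector_mult_def vec_lambda_beta by (rule Bochner_Integration.integral_sum) (rule I1)
    then show ?thesis by (simp only: I2)
  qed
  finally show ?thesis .
qed

text \<open>The Hessian of the plane wave is \<open>- \<kappa>\<^sup>2 x x\<^sup>T\<close> times the plane wave. Applying the Hessian to its
  expansion term by term and integrating against the source produces combinations of the \<open>\<gamma>\<close>'s, so
  \<open>x (x \<bullet> J_hat x) = 0\<close>.\<close>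

lemma gamma_zero_imp_transversal:
  assumes \<gamma>: "\<And>n m. m \<in> {- int n..int n} \<Longrightarrow> gamma_coeff \<kappa> R J n m = 0" and x: "norm x = 1"
  shows "(\<Sum>s\<in>UNIV. of_real (x $ s) * J_hat x s) = 0"
proof -
  have term_zero: "(\<Sum>s\<in>UNIV. \<integral>y. cpartial l (cpartial s (wave_term \<kappa> x n)) (complexify y) * J y $ s \<partial>N) = 0" for n l
  proof -
    define I where "I = {- int n..int n}"
    have "\<forall>m. \<exists>F. F \<in> entire_class \<kappa> \<and> (\<forall>y. y \<noteq> 0 \<longrightarrow> wave_fun \<kappa> n m y = F (complexify y))"
      by (rule allI) (rule wave_fun_entire[unfolded Bex_def])
    from choice[OF this] obtain F where
      "\<forall>m. F m \<in> entire_class \<kappa> \<and> (\<forall>y. y \<noteq> 0 \<longrightarrow> wave_fun \<kappa> n m y = F m (complexify y))"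
      by (rule exE)
    then have F: "\<And>m. F m \<in> entire_class \<kappa>" "\<And>m y. y \<noteq> 0 \<Longrightarrow> wave_fun \<kappa> n m y = F m (complexify y)"
      by simp_all
    let ?D = "\<lambda>s m. cpartial l (cpartial s (F m))"
    have D: "?D s m \<in> entire_class \<kappa>" for s m by (intro entire_cpartial F)
    have comb: "(\<lambda>z. \<Sum>m\<in>I. mode_weight x n m * F m z) \<in> entire_class \<kappa>"
      by (rule entire_sum) (rule entire_mult[OF entire_const F(1)])
    have eq: "cpartial l (cpartial s (wave_term \<kappa> x n)) (complexify y) = (\<Sum>m\<in>I. mode_weight x n m * ?D s m (complexify y))"
      if y: "y \<noteq> 0" for s y
    proof -
      have "cpartial l (cpartial s (wave_term \<kappa> x n)) (complexify y) = hessian (\<lambda>y. wave_term \<kappa> x n (complexify y)) y $ l $ s"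
        by (rule hessian_entire[OF wave_term_entire, symmetric])
      also have "\<dots> = hessian (\<lambda>y. \<Sum>m\<in>I. mode_weight x n m * F m (complexify y)) y $ l $ s"
      proof -
        have "hessian (\<lambda>y. wave_term \<kappa> x n (complexify y)) y = hessian (\<lambda>y. \<Sum>m\<in>I. mode_weight x n m * F m (complexify y)) y"
          by (rule hessian_local[of "- {0}"]) (use y wave_fun_modes[OF x, of _ n] F(2) in \<open>auto simp: I_def\<close>)
        then show ?thesis by simp
      qed
      also have "\<dots> = cpartial l (cpartial s (\<lambda>z. \<Sum>m\<in>I. mode_weight x n m * F m z)) (complexify y)"
        by (rule hessian_entire[OF comb])
      also have "cpartial s (\<lambda>z. \<Sum>m\<in>I. mode_weight x n m * F m z) = (\<lambda>z. \<Sum>m\<in>I. mode_weight x n m * cpartial s (F m) z)"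
        by (intro ext cpartial_sum[where \<kappa> = \<kappa>] F) (simp add: I_def)
      also have "cpartial l (\<lambda>z. \<Sum>m\<in>I. mode_weight x n m * cpartial s (F m) z) (complexify y) = (\<Sum>m\<in>I. mode_weight x n m * ?D s m (complexify y))"
        by (intro cpartial_sum[where \<kappa> = \<kappa>] entire_cpartial F) (simp add: I_def)
      finally show ?thesis .
    qed
    have "(\<integral>y. cpartial l (cpartial s (wave_term \<kappa> x n)) (complexify y) * J y $ s \<partial>N) =
        (\<Sum>m\<in>I. mode_weight x n m * (\<integral>y. ?D s m (complexify y) * J y $ s \<partial>N))" for s
    proof -
      have "(\<integral>y. cpartial l (cpartial s (wave_term \<kappa> x n)) (complexify y) * J y $ s \<partial>N) =
          (\<integral>y. (\<Sum>m\<in>I. mode_weight x n m * ?D s m (complexify y)) * J y $ s \<partial>N)"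
        by (rule integral_nonzero_cong(2)[OF entire_sum[OF entire_mult[OF entire_const D]] eq])
      also have "\<dots> = (\<integral>y. (\<Sum>m\<in>I. mode_weight x n m * (?D s m (complexify y) * J y $ s)) \<partial>N)"
        by (simp add: sum_distrib_right mult.assoc)
      also have "\<dots> = (\<Sum>m\<in>I. \<integral>y. mode_weight x n m * (?D s m (complexify y) * J y $ s) \<partial>N)"
        by (rule Bochner_Integration.integral_sum) (intro integrable_mult_right entire_integrable D)
      finally show ?thesis by simp
    qed
    then have "(\<Sum>s\<in>UNIV. \<integral>y. cpartial l (cpartial s (wave_term \<kappa> x n)) (complexify y) * J y $ s \<partial>N) =
        (\<Sum>s\<in>UNIV. \<Sum>m\<in>I. mode_weight x n m * (\<integral>y. ?D s m (complexify y) * J y $ s \<partial>N))"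
      by simp
    also have "\<dots> = (\<Sum>m\<in>I. mode_weight x n m * (\<Sum>s\<in>UNIV. \<integral>y. ?D s m (complexify y) * J y $ s \<partial>N))"
      unfolding sum_distrib_left by (rule sum.swap)
    also have "\<dots> = 0"
    proof (rule sum.neutral, intro ballI)
      fix m assume "m \<in> I"
      then have "gamma_coeff \<kappa> R J n m $ l = 0" using \<gamma> by (simp add: I_def)
      then show "mode_weight x n m * (\<Sum>s\<in>UNIV. \<integral>y. ?D s m (complexify y) * J y $ s \<partial>N) = 0"
        using \<kappa> gamma_coeff_nth[of "F m" n m l, OF F(1) F(2)] by simp
    qed
    finally show ?thesis .
  qed
  define S where "S = (\<Sum>s\<in>UNIV. of_real (x $ s) * J_hat x s)"
  have "of_real (x $ l) * S = 0" for l
  proof -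
    let ?G = "\<lambda>z. exp (- \<i> * (of_real \<kappa> * cdot (complexify x) z))"
    have "(\<lambda>n. \<Sum>s\<in>UNIV. \<integral>y. cpartial l (cpartial s (wave_term \<kappa> x n)) (complexify y) * J y $ s \<partial>N) sums
        (\<Sum>s\<in>UNIV. \<integral>y. cpartial l (cpartial s ?G) (complexify y) * J y $ s \<partial>N)"
      by (intro sums_sum normally_sums_integral normally_sums_cpartial(1) wave_term_normally_sums)
    then have 0: "(\<Sum>s\<in>UNIV. \<integral>y. cpartial l (cpartial s ?G) (complexify y) * J y $ s \<partial>N) = 0"
      unfolding term_zero using sums_unique2 sums_zero by blast
    have "cpartial l (cpartial s ?G) (complexify y) = - of_real (\<kappa>\<^sup>2 * x $ l * x $ s) * exp (- \<i> * of_real (\<kappa> * (x \<bullet> y)))" for s y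
      unfolding hessian_normally_sums[OF wave_term_normally_sums, symmetric] plane_wave_complexify[symmetric]
      by (rule hessian_plane_wave)
    then have "(\<integral>y. cpartial l (cpartial s ?G) (complexify y) * J y $ s \<partial>N) = - of_real (\<kappa>\<^sup>2 * x $ l * x $ s) * J_hat x s" for s
      unfolding J_hat_def by (simp only: mult.assoc integral_mult_right_zero)
    then have "(\<Sum>s\<in>UNIV. - of_real (\<kappa>\<^sup>2 * x $ l * x $ s) * J_hat x s) = 0" using 0 by simp
    moreover have "(\<Sum>s\<in>UNIV. - of_real (\<kappa>\<^sup>2 * x $ l * x $ s) * J_hat x s) = - of_real (\<kappa>\<^sup>2) * (of_real (x $ l) * S)"
      unfolding S_def sum_distrib_left by (intro sum.cong) (simp_all add: mult_ac)
    ultimately show ?thesis using \<kappa> by simp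
  qed
  moreover have "\<exists>l. x $ l \<noteq> 0" using x by (metis norm_zero vec_eq_iff zero_index zero_neq_one)
  ultimately have "S = 0" by auto
  then show ?thesis by (simp add: S_def)
qed

lemma far_field_transversal:
  assumes "(\<Sum>s\<in>UNIV. of_real (x $ s) * J_hat x s) = 0"
  shows "far_field \<kappa> R J x $ l = J_hat x l"
proof -
  have "far_field \<kappa> R J x $ l = (\<Sum>s\<in>UNIV. (if l = s then J_hat x s else 0) - of_real (x $ l) * (of_real (x $ s) * J_hat x s))"
    unfolding far_field_nth by (intro sum.cong) (simp_all add: algebra_simps)
  also have "\<dots> = J_hat x l - of_real (x $ l) * (\<Sum>s\<in>UNIV. of_real (x $ s) * J_hat x s)"
    by (simp add: sum_subtractf sum_distrib_left)
  finally show ?thesis using assms by simp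
qed

end

theorem theorem3p4:
  fixes \<kappa> R :: real and J :: "real^3 \<Rightarrow> complex^3"
  assumes "\<kappa> > 0" and "R > 0"
    and "J \<in> L2_on (ball 0 R)"
    and "compact (ess_support (ball 0 R) J)"
    and "\<And>n m. m \<in> {- int n..int n} \<Longrightarrow> gamma_coeff \<kappa> R J n m = 0"
  shows "(\<forall>x. norm x = 1 \<longrightarrow>
            (\<lambda>n. (4 * pi) *\<^sub>R (\<Sum>m\<in>{- int n..int n}.
               ((- \<i>) ^ n * sph_harmonic n m x) *s (G_hat x *v alpha_coeff \<kappa> R J n m)))
            sums far_field \<kappa> R J x)
       \<and> (nonradiating \<kappa> R J \<longleftrightarrow> (\<forall>x. norm x = 1 \<longrightarrow> far_field \<kappa> R J x = 0))"
proof -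
  obtain r where r: "0 < r" "r < R" "AE y in lebesgue_on (ball 0 R). norm y \<le> r \<or> J y = 0"
    using ess_support_radius[OF assms(2,4)] by blast
  interpret ball_source \<kappa> R r J
    by unfold_locales (use assms r L2_on_integrable in auto)
  have "nonradiating \<kappa> R J" if far: "\<forall>x. norm x = 1 \<longrightarrow> far_field \<kappa> R J x = 0"
  proof (rule J_hat_zero_imp_nonradiating)
    fix x :: "real^3" and s assume x: "norm x = 1"
    show "J_hat x s = 0"
      using far_field_transversal[OF gamma_zero_imp_transversal[OF assms(5) x], of s] far x by simp
  qed
  then show ?thesis using far_field_series nonradiating_imp_far_field_zero by blast
qed

end
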